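(* Let $M\ge2$ be an integer, let $\nu_1,\ldots,\nu_M\ge0$ be fixed integers (with $\nu_0=0$), and let $\kappa>\nu_1$ be a fixed integer. Let $K_n(x,y)$ be the correlation kernel of the squared singular values of the product of $M-1$ Ginibre matrices with one truncated unitary matrix given by the double contour integral in the context. Set $$x_*=\frac{(M+1)^{\frac{M+1}{2}}}{2(M-1)^{\frac{M-1}{2}}},\qquad c_2=\frac{(M+1)^{\frac{M+1}{2}}}{2^{\frac43}(M-1)^{\frac M2-\frac76}}.$$ Then $$\lim_{n\to\infty}\exp\left\{\left(\frac n2\right)^{\frac13}(M+1)^{\frac12}(M-1)^{\frac16}(\eta-\xi)\right\}\,n^{M-\frac53}\,c_2\,K_n\left(n^{M-1}\left(x_*+\frac{c_2\xi}{n^{\frac23}}\right),\,n^{M-1}\left(x_*+\frac{c_2\eta}{n^{\frac23}}\right)\right)=K_{\mathrm{Ai}}(\xi,\eta)$$ uniformly for $\xi$ and $\eta$ in any compact subset of $\mathbb{R}$, where $K_{\mathrm{Ai}}$ is the Airy kernel.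
   Context: Setting: $Y=X_M\cdots X_2V$, where $X_i$ ($i=2,\ldots,M$) are independent complex Ginibre matrices (i.i.d. standard complex Gaussian entries) of size $(n+\nu_i)\times(n+\nu_{i-1})$, $\nu_i\ge0$, and $V$, independent of them, is the $(n+\nu_1)\times n$ left upper block of an $l\times l$ Haar distributed unitary matrix with $l\ge2n+\nu_1$. Put $\nu_0=0$ and $\kappa=l+1-2n>\nu_1$; $\kappa$ is kept fixed, so $l=2n+\kappa-1$ varies with $n$. The squared singular values of $Y$ form a determinantal point process on $(0,\infty)$ with correlation kernel, for $x,y>0$, $$K_n(x,y)=\frac{1}{(2\pi i)^2}\int_{-1/2-i\infty}^{-1/2+i\infty}ds\oint_\Sigma dt\,\prod_{j=0}^M\frac{\Gamma(s+\nu_j+1)}{\Gamma(t+\nu_j+1)}\,\frac{\Gamma(t-n+1)}{\Gamma(s-n+1)}\,\frac{\Gamma(t+n+\kappa)}{\Gamma(s+n+\kappa)}\,\frac{x^ty^{-s-1}}{s-t},$$ where $\Sigma$ is a closed contour going around $0,1,\ldots,n-1$ once in the positive direction with $\operatorname{Re}t>-1/2$ for $t\in\Sigma$. This formula is taken as the definition of $K_n$. The Airy kernel is $K_{\mathrm{Ai}}(x,y)=\frac{\mathrm{Ai}(x)\mathrm{Ai}'(y)-\mathrm{Ai}'(x)\mathrm{Ai}(y)}{x-y}$, extended continuously to $x=y$, where $\mathrm{Ai}$ is the Airy function. For $\xi,\eta$ in a fixed compact set the arguments of $K_n$ are positive for all large $n$. *)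

theory Defs
  imports "HOL-Complex_Analysis.Complex_Analysis"
begin

text \<open>The integral of \<open>f\<close> along \<open>Re s = c\<close>, upwards, with \<open>ds = i du\<close> for \<open>s = c + i u\<close>.\<close>

definition vertical_line_integral :: "real \<Rightarrow> (complex \<Rightarrow> complex) \<Rightarrow> complex" where
  "vertical_line_integral c f = \<i> * (LBINT u. f (Complex c u))"

text \<open>
  The condition on the closed contour of the inner integral. The points \<open>0, \<dots>, n - 1\<close> have to be
  excluded from the path explicitly, as \<open>winding_number\<close> is unspecified for points on the path.
\<close>

definition admissible_contour :: "nat \<Rightarrow> (real \<Rightarrow> complex) \<Rightarrow> bool" where
  "admissible_contour n \<gamma> \<longleftrightarrow>
     valid_path \<gamma> \<and> pathfinish \<gamma> = pathstart \<gamma> \<and>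
     path_image \<gamma> \<subseteq> {t. Re t > - 1 / 2} - of_nat ` {..<n} \<and>
     (\<forall>k<n. winding_number \<gamma> (of_nat k) = 1)"

definition kernel_integrand ::
    "nat \<Rightarrow> (nat \<Rightarrow> nat) \<Rightarrow> nat \<Rightarrow> nat \<Rightarrow> real \<Rightarrow> real \<Rightarrow> complex \<Rightarrow> complex \<Rightarrow> complex" where
  "kernel_integrand M \<nu> \<kappa> n x y s t =
     (\<Prod>j=0..M. Gamma (s + of_nat (\<nu> j) + 1) / Gamma (t + of_nat (\<nu> j) + 1)) *
     (Gamma (t - of_nat n + 1) / Gamma (s - of_nat n + 1)) *
     (Gamma (t + of_nat n + of_nat \<kappa>) / Gamma (s + of_nat n + of_nat \<kappa>)) *
     (of_real x powr t * of_real y powr (- s - 1) / (s - t))"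

text \<open>
  The kernel \<open>K\<^sub>n\<close> for the squared singular values of \<open>X\<^sub>M \<cdots> X\<^sub>2 V\<close>, written with the contour \<open>\<gamma>\<close>
  of the inner integral as a parameter. The value is the same for every \<open>\<gamma>\<close> with
  \<open>admissible_contour n \<gamma>\<close>: when \<open>\<nu> 0 = 0\<close>, the only poles in \<open>t\<close> with \<open>Re t > -1/2\<close> are
  \<open>0, \<dots>, n - 1\<close>.
\<close>

definition corr_kernel ::
    "nat \<Rightarrow> (nat \<Rightarrow> nat) \<Rightarrow> nat \<Rightarrow> (real \<Rightarrow> complex) \<Rightarrow> nat \<Rightarrow> real \<Rightarrow> real \<Rightarrow> complex" where
  "corr_kernel M \<nu> \<kappa> \<gamma> n x y =
     1 / (2 * of_real pi * \<i>)\<^sup>2 *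
     vertical_line_integral (- 1 / 2)
       (\<lambda>s. contour_integral \<gamma> (kernel_integrand M \<nu> \<kappa> n x y s))"

text \<open>The integral of \<open>f\<close> along the ray from \<open>0\<close> to infinity in direction \<open>w\<close>.\<close>

definition ray_integral :: "complex \<Rightarrow> (complex \<Rightarrow> complex) \<Rightarrow> complex" where
  "ray_integral w f = w * (LBINT r:{0..}. f (of_real r * w))"

text \<open>
  The Airy function as the integral of \<open>exp (v\<^sup>3 / 3 - z v) / (2 \<pi> i)\<close> along the contour that comes
  from infinity in direction \<open>exp (- i \<pi> / 3)\<close> to \<open>0\<close> and goes back to infinity in direction
  \<open>exp (i \<pi> / 3)\<close>. On both rays \<open>v\<^sup>3 = - r\<^sup>3\<close> with \<open>r = \<bar>v\<bar>\<close>, so the integrals converge absolutely.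
\<close>

definition Airy_Ai :: "complex \<Rightarrow> complex" where
  "Airy_Ai z =
     1 / (2 * of_real pi * \<i>) *
     (ray_integral (cis (pi / 3)) (\<lambda>v. exp (v ^ 3 / 3 - z * v)) -
      ray_integral (cis (- pi / 3)) (\<lambda>v. exp (v ^ 3 / 3 - z * v)))"

definition Airy_quotient :: "real \<Rightarrow> real \<Rightarrow> complex" where
  "Airy_quotient x y =
     (Airy_Ai (of_real x) * deriv Airy_Ai (of_real y) -
      deriv Airy_Ai (of_real x) * Airy_Ai (of_real y)) / of_real (x - y)"

text \<open>On the diagonal the Airy kernel is the continuous extension from \<open>{(u, v). u \<noteq> v}\<close>.\<close>

definition Airy_kernel :: "real \<Rightarrow> real \<Rightarrow> complex" where
  "Airy_kernel x y =
     (if x = y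
      then Lim (at (x, x) within {(u, v). u \<noteq> v}) (\<lambda>(u, v). Airy_quotient u v)
      else Airy_quotient x y)"

definition x_star :: "nat \<Rightarrow> real" where
  "x_star M = (real M + 1) powr ((real M + 1) / 2) / (2 * (real M - 1) powr ((real M - 1) / 2))"

definition c\<^sub>2 :: "nat \<Rightarrow> real" where
  "c\<^sub>2 M = (real M + 1) powr ((real M + 1) / 2) /
          (2 powr (4 / 3) * (real M - 1) powr (real M / 2 - 7 / 6))"

end

theory Submission
  imports Defs "HOL-Real_Asymp.Real_Asymp"
begin

text \<open>
  The factors with \<open>\<nu> 0 = 0\<close> and \<open>Gamma (t - n + 1) / Gamma (s - n + 1)\<close> combine to
  \<open>\<Prod> (s - k) / (t - k)\<close> over \<open>k < n\<close>. So the \<open>t\<close>-integral is the sum over simple poles at \<open>0, \<dots>, n - 1\<close>,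
  the zeros cancel \<open>1 / (s - k)\<close>, and the \<open>s\<close>-line may be moved to the right of \<open>n - 1\<close>. There
  \<open>1 / (s - k) = b \<integral> exp (- b r (s - k)) dr\<close> over \<open>r > 0\<close> factorizes the double integral into
  \<open>\<integral> P (x exp (b r)) Q (y exp (b r)) dr\<close> with a polynomial \<open>P\<close> (the residue sum) and a function \<open>Q\<close> given
  by a vertical line integral. At \<open>x = n\<^sup>M\<^sup>-\<^sup>1 x_star exp (b \<xi>)\<close> the logarithm of both integrands has a
  double saddle point at \<open>n z\<close>, \<open>z\<^sup>2 = (M + 1) / (M - 1)\<close>; taking \<open>b\<close> of order \<open>n\<^sup>-\<^sup>2\<^sup>/\<^sup>3\<close>, steepest descent
  turns the rescaled \<open>P\<close> and \<open>Q\<close> into Airy functions, and dominated convergence in \<open>r\<close> together with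
  \<open>Airy_kernel \<xi> \<eta> = \<integral> Airy_Ai (\<xi> + r) Airy_Ai (\<eta> + r) dr\<close> gives the limit. All estimates allow
  \<open>\<xi>\<close> and \<open>\<eta>\<close> to depend on \<open>n\<close>, and convergence along convergent sequences of arguments is
  uniform convergence on compact sets.
\<close>

section \<open>Bounds for the Gamma and Digamma functions\<close>

text \<open>No Stirling formula enters. Each integrand is only compared with its own value at the
  saddle point, so it suffices to integrate \<open>Digamma z = Ln z + O(1 / |z|)\<close> along
  paths; the saddle value itself cancels between \<open>Ps\<close> and \<open>Qs\<close>. The price
  is that a path must keep a distance of order n from 0 and from n and must avoid, seen from both, a
  sector about the negative axis. The contour of P encircles \<open>0, ..., n - 1\<close> and cannot
  do this throughout: on its left side the integrand is compared with its value at the upper corner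
  instead. The two factors play different roles in the domination. In the saddle variable v the line
  of Q has real part 1, which gives the factor \<open>exp (- \<eta>)\<close> and thereby
  integrability in r. The contour of P never goes to the right of the saddle point, so P is bounded
  as soon as \<xi> is bounded below.\<close>

lemma norm_Gamma_mono:
  fixes z w :: complex
  assumes "Re z = Re w" "Re z > 0" "\<bar>Im w\<bar> \<le> \<bar>Im z\<bar>"
  shows "norm (Gamma z) \<le> norm (Gamma w)"
proof (rule LIMSEQ_le)
  show "(\<lambda>n. norm (Gamma_series z n)) \<longlonglongrightarrow> norm (Gamma z)"
    by (intro tendsto_norm Gamma_series_LIMSEQ)
  show "(\<lambda>n. norm (Gamma_series w n)) \<longlonglongrightarrow> norm (Gamma w)"
    by (intro tendsto_norm Gamma_series_LIMSEQ)
  \<comment> \<open>The imaginary part only affects the Pochhammer symbol in the denominator, since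
    the modulus of the exponential in the numerator depends on the real part alone.\<close>
  have "norm (Gamma_series z n) \<le> norm (Gamma_series w n)" for n
  proof -
    have "norm (pochhammer w (n + 1)) \<le> norm (pochhammer z (n + 1))"
      unfolding pochhammer_prod prod_norm [symmetric]
    proof (intro prod_mono conjI)
      fix i :: nat
      have "(Im w)\<^sup>2 \<le> (Im z)\<^sup>2" using assms(3) by (simp add: abs_le_square_iff)
      then show "norm (w + of_nat i) \<le> norm (z + of_nat i)"
        using assms by (simp add: cmod_def)
    qed auto
    moreover have "norm (pochhammer w (n + 1)) > 0"
    proof -
      have "w + of_nat i \<noteq> 0" for i :: nat
      proof
        assume "w + of_nat i = 0"
        then have "Re (w + of_nat i) = 0" by simp
        with assms show False by simp
      qed
      then show ?thesis by (simp add: pochhammer_prod del: of_nat_Suc)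
    qed
    moreover have "norm (exp (z * of_real (ln (of_nat n)))) = norm (exp (w * of_real (ln (of_nat n))))"
      using assms by simp
    ultimately show ?thesis
      unfolding Gamma_series_def norm_divide norm_mult
      by (intro frac_le mult_mono) (auto simp del: of_nat_Suc norm_exp_eq_Re)
  qed
  then show "\<exists>N. \<forall>n\<ge>N. norm (Gamma_series z n) \<le> norm (Gamma_series w n)" by blast
qed

lemma norm_Gamma_le_Re:
  fixes z :: complex
  assumes "Re z > 0"
  shows "norm (Gamma z) \<le> Gamma (Re z)"
proof -
  have "norm (Gamma z) \<le> norm (Gamma (of_real (Re z) :: complex))"
    using assms by (intro norm_Gamma_mono) auto
  also have "\<dots> = Gamma (Re z)"
    using assms Gamma_real_pos[of "Re z"] by (simp add: Gamma_complex_of_real)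
  finally show ?thesis .
qed

text \<open>The condition with \<beta> < 1 describes a sector that avoids the negative axis but
  reaches into the left half-plane; the contours of the polynomial pass to the left of n and need
  this. The cross term 2 u Re z is absorbed by the arithmetic-geometric mean inequality.\<close>

lemma norm_add_real_sector:
  fixes z :: complex
  assumes "Re z \<ge> - \<beta> * cmod z" "0 \<le> \<beta>" "\<beta> < 1" "u \<ge> 0"
  shows "(1 - \<beta>) / 2 * (cmod z + u)\<^sup>2 \<le> (cmod (z + of_real u))\<^sup>2"
proof -
  have "u * (- \<beta> * cmod z) \<le> u * Re z"
    using assms by (intro mult_left_mono) auto
  moreover have "\<beta> * (2 * u * cmod z) \<le> \<beta> * (u\<^sup>2 + (cmod z)\<^sup>2)"
    using assms sum_squares_bound[of u "cmod z"] by (intro mult_left_mono) auto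
  ultimately have "(1 - \<beta>) * ((cmod z)\<^sup>2 + u\<^sup>2) \<le> (cmod z)\<^sup>2 + 2 * u * Re z + u\<^sup>2"
    by (simp add: algebra_simps)
  also have "(cmod z)\<^sup>2 + 2 * u * Re z + u\<^sup>2 = (cmod (z + of_real u))\<^sup>2"
    unfolding cmod_power2 by (simp add: algebra_simps power2_eq_square)
  finally have "(1 - \<beta>) * ((cmod z)\<^sup>2 + u\<^sup>2) \<le> (cmod (z + of_real u))\<^sup>2" .
  moreover have "(1 - \<beta>) * ((cmod z + u)\<^sup>2 / 2) \<le> (1 - \<beta>) * ((cmod z)\<^sup>2 + u\<^sup>2)"
    using assms sum_squares_bound[of "cmod z" u] by (intro mult_left_mono) (auto simp: power2_sum)
  ultimately show ?thesis by simp
qed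

lemma sector_not_nonpos_Reals:
  fixes z :: complex
  assumes "Re z \<ge> - \<beta> * cmod z" "0 \<le> \<beta>" "\<beta> < 1" "z \<noteq> 0" "u \<ge> 0"
  shows "z + of_real u \<notin> \<real>\<^sub>\<le>\<^sub>0"
proof
  assume "z + of_real u \<in> \<real>\<^sub>\<le>\<^sub>0"
  then have "Im z = 0" "Re z \<le> - u" by (auto simp: complex_nonpos_Reals_iff)
  then have "Re z = - cmod z" using assms by (simp add: cmod_eq_Re)
  with assms(1) have "(1 - \<beta>) * cmod z \<le> 0" by (simp add: algebra_simps)
  with assms show False by (simp add: mult_le_0_iff)
qed

text \<open>Telescoping against 2 / (r + k); the comparison of single terms uses r + k + 1 \<le> 2
  (r + k), hence r \<ge> 1.\<close>

lemma sum_inverse_squares_le: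
  fixes r :: real
  assumes "r \<ge> 1"
  shows "(\<Sum>k<m. 1 / (r + real k)\<^sup>2) \<le> 2 / r"
proof -
  have "(\<Sum>k<m. 1 / (r + real k)\<^sup>2) \<le> 2 / r - 2 / (r + real m)"
  proof (induction m)
    case (Suc m)
    have "1 / (r + real m)\<^sup>2 \<le> 2 / ((r + real m) * (r + real m + 1))"
      using assms by (simp add: divide_simps power2_eq_square)
    also have "\<dots> = 2 / (r + real m) - 2 / (r + real (Suc m))"
      using assms by (simp add: divide_simps)
    finally show ?case using Suc by simp
  qed simp
  also have "\<dots> \<le> 2 / r" using assms by simp
  finally show ?thesis .
qed

text \<open>The difference is the increment of \<open>h\<close> over [0, 1]. Its derivative w / ((z
  + k) (z + k + w)) is of order 1 / (|z| + k)^2 in the sector.\<close>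

lemma inverse_minus_Ln_diff_bound:
  fixes z :: complex
  assumes "Re z \<ge> - \<beta> * cmod z" "0 \<le> \<beta>" "\<beta> < 1" "z \<noteq> 0"
  shows "cmod (inverse (z + of_nat k) - (Ln (z + of_nat k + 1) - Ln (z + of_nat k)))
          \<le> 2 / (1 - \<beta>) * (1 / (cmod z + real k)\<^sup>2)"
proof -
  define d where "d = (1 - \<beta>) / 2"
  have d: "d > 0" using assms by (simp add: d_def)
  define h where "h = (\<lambda>w. w * inverse (z + of_nat k) - Ln (z + of_nat k + w))"
  have lo: "sqrt d * (cmod z + real k) \<le> cmod (z + of_real (real k + x))" if "x \<ge> 0" for x
  proof -
    have "d * (cmod z + real k)\<^sup>2 \<le> d * (cmod z + (real k + x))\<^sup>2"
      using d that by (intro mult_left_mono power_mono) auto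
    also have "\<dots> \<le> (cmod (z + of_real (real k + x)))\<^sup>2"
      using norm_add_real_sector[of \<beta> z "real k + x"] assms that by (simp add: d_def)
    finally have "(sqrt d * (cmod z + real k))\<^sup>2 \<le> (cmod (z + of_real (real k + x)))\<^sup>2"
      using d by (simp add: power_mult_distrib)
    then show ?thesis by (rule power2_le_imp_le[OF _ norm_ge_zero])
  qed
  have pos: "cmod z + real k > 0" using assms by (simp add: add_pos_nonneg)
  have "cmod (h 1 - h 0) \<le> (1 / d * (1 / (cmod z + real k)\<^sup>2)) * cmod (1 - 0 :: complex)"
  proof (rule field_differentiable_bound[where S = "closed_segment 0 1"])
    fix w :: complex assume "w \<in> closed_segment 0 1"
    then obtain x where x: "w = of_real x" "0 \<le> x" "x \<le> 1"
      by (auto simp: closed_segment_def scaleR_conv_of_real)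
    have eq: "z + of_nat k + w = z + of_real (real k + x)" using x by (simp add: add_ac)
    have nn: "z + of_nat k + w \<notin> \<real>\<^sub>\<le>\<^sub>0" unfolding eq
      using assms x by (intro sector_not_nonpos_Reals) auto
    show "(h has_field_derivative (inverse (z + of_nat k) - inverse (z + of_nat k + w))) (at w within closed_segment 0 1)"
      unfolding h_def by (rule has_field_derivative_at_within) (use nn in \<open>auto intro!: derivative_eq_intros\<close>)
    have a: "sqrt d * (cmod z + real k) \<le> cmod (z + of_nat k)" using lo[of 0] by simp
    have b: "sqrt d * (cmod z + real k) \<le> cmod (z + of_nat k + w)" unfolding eq using lo[of x] x by blast
    have sp: "sqrt d * (cmod z + real k) > 0" using d pos by simp
    have nz: "z + of_nat k \<noteq> 0" "z + of_nat k + w \<noteq> 0" using a b sp by auto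
    have "inverse (z + of_nat k) - inverse (z + of_nat k + w) = w / ((z + of_nat k) * (z + of_nat k + w))"
      using nz by (simp add: inverse_eq_divide diff_frac_eq)
    also have "cmod \<dots> \<le> 1 / ((sqrt d * (cmod z + real k)) * (sqrt d * (cmod z + real k)))"
      unfolding norm_divide norm_mult using a b sp x by (intro frac_le mult_mono mult_pos_pos[OF sp sp]) auto
    also have "\<dots> = 1 / d * (1 / (cmod z + real k)\<^sup>2)"
      using d by (simp add: power2_eq_square)
    finally show "cmod (inverse (z + of_nat k) - inverse (z + of_nat k + w)) \<le> 1 / d * (1 / (cmod z + real k)\<^sup>2)" .
  qed auto
  then show ?thesis by (simp add: h_def d_def algebra_simps)
qed

text \<open>In the partial sums for Digamma each reciprocal is compared with an increment of
  \<open>Ln\<close>. The increments telescope to \<open>Ln z\<close> up to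
  \<open>Ln (1 + z / m)\<close>, which tends to 0, and the errors are summable with sum of order 1 /
  |z|.\<close>

lemma norm_Digamma_minus_Ln_le:
  fixes z :: complex
  assumes "Re z \<ge> - \<beta> * cmod z" "0 \<le> \<beta>" "\<beta> < 1" "cmod z \<ge> 1"
  shows "cmod (Digamma z - Ln z) \<le> 4 / (1 - \<beta>) / cmod z"
proof -
  have z0: "z \<noteq> 0" using assms by auto
  let ?D = "\<lambda>m. of_real (ln (real m)) - (\<Sum>n<m. inverse (z + of_nat n))"
  have tel: "(\<Sum>k<m. inverse (z + of_nat k) - (Ln (z + of_nat k + 1) - Ln (z + of_nat k))) =
      (\<Sum>k<m. inverse (z + of_nat k)) - Ln (z + of_nat m) + Ln z" for m
    by (induction m) (auto simp: algebra_simps)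
  have "(\<lambda>m. Ln (1 + z / of_nat m)) \<longlonglongrightarrow> Ln (1 + 0)"
    by (intro tendsto_intros lim_const_over_n) auto
  then have l0: "(\<lambda>m. Ln (1 + z / of_nat m)) \<longlonglongrightarrow> 0" by simp
  have ev: "eventually (\<lambda>m. ?D m - Ln z = - (\<Sum>k<m. inverse (z + of_nat k) - (Ln (z + of_nat k + 1) - Ln (z + of_nat k)))
      - Ln (1 + z / of_nat m)) sequentially"
    using eventually_gt_at_top[of 0]
  proof eventually_elim
    case (elim m)
    have "z + of_nat m \<noteq> 0"
      using sector_not_nonpos_Reals[of \<beta> z "real m"] assms z0 by auto
    have "Ln (of_real (real m) * (1 + z / of_nat m)) = of_real (ln (real m)) + Ln (1 + z / of_nat m)"
      using elim \<open>z + of_nat m \<noteq> 0\<close> by (subst Ln_times_of_real) (auto simp: field_simps)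
    also have "of_real (real m) * (1 + z / of_nat m) = z + of_nat m"
      using elim by (simp add: field_simps)
    finally show ?case unfolding tel by simp
  qed
  have "(\<lambda>m. ?D m - Ln z) \<longlonglongrightarrow> Digamma z - Ln z"
    by (intro tendsto_intros Digamma_LIMSEQ z0)
  from tendsto_add[OF this l0] have lim: "(\<lambda>m. ?D m - Ln z + Ln (1 + z / of_nat m)) \<longlonglongrightarrow> Digamma z - Ln z" by simp
  show ?thesis
  proof (rule Lim_norm_ubound[OF _ lim])
    show "eventually (\<lambda>m. cmod (?D m - Ln z + Ln (1 + z / of_nat m)) \<le> 4 / (1 - \<beta>) / cmod z) sequentially"
      using ev
    proof eventually_elim
      case (elim m)
      have "cmod (?D m - Ln z + Ln (1 + z / of_nat m)) =
        cmod (\<Sum>k<m. inverse (z + of_nat k) - (Ln (z + of_nat k + 1) - Ln (z + of_nat k)))"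
        unfolding elim by (simp add: norm_minus_commute)
      also have "\<dots> \<le> (\<Sum>k<m. 2 / (1 - \<beta>) * (1 / (cmod z + real k)\<^sup>2))"
        by (intro sum_norm_le inverse_minus_Ln_diff_bound) (use assms z0 in auto)
      also have "\<dots> = 2 / (1 - \<beta>) * (\<Sum>k<m. 1 / (cmod z + real k)\<^sup>2)"
        by (simp add: sum_distrib_left)
      also have "\<dots> \<le> 2 / (1 - \<beta>) * (2 / cmod z)"
        using assms by (intro mult_left_mono sum_inverse_squares_le) auto
      finally show ?case by simp
    qed
  qed simp
qed

lemma Digamma_plus_nat:
  fixes z :: complex
  assumes "\<And>k. k < N \<Longrightarrow> z + of_nat k \<noteq> 0"
  shows "Digamma (z + of_nat N) = Digamma z + (\<Sum>k<N. 1 / (z + of_nat k))"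
  using assms
proof (induction N)
  case (Suc N)
  have "Digamma (z + of_nat N + 1) = Digamma (z + of_nat N) + 1 / (z + of_nat N)"
    using Suc.prems by (intro Digamma_plus1) auto
  then show ?case using Suc by (simp add: add_ac)
qed simp

text \<open>The Digamma arguments of the phase are t - n, t + n and t shifted by fixed integers.
  Here such a shift is absorbed into the error term.\<close>

lemma norm_Digamma_shift_minus_Ln_le:
  fixes z :: complex
  assumes "Re z \<ge> - \<beta> * cmod z" "0 \<le> \<beta>" "\<beta> < 1" "cmod z \<ge> 1"
  shows "cmod (Digamma (z + of_nat N) - Ln z) \<le> (4 + 2 * real N) / (1 - \<beta>) / cmod z"
proof -
  have z0: "z \<noteq> 0" using assms by auto
  have lo: "(1 - \<beta>) / 2 * cmod z \<le> cmod (z + of_nat k)" for k :: nat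
  proof -
    have "((1 - \<beta>) / 2 * cmod z)\<^sup>2 \<le> (1 - \<beta>) / 2 * (cmod z)\<^sup>2"
      using assms mult_left_mono[of "(1 - \<beta>) / 2" 1 "(1 - \<beta>) / 2 * (cmod z)\<^sup>2"]
      by (simp add: power_mult_distrib power2_eq_square mult_ac)
    also have "\<dots> \<le> (1 - \<beta>) / 2 * (cmod z + real k)\<^sup>2"
      using assms by (intro mult_left_mono power_mono) auto
    also have "\<dots> \<le> (cmod (z + of_real (real k)))\<^sup>2"
      using assms by (intro norm_add_real_sector) auto
    finally show ?thesis using power2_le_imp_le[OF _ norm_ge_zero] by fastforce
  qed
  have pos: "(1 - \<beta>) / 2 * cmod z > 0" using assms z0 by simp
  have "cmod (\<Sum>k<N. 1 / (z + of_nat k)) \<le> (\<Sum>k<N. 1 / ((1 - \<beta>) / 2 * cmod z))"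
  proof (intro sum_norm_le)
    fix k show "cmod (1 / (z + of_nat k)) \<le> 1 / ((1 - \<beta>) / 2 * cmod z)"
      unfolding norm_divide norm_one by (intro frac_le lo pos) auto
  qed
  also have "\<dots> = 2 * real N / (1 - \<beta>) / cmod z" by simp
  finally have "cmod (\<Sum>k<N. 1 / (z + of_nat k)) \<le> 2 * real N / (1 - \<beta>) / cmod z" .
  moreover have "Digamma (z + of_nat N) = Digamma z + (\<Sum>k<N. 1 / (z + of_nat k))"
  proof (intro Digamma_plus_nat)
    fix k show "z + of_nat k \<noteq> 0" using lo[of k] pos by auto
  qed
  ultimately have "cmod (Digamma (z + of_nat N) - Ln z) \<le> 4 / (1 - \<beta>) / cmod z + 2 * real N / (1 - \<beta>) / cmod z"
    using norm_Digamma_minus_Ln_le[OF assms] norm_triangle_ineq[of "Digamma z - Ln z" "\<Sum>k<N. 1 / (z + of_nat k)"]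
    by (simp add: algebra_simps)
  also have "\<dots> = (4 + 2 * real N) / (1 - \<beta>) / cmod z" by (simp add: add_divide_distrib)
  finally show ?thesis .
qed

section \<open>The Airy function and its kernel\<close>

lemma integral_indicator_Icc:
  fixes F f :: "real \<Rightarrow> complex"
  assumes "a \<le> b" "\<And>x. a \<le> x \<Longrightarrow> x \<le> b \<Longrightarrow> (F has_vector_derivative f x) (at x)" "continuous_on {a..b} f"
  shows "(LBINT x. indicator {a..b} x *\<^sub>R f x) = F b - F a"
  using assms by (intro integral_FTC_atLeastAtMost) (auto intro: has_vector_derivative_at_within)

lemma FTC_halfline:
  fixes F f :: "real \<Rightarrow> complex"
  assumes deriv: "\<And>x. a \<le> x \<Longrightarrow> (F has_vector_derivative f x) (at x)"
    and cont: "continuous_on {a..} f"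
    and int: "integrable lborel (\<lambda>x. indicator {a..} x *\<^sub>R f x)"
  shows "((\<lambda>T. F T - F a) \<longlongrightarrow> (LBINT x. indicator {a..} x *\<^sub>R f x)) at_top"
proof (rule Lim_transform_eventually)
  show "((\<lambda>y. LBINT x. indicator {..y} x *\<^sub>R (indicator {a..} x *\<^sub>R f x)) \<longlongrightarrow>
         (LBINT x. indicator {a..} x *\<^sub>R f x)) at_top"
    by (intro tendsto_integral_at_top int) auto
  show "eventually (\<lambda>y. (LBINT x. indicator {..y} x *\<^sub>R (indicator {a..} x *\<^sub>R f x)) = F y - F a) at_top"
    using eventually_ge_at_top[of a]
  proof eventually_elim
    case (elim y)
    have "(LBINT x. indicator {..y} x *\<^sub>R (indicator {a..} x *\<^sub>R f x)) = (LBINT x. indicator {a..y} x *\<^sub>R f x)"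
      by (intro Bochner_Integration.integral_cong) (auto simp: indicator_def)
    also have "\<dots> = F y - F a"
      using elim cont by (intro integral_indicator_Icc deriv) (auto elim: continuous_on_subset)
    finally show ?case .
  qed
qed

lemma FTC_line:
  fixes F f :: "real \<Rightarrow> complex"
  assumes deriv: "\<And>x. (F has_vector_derivative f x) (at x)"
    and cont: "continuous_on UNIV f"
    and int: "integrable lborel f"
  shows "((\<lambda>T. F T - F (- T)) \<longlongrightarrow> (LBINT x. f x)) at_top"
proof (rule Lim_transform_eventually)
  show "((\<lambda>T. LBINT x. indicator {-T..T} x *\<^sub>R f x) \<longlongrightarrow> (LBINT x. f x)) at_top"
  proof (rule integral_dominated_convergence_at_top[where w = "\<lambda>x. norm (f x)"])
    show "AE x in lborel. ((\<lambda>T. indicator {-T..T} x *\<^sub>R f x) \<longlongrightarrow> f x) at_top"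
    proof (intro AE_I2)
      fix x :: real
      have "eventually (\<lambda>T. indicator {-T..T} x *\<^sub>R f x = f x) at_top"
        using eventually_ge_at_top[of "\<bar>x\<bar>"] by eventually_elim (auto simp: indicator_def)
      then show "((\<lambda>T. indicator {-T..T} x *\<^sub>R f x) \<longlongrightarrow> f x) at_top" by (rule tendsto_eventually)
    qed
  qed (use int in \<open>auto simp: indicator_def\<close>)
  show "eventually (\<lambda>T. (LBINT x. indicator {-T..T} x *\<^sub>R f x) = F T - F (- T)) at_top"
    using eventually_ge_at_top[of 0]
    by eventually_elim (use cont in \<open>auto intro!: integral_indicator_Icc deriv elim: continuous_on_subset\<close>)
qed

lemma integrable_exp_neg_halfline:
  assumes "c > 0"
  shows "integrable lborel (\<lambda>x::real. indicator {0..} x *\<^sub>R exp (- c * x))"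
proof -
  have "set_integrable lebesgue {0..} (\<lambda>x::real. exp (- c * x))"
    using assms by (intro nonnegative_absolutely_integrable_1 integrable_on_exp_minus_to_infinity) auto
  then have "integrable lebesgue (\<lambda>x::real. indicator {0..} x *\<^sub>R exp (- c * x))"
    by (simp add: set_integrable_def)
  then show ?thesis
    by (subst (asm) integrable_completion) (auto intro!: borel_measurable_continuous_on_indicator continuous_intros)
qed

lemma integrable_exp_neg_abs:
  assumes "c > 0"
  shows "integrable lborel (\<lambda>x::real. exp (- c * \<bar>x\<bar>))"
proof -
  let ?g = "\<lambda>x::real. indicator {0..} x *\<^sub>R exp (- c * x)"
  have "integrable lborel (\<lambda>x. ?g (0 + (-1) * x))"
    by (intro lborel_integrable_real_affine integrable_exp_neg_halfline assms) auto
  then have "integrable lborel (\<lambda>x. ?g x + ?g (0 + (-1) * x))"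
    by (intro Bochner_Integration.integrable_add integrable_exp_neg_halfline assms)
  then show ?thesis
    by (rule Bochner_Integration.integrable_bound) (auto intro!: AE_I2 simp: indicator_def)
qed

section \<open>The Airy function as an integral over the line Re v = 1\<close>

lemma Re_cube_vertical: "Re ((Complex 1 y) ^ 3) = 1 - 3 * y\<^sup>2"
  by (simp add: power3_eq_cube power2_eq_square algebra_simps)

lemma cmod_Complex_1_le: "cmod (Complex 1 y) \<le> 1 + \<bar>y\<bar>"
  using cmod_le[of "Complex 1 y"] by simp

text \<open>The power is at most exp (k |y|), and completing the square around (c + k + 1) / 2 lets
  the Gaussian absorb the linear exponent. The extra 1 is what leaves exp (- |y|).\<close>

lemma airy_dominator:
  fixes y c :: real
  assumes "c \<ge> 0"
  shows "(1 + \<bar>y\<bar>) ^ k * exp (1 / 3 - y\<^sup>2 + c * (1 + \<bar>y\<bar>))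
    \<le> exp (1 / 3 + c + (c + real k + 1)\<^sup>2 / 4) * exp (- 1 * \<bar>y\<bar>)"
proof -
  have "(1 + \<bar>y\<bar>) ^ k \<le> exp \<bar>y\<bar> ^ k"
    by (intro power_mono exp_ge_add_one_self) auto
  also have "\<dots> = exp (real k * \<bar>y\<bar>)" by (simp add: exp_of_nat_mult)
  finally have "(1 + \<bar>y\<bar>) ^ k * exp (1 / 3 - y\<^sup>2 + c * (1 + \<bar>y\<bar>)) \<le> exp (real k * \<bar>y\<bar>) * exp (1 / 3 - y\<^sup>2 + c * (1 + \<bar>y\<bar>))"
    by (intro mult_right_mono) auto
  also have "\<dots> \<le> exp (1 / 3 + c + (c + real k + 1)\<^sup>2 / 4) * exp (- 1 * \<bar>y\<bar>)"
  proof -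
    have "0 \<le> (\<bar>y\<bar> - (c + real k + 1) / 2)\<^sup>2" by simp
    also have "\<dots> = y\<^sup>2 - (c + real k + 1) * \<bar>y\<bar> + (c + real k + 1)\<^sup>2 / 4"
      by (simp add: power2_diff power_divide)
    finally show ?thesis unfolding exp_add[symmetric] by (simp add: algebra_simps)
  qed
  finally show ?thesis .
qed

text \<open>On Re v = 1 the real part of v^3 / 3 is 1 / 3 - y^2, so every power of v is integrable
  against the exponential. Each power stands for one differentiation in z:
  \<open>airy_moment k\<close> is (-1)^k times the k-th derivative of the Airy function.\<close>

definition airy_integrand :: "nat \<Rightarrow> complex \<Rightarrow> real \<Rightarrow> complex" where
  "airy_integrand k z y = Complex 1 y ^ k * exp (Complex 1 y ^ 3 / 3 - z * Complex 1 y)"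

definition airy_moment :: "nat \<Rightarrow> complex \<Rightarrow> complex" where
  "airy_moment k z = (LBINT y. airy_integrand k z y) / (2 * of_real pi)"

lemma Complex_eq_1: "Complex 1 y = 1 + \<i> * of_real y"
  by (simp add: complex_eq_iff)

lemma continuous_on_airy_integrand: "continuous_on A (airy_integrand k z)"
  unfolding airy_integrand_def Complex_eq_1 by (intro continuous_intros) auto

lemma airy_integrand_measurable [measurable]: "airy_integrand k z \<in> borel_measurable borel"
  by (intro borel_measurable_continuous_onI continuous_on_airy_integrand)

lemma norm_airy_integrand:
  "norm (airy_integrand k z y) = cmod (Complex 1 y) ^ k * exp (1 / 3 - y\<^sup>2 - Re (z * Complex 1 y))"
proof -
  have "Re (Complex 1 y ^ 3 / 3 - z * Complex 1 y) = 1 / 3 - y\<^sup>2 - Re (z * Complex 1 y)"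
    using Re_cube_vertical[of y] by (simp add: Re_divide_numeral diff_divide_distrib)
  then show ?thesis by (simp only: airy_integrand_def norm_mult norm_power norm_exp_eq_Re)
qed

lemma norm_airy_integrand_le:
  "norm (airy_integrand k z y) \<le> (1 + \<bar>y\<bar>) ^ k * exp (1 / 3 - y\<^sup>2 + cmod z * (1 + \<bar>y\<bar>))"
proof -
  have "- Re (z * Complex 1 y) \<le> cmod (z * Complex 1 y)"
    using abs_Re_le_cmod[of "z * Complex 1 y"] by linarith
  also have "\<dots> \<le> cmod z * (1 + \<bar>y\<bar>)"
    unfolding norm_mult by (intro mult_left_mono cmod_Complex_1_le) auto
  finally have *: "- Re (z * Complex 1 y) \<le> cmod z * (1 + \<bar>y\<bar>)" .
  show ?thesis unfolding norm_airy_integrand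
    by (intro mult_mono power_mono cmod_Complex_1_le) (use * in auto)
qed

lemma integrable_airy_integrand: "integrable lborel (airy_integrand k z)"
proof (rule Bochner_Integration.integrable_bound)
  show "integrable lborel (\<lambda>y. exp (1 / 3 + cmod z + (cmod z + real k + 1)\<^sup>2 / 4) * exp (- 1 * \<bar>y\<bar>))"
    by (intro integrable_mult_right integrable_exp_neg_abs) auto
  show "AE y in lborel. norm (airy_integrand k z y) \<le> norm (exp (1 / 3 + cmod z + (cmod z + real k + 1)\<^sup>2 / 4) * exp (- 1 * \<bar>y\<bar>))"
    using order_trans[OF norm_airy_integrand_le airy_dominator] by (intro AE_I2) (auto simp del: mult_minus1)
qed simp

text \<open>All points of the line have real part 1, so a real argument x contributes exactly the
  factor exp (- x) to the modulus.\<close>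

lemma norm_airy_moment_of_real_le:
  obtains C where "C \<ge> 0" "\<And>x. norm (airy_moment k (of_real x)) \<le> C * exp (- x)"
proof
  let ?C = "(LBINT y. norm (airy_integrand k 0 y)) / (2 * pi)"
  show "?C \<ge> 0" by (intro divide_nonneg_nonneg Bochner_Integration.integral_nonneg) auto
  fix x :: real
  have eq: "norm (airy_integrand k (of_real x) y) = exp (- x) * norm (airy_integrand k 0 y)" for y
  proof -
    have "exp (1 / 3 - y\<^sup>2 - x) = exp (- x) * exp (1 / 3 - y\<^sup>2)"
      by (subst mult_exp_exp) (simp add: algebra_simps)
    then show ?thesis unfolding norm_airy_integrand by simp
  qed
  have "norm (LBINT y. airy_integrand k (of_real x) y) \<le> (LBINT y. norm (airy_integrand k (of_real x) y))"
    by (rule integral_norm_bound)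
  also have "\<dots> = exp (- x) * (LBINT y. norm (airy_integrand k 0 y))"
    unfolding eq by (rule integral_mult_right_zero)
  finally show "norm (airy_moment k (of_real x)) \<le> ?C * exp (- x)"
    by (simp add: airy_moment_def norm_divide divide_right_mono mult.commute field_simps)
qed

lemma has_field_derivative_quadratic_bound:
  fixes f :: "complex \<Rightarrow> complex"
  assumes "\<And>h. norm h \<le> 1 \<Longrightarrow> norm (f (z + h) - f z - D * h) \<le> B * (norm h)\<^sup>2"
  shows "(f has_field_derivative D) (at z)"
  unfolding DERIV_def
proof (rule LIM_zero_cancel, rule Lim_null_comparison)
  show "eventually (\<lambda>h. norm ((f (z + h) - f z) / h - D) \<le> B * norm h) (at 0)"
    unfolding eventually_at
  proof (intro exI[of _ 1] conjI ballI impI)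
    fix h :: complex assume h: "h \<noteq> 0 \<and> dist h 0 < 1"
    have "norm ((f (z + h) - f z) / h - D) = norm (f (z + h) - f z - D * h) / norm h"
      using h by (simp add: divide_diff_eq_iff norm_divide[symmetric])
    also have "\<dots> \<le> B * (norm h)\<^sup>2 / norm h"
      using h by (intro divide_right_mono assms) auto
    finally show "norm ((f (z + h) - f z) / h - D) \<le> B * norm h"
      using h by (simp add: power2_eq_square)
  qed auto
  show "((\<lambda>h. B * norm h) \<longlongrightarrow> 0) (at (0::complex))"
    by (rule tendsto_eq_intros | simp)+
qed

lemma airy_moment_has_field_derivative:
  "(airy_moment k has_field_derivative - airy_moment (Suc k) z) (at z)"
proof -
  \<comment> \<open>For |h| \<le> 1 the remainder of exp (- h v) costs one unit in the linear
    exponent and two powers of 1 + |y|, which explains \<open>?c\<close> and k + 2.\<close>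
  let ?c = "cmod z + 1"
  let ?K = "exp (1 / 3 + ?c + (?c + real (k + 2) + 1)\<^sup>2 / 4)"
  let ?w = "\<lambda>y. ?K * exp (- 1 * \<bar>y\<bar>)"
  have intw: "integrable lborel ?w"
    by (intro integrable_mult_right integrable_exp_neg_abs) auto
  show ?thesis
  proof (rule has_field_derivative_quadratic_bound)
    fix h :: complex assume h: "norm h \<le> 1"
    let ?d = "\<lambda>y. airy_integrand k (z + h) y - airy_integrand k z y + h * airy_integrand (Suc k) z y"
    have pt: "norm (?d y) \<le> (norm h)\<^sup>2 * ?w y" for y
    proof -
      let ?v = "Complex 1 y"
      have "?d y = airy_integrand k z y * (exp (- h * ?v) - (\<Sum>i\<le>1. (- h * ?v) ^ i / fact i))"
      proof -
        have "exp (?v ^ 3 / 3 - (z + h) * ?v) = exp (?v ^ 3 / 3 - z * ?v) * exp (- h * ?v)"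
          by (simp add: mult_exp_exp algebra_simps)
        then show ?thesis by (simp add: airy_integrand_def algebra_simps)
      qed
      also have "norm \<dots> \<le> norm (airy_integrand k z y) * (exp \<bar>Re (- h * ?v)\<bar> * (norm (- h * ?v)) ^ Suc 1 / fact 1)"
        by (rule order_trans[OF norm_mult_ineq mult_left_mono[OF Taylor_exp norm_ge_zero]])
      also have "\<dots> \<le> ((1 + \<bar>y\<bar>) ^ k * exp (1 / 3 - y\<^sup>2 + cmod z * (1 + \<bar>y\<bar>))) *
          (exp (1 + \<bar>y\<bar>) * (norm h * (1 + \<bar>y\<bar>))\<^sup>2)"
      proof -
        have "cmod (- h * ?v) \<le> 1 * (1 + \<bar>y\<bar>)"
          unfolding norm_mult using h cmod_Complex_1_le by (intro mult_mono) auto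
        then have "\<bar>Re (- h * ?v)\<bar> \<le> 1 + \<bar>y\<bar>"
          by (intro order_trans[OF abs_Re_le_cmod]) simp
        moreover have "norm (- h * ?v) \<le> norm h * (1 + \<bar>y\<bar>)"
          unfolding norm_mult norm_minus_cancel by (intro mult_left_mono cmod_Complex_1_le) auto
        ultimately show ?thesis
          by (intro mult_mono norm_airy_integrand_le) (auto simp: power2_eq_square intro!: mult_mono)
      qed
      also have "\<dots> = (norm h)\<^sup>2 * ((1 + \<bar>y\<bar>) ^ (k + 2) * exp (1 / 3 - y\<^sup>2 + ?c * (1 + \<bar>y\<bar>)))"
      proof -
        have "exp (1 / 3 - y\<^sup>2 + ?c * (1 + \<bar>y\<bar>)) = exp (1 / 3 - y\<^sup>2 + cmod z * (1 + \<bar>y\<bar>)) * exp (1 + \<bar>y\<bar>)"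
          by (simp add: mult_exp_exp algebra_simps)
        then show ?thesis by (simp only: power_add power_mult_distrib mult_ac)
      qed
      also have "\<dots> \<le> (norm h)\<^sup>2 * ?w y"
        by (intro mult_left_mono airy_dominator) auto
      finally show ?thesis .
    qed
    have intd: "integrable lborel ?d"
      by (intro Bochner_Integration.integrable_add Bochner_Integration.integrable_diff integrable_mult_right integrable_airy_integrand)
    have "(LBINT y. ?d y) = (LBINT y. airy_integrand k (z + h) y) - (LBINT y. airy_integrand k z y) + h * (LBINT y. airy_integrand (Suc k) z y)"
      by (subst Bochner_Integration.integral_add Bochner_Integration.integral_diff;
          (intro Bochner_Integration.integrable_diff integrable_mult_right integrable_airy_integrand)?)+
         (simp_all add: integrable_airy_integrand)
    then have "airy_moment k (z + h) - airy_moment k z - (- airy_moment (Suc k) z) * h = (LBINT y. ?d y) / (2 * of_real pi)"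
      by (simp add: airy_moment_def diff_divide_distrib add_divide_distrib)
    also have "norm \<dots> \<le> (LBINT y. (norm h)\<^sup>2 * ?w y) / (2 * pi)"
      unfolding norm_divide
      using order_trans[OF integral_norm_bound integral_mono[OF integrable_norm[OF intd] integrable_mult_right[OF intw]], OF pt]
      by (simp add: divide_right_mono)
    also have "(LBINT y. (norm h)\<^sup>2 * ?w y) = (norm h)\<^sup>2 * (LBINT y. ?w y)"
      by (rule integral_mult_right_zero)
    finally show "norm (airy_moment k (z + h) - airy_moment k z - - airy_moment (Suc k) z * h) \<le> ((LBINT y. ?w y) / (2 * pi)) * (norm h)\<^sup>2"
      by (simp add: mult.commute)
  qed
qed

lemma tendsto_exp_neg_at_top: "((\<lambda>T::real. C * exp (- T)) \<longlongrightarrow> 0) at_top"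
proof -
  have "((\<lambda>T::real. C * exp (- T)) \<longlongrightarrow> C * 0) at_top"
    by (intro tendsto_intros filterlim_compose[OF exp_at_bot filterlim_uminus_at_bot_at_top])
  then show ?thesis by simp
qed

text \<open>The Airy equation: (v^2 - z) exp (v^3 / 3 - z v) is a derivative in v, and its primitive
  vanishes at both ends of the line.\<close>

lemma airy_moment_ode: "airy_moment 2 z = z * airy_moment 0 z"
proof -
  let ?F = "\<lambda>y. airy_integrand 0 z y"
  let ?f = "\<lambda>y. \<i> * (airy_integrand 2 z y - z * airy_integrand 0 z y)"
  have der: "(?F has_vector_derivative ?f y) (at y)" for y
    unfolding airy_integrand_def Complex_eq_1
    by (auto intro!: derivative_eq_intros has_vector_derivative_real_field simp: field_simps power2_eq_square)
  have int: "integrable lborel ?f"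
    by (intro integrable_mult_right Bochner_Integration.integrable_diff integrable_airy_integrand)
  have "((\<lambda>T. ?F T - ?F (- T)) \<longlongrightarrow> (LBINT x. ?f x)) at_top"
    by (intro FTC_line der int continuous_intros continuous_on_airy_integrand)
  moreover have "((\<lambda>T. ?F T - ?F (- T)) \<longlongrightarrow> 0 - 0) at_top"
  proof (intro tendsto_diff)
    let ?C = "exp (1 / 3 + cmod z + (cmod z + real 0 + 1)\<^sup>2 / 4)"
    have *: "norm (?F y) \<le> ?C * exp (- \<bar>y\<bar>)" for y
      using order_trans[OF norm_airy_integrand_le[of 0 z y] airy_dominator[of "cmod z" y 0]] by simp
    show "((\<lambda>T. ?F T) \<longlongrightarrow> 0) at_top"
      by (rule Lim_null_comparison[OF _ tendsto_exp_neg_at_top[of ?C]], rule eventually_mono[OF eventually_ge_at_top[of 0]])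
         (use * in \<open>metis abs_of_nonneg\<close>)
    show "((\<lambda>T. ?F (- T)) \<longlongrightarrow> 0) at_top"
      by (rule Lim_null_comparison[OF _ tendsto_exp_neg_at_top[of ?C]], rule eventually_mono[OF eventually_ge_at_top[of 0]])
         (use * in \<open>metis abs_of_nonneg abs_minus_cancel\<close>)
  qed
  ultimately have "(LBINT x. ?f x) = 0" using tendsto_unique[OF trivial_limit_at_top_linorder] by fastforce
  moreover have "(LBINT x. ?f x) = \<i> * ((LBINT x. airy_integrand 2 z x) - z * (LBINT x. airy_integrand 0 z x))"
    by (simp add: integrable_airy_integrand)
  ultimately show ?thesis by (simp add: airy_moment_def)
qed

section \<open>From the vertical line to rays\<close>

lemma cube_ge_linear:
  fixes r l :: real
  assumes "r \<ge> 0" "l \<ge> 0"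
  shows "3 * l\<^sup>2 * r - 2 * l ^ 3 \<le> r ^ 3"
proof -
  have "r ^ 3 - 3 * l\<^sup>2 * r + 2 * l ^ 3 = (r - l)\<^sup>2 * (r + 2 * l)"
    by (simp add: power2_eq_square power3_eq_cube algebra_simps)
  also have "\<dots> \<ge> 0" using assms by simp
  finally show ?thesis by simp
qed

lemma cubic_exp_dominator:
  fixes c K :: real
  assumes "c > 0" "K \<ge> 0"
  obtains C where "C > 0" "\<And>r. r \<ge> 0 \<Longrightarrow> exp (K * r - c * r ^ 3) \<le> C * exp (- 1 * r)"
proof
  \<comment> \<open>The tangent of c r^3 at r = l lies below the cubic. The point l is chosen so
    that this tangent has slope K + 1, which cancels K r and leaves exp (- r).\<close>
  define l where "l = sqrt ((K + 1) / (3 * c))"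
  have l: "l \<ge> 0" "3 * c * l\<^sup>2 = K + 1" using assms by (auto simp: l_def)
  show "exp (2 * c * l ^ 3) > 0" by simp
  fix r :: real assume r: "r \<ge> 0"
  have "c * (3 * l\<^sup>2 * r - 2 * l ^ 3) \<le> c * r ^ 3"
    using cube_ge_linear[OF r l(1)] assms by (intro mult_left_mono) auto
  then have "(3 * c * l\<^sup>2) * r - 2 * c * l ^ 3 \<le> c * r ^ 3" by (simp add: algebra_simps)
  then have "K * r - c * r ^ 3 \<le> 2 * c * l ^ 3 + - 1 * r" unfolding l by (simp add: algebra_simps)
  then show "exp (K * r - c * r ^ 3) \<le> exp (2 * c * l ^ 3) * exp (- 1 * r)"
    unfolding exp_add[symmetric] by simp
qed

lemma Re_cis_cube: "Re ((of_real r * cis \<theta>) ^ 3) = r ^ 3 * cos (3 * \<theta>)"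
proof -
  have "(of_real r * cis \<theta>) ^ 3 = of_real (r ^ 3) * cis (real 3 * \<theta>)"
    by (simp only: power_mult_distrib Complex.DeMoivre of_real_power)
  then show ?thesis by simp
qed

lemma integrable_airy_ray:
  assumes "cos (3 * \<theta>) < 0"
  shows "integrable lborel (\<lambda>r. indicator {0..} r *\<^sub>R exp ((of_real r * cis \<theta>) ^ 3 / 3 - z * (of_real r * cis \<theta>)))"
proof -
  let ?f = "\<lambda>r. indicator {0..} r *\<^sub>R exp ((of_real r * cis \<theta>) ^ 3 / 3 - z * (of_real r * cis \<theta>))"
  obtain C where C: "C > 0" "\<And>r. r \<ge> 0 \<Longrightarrow> exp (cmod z * r - (- cos (3 * \<theta>) / 3) * r ^ 3) \<le> C * exp (- 1 * r)"
    using cubic_exp_dominator[of "- cos (3 * \<theta>) / 3" "cmod z"] assms by auto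
  show ?thesis
  proof (rule Bochner_Integration.integrable_bound)
    show "integrable lborel (\<lambda>r. C * (indicator {0..} r *\<^sub>R exp (- 1 * r)))"
      by (intro integrable_mult_right integrable_exp_neg_halfline) auto
    show "AE r in lborel. norm (?f r) \<le> norm (C * (indicator {0..} r *\<^sub>R exp (- 1 * r)))"
    proof (intro AE_I2)
      fix r :: real
      show "norm (?f r) \<le> norm (C * (indicator {0..} r *\<^sub>R exp (- 1 * r)))"
      proof (cases "r \<ge> 0")
        case True
        have "- Re (z * (of_real r * cis \<theta>)) \<le> cmod (z * (of_real r * cis \<theta>))"
          using abs_Re_le_cmod[of "z * (of_real r * cis \<theta>)"] by linarith
        also have "\<dots> = cmod z * r" using True by (simp add: norm_mult)
        finally have "Re ((of_real r * cis \<theta>) ^ 3 / 3 - z * (of_real r * cis \<theta>)) \<le> cmod z * r - (- cos (3 * \<theta>) / 3) * r ^ 3"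
          using Re_cis_cube[of r \<theta>] by (simp only: minus_complex.simps Re_divide_numeral) (simp add: algebra_simps)
        then have "norm (exp ((of_real r * cis \<theta>) ^ 3 / 3 - z * (of_real r * cis \<theta>))) \<le> exp (cmod z * r - (- cos (3 * \<theta>) / 3) * r ^ 3)"
          by (simp only: norm_exp_eq_Re exp_le_cancel_iff)
        also note C(2)[OF True]
        finally show ?thesis using True C(1) by simp
      qed simp
    qed
    show "?f \<in> borel_measurable lborel"
    proof -
      have "?f \<in> borel_measurable borel"
        by (intro borel_measurable_continuous_on_indicator continuous_intros) auto
      then show ?thesis by simp
    qed
  qed
qed

text \<open>Both contours are compared at height \<open>T\<close>; on the horizontal segment between them
  the integrand is at most of order \<open>exp (- 2 T\<^sup>2 / 3 + \<bar>z\<bar> (2 T))\<close>.\<close>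

lemma airy_vertical_eq_rays:
  assumes \<theta>: "pi / 4 \<le> \<theta>" "\<theta> < pi / 2"
  shows "airy_moment 0 z = 1 / (2 * of_real pi * \<i>) *
     (ray_integral (cis \<theta>) (\<lambda>v. exp (v ^ 3 / 3 - z * v)) - ray_integral (cis (- \<theta>)) (\<lambda>v. exp (v ^ 3 / 3 - z * v)))"
proof -
  let ?g = "\<lambda>v::complex. exp (v ^ 3 / 3 - z * v)"
  have "?g holomorphic_on UNIV" by (intro holomorphic_intros) auto
  then obtain F where F: "\<And>v. (F has_field_derivative ?g v) (at v)"
    using holomorphic_convex_primitive'[of UNIV ?g] by auto
  have s: "sin \<theta> > 0" using \<theta> pi_gt_zero by (intro sin_gt_zero) linarith+
  have c: "cos \<theta> > 0" using \<theta> pi_gt_zero by (intro cos_gt_zero_pi) linarith+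
  have cs: "cos \<theta> \<le> sin \<theta>"
  proof -
    have "cos \<theta> \<le> cos (pi / 4)" using \<theta> pi_gt_zero by (intro cos_monotone_0_pi_le) linarith+
    moreover have "sin (pi / 4) \<le> sin \<theta>" using \<theta> pi_gt_zero by (intro sin_monotone_2pi_le) linarith+
    ultimately show ?thesis by (simp add: sin_45 cos_45)
  qed
  \<comment> \<open>From \<theta> \<ge> pi / 4 follows cos^2 \<le> 1 / 2 < 3 / 4, so v^3 has
    negative real part along the ray.\<close>
  have c3: "cos (3 * \<theta>) < 0"
  proof -
    have "cos (3 * \<theta>) = cos \<theta> * (4 * (cos \<theta>)\<^sup>2 - 3)"
      using cos_treble_cos[of \<theta>] by (simp add: power2_eq_square power3_eq_cube algebra_simps)
    moreover have "(cos \<theta>)\<^sup>2 \<le> (sin \<theta>)\<^sup>2"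
      using power_mono[OF cs, of 2] c by simp
    then have "(cos \<theta>)\<^sup>2 \<le> 1 / 2"
      using sin_cos_squared_add[of \<theta>] by linarith
    with c \<open>(cos \<theta>)\<^sup>2 \<le> 1 / 2\<close> calculation show ?thesis by (simp add: mult_pos_neg)
  qed
  have ray: "((\<lambda>T. F (of_real T * cis \<phi>) - F 0) \<longlongrightarrow> ray_integral (cis \<phi>) ?g) at_top" if "\<phi> = \<theta> \<or> \<phi> = - \<theta>" for \<phi>
  proof -
    have c3': "cos (3 * \<phi>) < 0" using that c3 by auto
    have eq: "indicator {0..} x *\<^sub>R (cis \<phi> * ?g (of_real x * cis \<phi>)) = cis \<phi> * (indicator {0..} x *\<^sub>R ?g (of_real x * cis \<phi>))" for x :: real
      by simp
    have "((\<lambda>T. F (of_real T * cis \<phi>) - F (of_real 0 * cis \<phi>)) \<longlongrightarrow>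
       (LBINT x. indicator {0..} x *\<^sub>R (cis \<phi> * ?g (of_real x * cis \<phi>)))) at_top"
    proof (rule FTC_halfline)
      fix x :: real
      have "((\<lambda>x. F (x * cis \<phi>)) has_field_derivative ?g (of_real x * cis \<phi>) * cis \<phi>) (at (of_real x))"
        by (rule DERIV_chain2[OF F]) (auto intro!: derivative_eq_intros)
      from has_vector_derivative_real_field[OF this]
      show "((\<lambda>T. F (of_real T * cis \<phi>)) has_vector_derivative cis \<phi> * ?g (of_real x * cis \<phi>)) (at x)"
        by (simp add: mult.commute)
      show "integrable lborel (\<lambda>x. indicator {0..} x *\<^sub>R (cis \<phi> * ?g (of_real x * cis \<phi>)))"
        unfolding eq by (intro integrable_mult_right integrable_airy_ray c3')
    qed (auto intro!: continuous_intros)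
    moreover have "(LBINT x. indicator {0..} x *\<^sub>R (cis \<phi> * ?g (of_real x * cis \<phi>))) = ray_integral (cis \<phi>) ?g"
      unfolding eq ray_integral_def set_lebesgue_integral_def by (rule integral_mult_right_zero)
    ultimately show ?thesis by simp
  qed
  have vert: "((\<lambda>T. F (Complex 1 T) - F (Complex 1 (- T))) \<longlongrightarrow> \<i> * (LBINT y. airy_integrand 0 z y)) at_top"
  proof -
    have "((\<lambda>T. F (Complex 1 T) - F (Complex 1 (- T))) \<longlongrightarrow> (LBINT y. \<i> * airy_integrand 0 z y)) at_top"
    proof (rule FTC_line)
      fix x :: real
      have "((\<lambda>x. F (1 + \<i> * x)) has_field_derivative ?g (1 + \<i> * of_real x) * \<i>) (at (of_real x))"
        by (rule DERIV_chain2[OF F]) (auto intro!: derivative_eq_intros)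
      from has_vector_derivative_real_field[OF this]
      show "((\<lambda>T. F (Complex 1 T)) has_vector_derivative \<i> * airy_integrand 0 z x) (at x)"
        by (simp add: mult.commute Complex_eq_1 airy_integrand_def)
    qed (auto intro!: continuous_intros continuous_on_airy_integrand integrable_mult_right integrable_airy_integrand)
    then show ?thesis by simp
  qed
  \<comment> \<open>The sign s selects the upper or the lower end. T / sin \<theta> is the radius at
    which the ray reaches height T, and \<open>X\<close> below is the abscissa of that
    point.\<close>
  have join: "((\<lambda>T. F (Complex 1 (s * T)) - F (of_real (T / sin \<theta>) * cis (s * \<theta>))) \<longlongrightarrow> 0) at_top" if s1: "s = 1 \<or> s = -1" for s :: real
  proof (rule Lim_null_comparison)
    show "((\<lambda>T::real. T * exp (- (2 / 3) * T\<^sup>2 + cmod z * (2 * T))) \<longlongrightarrow> 0) at_top"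
      by real_asymp
    show "eventually (\<lambda>T. norm (F (Complex 1 (s * T)) - F (of_real (T / sin \<theta>) * cis (s * \<theta>))) \<le>
        T * exp (- (2 / 3) * T\<^sup>2 + cmod z * (2 * T))) at_top"
      using eventually_ge_at_top[of "max 1 (sin \<theta> / cos \<theta>)"]
    proof eventually_elim
      case (elim T)
      define X where "X = T * cos \<theta> / sin \<theta>"
      have T1: "T \<ge> 1" using elim by simp
      have "T * cos \<theta> \<le> T * sin \<theta>" using cs T1 by (intro mult_left_mono) auto
      then have X: "1 \<le> X" "X \<le> T"
        using elim s c by (auto simp: X_def field_simps)
      have e1: "of_real (T / sin \<theta>) * cis (s * \<theta>) = Complex X (s * T)"
        using s s1 by (auto simp: complex_eq_iff X_def)
      have "norm (F (Complex X (s * T)) - F (Complex 1 (s * T))) \<le> exp (- (2 / 3) * T\<^sup>2 + cmod z * (2 * T)) * norm (Complex X (s * T) - Complex 1 (s * T))"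
      proof (rule field_differentiable_bound[where S = "closed_segment (Complex 1 (s * T)) (Complex X (s * T))" and f' = ?g])
        fix v assume "v \<in> closed_segment (Complex 1 (s * T)) (Complex X (s * T))"
        then have v: "Im v = s * T" "Re v \<ge> 1" "Re v \<le> X"
          using X by (auto simp: closed_segment_same_Im closed_segment_eq_real_ivl)
        show "(F has_field_derivative ?g v) (at v within closed_segment (Complex 1 (s * T)) (Complex X (s * T)))"
          by (rule has_field_derivative_at_within[OF F])
        have "Re (v ^ 3) = Re v ^ 3 - 3 * Re v * T\<^sup>2"
          using v s1 by (auto simp: power3_eq_cube power2_eq_square algebra_simps)
        \<comment> \<open>Since Re v \<le> X \<le> T, the cube is at most Re v * T^2; then Re v
          \<ge> 1 is applied to the remaining - 2 Re v * T^2.\<close>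
        also have "\<dots> \<le> - 2 * T\<^sup>2"
        proof -
          have "Re v * (Re v)\<^sup>2 \<le> Re v * T\<^sup>2"
            using v X by (intro mult_left_mono power_mono) auto
          moreover have "1 * T\<^sup>2 \<le> Re v * T\<^sup>2" using v by (intro mult_right_mono) auto
          ultimately show ?thesis by (simp add: power3_eq_cube power2_eq_square)
        qed
        finally have a: "Re (v ^ 3) \<le> - 2 * T\<^sup>2" .
        have "cmod v \<le> 2 * T" using cmod_le[of v] v X s1 elim by auto
        then have "cmod (z * v) \<le> cmod z * (2 * T)" unfolding norm_mult by (intro mult_left_mono) auto
        then have b: "- Re (z * v) \<le> cmod z * (2 * T)" using abs_Re_le_cmod[of "z * v"] by linarith
        show "norm (?g v) \<le> exp (- (2 / 3) * T\<^sup>2 + cmod z * (2 * T))"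
          unfolding norm_exp_eq_Re exp_le_cancel_iff using a b by (simp only: minus_complex.simps Re_divide_numeral)
      qed auto
      also have "norm (Complex X (s * T) - Complex 1 (s * T)) = X - 1"
        using X by (simp add: cmod_def)
      also have "exp (- (2 / 3) * T\<^sup>2 + cmod z * (2 * T)) * (X - 1) \<le> exp (- (2 / 3) * T\<^sup>2 + cmod z * (2 * T)) * T"
        using X by (intro mult_left_mono) auto
      finally show ?case unfolding e1 by (simp add: norm_minus_commute mult.commute)
    qed
  qed
  have sc: "filterlim (\<lambda>T. T / sin \<theta>) at_top at_top" using s by real_asymp
  note r1 = filterlim_compose[OF ray[of \<theta>] sc] and r2 = filterlim_compose[OF ray[of "- \<theta>"] sc]
  have "((\<lambda>T. (F (Complex 1 (1 * T)) - F (of_real (T / sin \<theta>) * cis (1 * \<theta>)))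
      - (F (Complex 1 (- 1 * T)) - F (of_real (T / sin \<theta>) * cis (- 1 * \<theta>)))
      + ((F (of_real (T / sin \<theta>) * cis \<theta>) - F 0) - (F (of_real (T / sin \<theta>) * cis (- \<theta>)) - F 0)))
     \<longlongrightarrow> 0 - 0 + (ray_integral (cis \<theta>) ?g - ray_integral (cis (- \<theta>)) ?g)) at_top"
    by (intro tendsto_intros join r1 r2) auto
  also have "(\<lambda>T. (F (Complex 1 (1 * T)) - F (of_real (T / sin \<theta>) * cis (1 * \<theta>)))
      - (F (Complex 1 (- 1 * T)) - F (of_real (T / sin \<theta>) * cis (- 1 * \<theta>)))
      + ((F (of_real (T / sin \<theta>) * cis \<theta>) - F 0) - (F (of_real (T / sin \<theta>) * cis (- \<theta>)) - F 0)))
     = (\<lambda>T. F (Complex 1 T) - F (Complex 1 (- T)))" by (auto simp: fun_eq_iff)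
  finally have fin: "\<i> * (LBINT y. airy_integrand 0 z y) = ray_integral (cis \<theta>) ?g - ray_integral (cis (- \<theta>)) ?g"
    using tendsto_unique[OF trivial_limit_at_top_linorder vert] by simp
  show ?thesis unfolding airy_moment_def fin[symmetric] by (simp add: field_simps)
qed

text \<open>The vertical line serves as a normal form for two pairs of rays: those at angle pi / 3
  in the definition of \<open>Airy_Ai\<close> and those at angle pi / 4 in which the contour of the
  polynomial ends.\<close>

lemma Airy_Ai_eq_moment: "Airy_Ai z = airy_moment 0 z"
proof -
  have "airy_moment 0 z = 1 / (2 * of_real pi * \<i>) *
     (ray_integral (cis (pi / 3)) (\<lambda>v. exp (v ^ 3 / 3 - z * v)) - ray_integral (cis (- (pi / 3))) (\<lambda>v. exp (v ^ 3 / 3 - z * v)))"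
    by (rule airy_vertical_eq_rays) auto
  then show ?thesis by (simp add: Airy_Ai_def)
qed

lemma deriv_Airy_Ai: "deriv Airy_Ai z = - airy_moment 1 z"
  using DERIV_imp_deriv[OF airy_moment_has_field_derivative[of 0 z]]
  by (simp add: Airy_Ai_eq_moment[abs_def])

lemma continuous_on_airy_moment: "continuous_on A (airy_moment k)"
  using DERIV_isCont[OF airy_moment_has_field_derivative] by (intro continuous_at_imp_continuous_on) blast

section \<open>The Airy kernel as an overlap integral\<close>

definition airy_overlap :: "real \<Rightarrow> real \<Rightarrow> complex" where
  "airy_overlap x y = (LBINT r. indicator {0..} r *\<^sub>R (Airy_Ai (of_real (x + r)) * Airy_Ai (of_real (y + r))))"

lemma Airy_Ai_bound:
  obtains C where "C \<ge> 0" "\<And>x. norm (Airy_Ai (of_real x)) \<le> C * exp (- x)"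
  using norm_airy_moment_of_real_le[of 0] unfolding Airy_Ai_eq_moment by blast

lemma continuous_on_Airy_shift: "continuous_on A (\<lambda>r. Airy_Ai (of_real (x + r)))"
proof -
  have "continuous_on A (\<lambda>r. airy_moment 0 (of_real (x + r)))"
    by (rule continuous_on_compose2[OF continuous_on_airy_moment[of UNIV]]) (auto intro!: continuous_intros)
  then show ?thesis by (simp add: Airy_Ai_eq_moment)
qed

lemma airy_overlap_integrable:
  "integrable lborel (\<lambda>r. indicator {0..} r *\<^sub>R (Airy_Ai (of_real (x + r)) * Airy_Ai (of_real (y + r))))"
proof -
  obtain C where C: "C \<ge> 0" "\<And>x. norm (Airy_Ai (of_real x)) \<le> C * exp (- x)" using Airy_Ai_bound by blast
  show ?thesis
  proof (rule Bochner_Integration.integrable_bound)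
    show "integrable lborel (\<lambda>r. C * C * exp (- x) * exp (- y) * (indicator {0..} r *\<^sub>R exp (- 2 * r)))"
      by (intro integrable_mult_right integrable_exp_neg_halfline) auto
    show "AE r in lborel. norm (indicator {0..} r *\<^sub>R (Airy_Ai (of_real (x + r)) * Airy_Ai (of_real (y + r))))
       \<le> norm (C * C * exp (- x) * exp (- y) * (indicator {0..} r *\<^sub>R exp (- 2 * r)))"
    proof (intro AE_I2)
      fix r :: real
      have "norm (Airy_Ai (of_real (x + r)) * Airy_Ai (of_real (y + r))) \<le> (C * exp (- (x + r))) * (C * exp (- (y + r)))"
        unfolding norm_mult by (intro mult_mono C) (use C in auto)
      also have "\<dots> = C * C * exp (- x) * exp (- y) * exp (- 2 * r)"
        by (simp add: mult_exp_exp mult_ac)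
      finally show "norm (indicator {0..} r *\<^sub>R (Airy_Ai (of_real (x + r)) * Airy_Ai (of_real (y + r))))
       \<le> norm (C * C * exp (- x) * exp (- y) * (indicator {0..} r *\<^sub>R exp (- 2 * r)))"
        using C(1) by (auto simp: indicator_def)
    qed
    show "(\<lambda>r. indicator {0..} r *\<^sub>R (Airy_Ai (of_real (x + r)) * Airy_Ai (of_real (y + r)))) \<in> borel_measurable lborel"
    proof -
      have "(\<lambda>r. indicator {0..} r *\<^sub>R (Airy_Ai (of_real (x + r)) * Airy_Ai (of_real (y + r)))) \<in> borel_measurable borel"
        by (intro borel_measurable_continuous_on_indicator continuous_on_mult continuous_on_Airy_shift) auto
      then show ?thesis by simp
    qed
  qed
qed

text \<open>By the Airy equation the r-derivative of Ai(x + r) Ai'(y + r) - Ai'(x + r) Ai(y + r) is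
  (y - x) Ai(x + r) Ai(y + r), and the bracket vanishes at infinity.\<close>

lemma airy_overlap_eq_quotient:
  assumes "x \<noteq> y"
  shows "airy_overlap x y = Airy_quotient x y"
proof -
  let ?A = "\<lambda>x::real. airy_moment 0 (of_real x)" and ?B = "\<lambda>x::real. airy_moment 1 (of_real x)"
  let ?F = "\<lambda>r. - ?A (x + r) * ?B (y + r) + ?B (x + r) * ?A (y + r)"
  let ?f = "\<lambda>r. of_real (y - x) * (?A (x + r) * ?A (y + r))"
  have dA: "((\<lambda>r. airy_moment k (of_real (x + r))) has_vector_derivative (- airy_moment (Suc k) (of_real (x + r)))) (at r)" for k x r
  proof -
    have "((\<lambda>r. airy_moment k (of_real x + r)) has_field_derivative (- airy_moment (Suc k) (of_real x + of_real r)) * 1) (at (of_real r))"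
      by (rule DERIV_chain2[OF airy_moment_has_field_derivative]) (auto intro!: derivative_eq_intros)
    from has_vector_derivative_real_field[OF this] show ?thesis by simp
  qed
  have ode: "airy_moment (Suc (Suc 0)) z = z * airy_moment 0 z" for z
    using airy_moment_ode[of z] by (simp add: numeral_2_eq_2)
  have der: "(?F has_vector_derivative ?f r) (at r)" for r
  proof -
    have "(?F has_vector_derivative
      (- ?A (x + r) * (- airy_moment (Suc 1) (of_real (y + r))) + (- (- airy_moment (Suc 0) (of_real (x + r)))) * ?B (y + r)
       + (?B (x + r) * (- airy_moment (Suc 0) (of_real (y + r))) + (- airy_moment (Suc 1) (of_real (x + r))) * ?A (y + r)))) (at r)"
      by (intro has_vector_derivative_add has_vector_derivative_mult has_vector_derivative_minus dA)
    then show ?thesis by (rule has_vector_derivative_eq_rhs) (simp add: ode algebra_simps)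
  qed
  have int0: "integrable lborel (\<lambda>r. indicator {0..} r *\<^sub>R (?A (x + r) * ?A (y + r)))"
    using airy_overlap_integrable[of x y] by (simp add: Airy_Ai_eq_moment)
  have feq: "indicator {0..} r *\<^sub>R (?f r) = of_real (y - x) * (indicator {0..} r *\<^sub>R (?A (x + r) * ?A (y + r)))" for r :: real
    by (simp add: scaleR_conv_of_real)
  have "((\<lambda>T. ?F T - ?F 0) \<longlongrightarrow> (LBINT r. indicator {0..} r *\<^sub>R (?f r))) at_top"
  proof (rule FTC_halfline[OF der])
    show "continuous_on {0..} ?f"
      using continuous_on_Airy_shift[of "{0..}"] by (intro continuous_intros) (simp_all add: Airy_Ai_eq_moment)
    show "integrable lborel (\<lambda>r. indicator {0..} r *\<^sub>R (?f r))"
      unfolding feq by (intro integrable_mult_right int0)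
  qed
  moreover have "((\<lambda>T. ?F T - ?F 0) \<longlongrightarrow> (- 0 * 0 + 0 * 0) - ?F 0) at_top"
  proof -
    have lim: "((\<lambda>T. airy_moment k (of_real (u + T))) \<longlongrightarrow> 0) at_top" for k u
    proof -
      obtain C where C: "\<And>x. norm (airy_moment k (of_real x)) \<le> C * exp (- x)" using norm_airy_moment_of_real_le[of k] by blast
      show ?thesis
      proof (rule Lim_null_comparison[OF always_eventually])
        show "\<forall>T. norm (airy_moment k (of_real (u + T))) \<le> (C * exp (- u)) * exp (- T)"
        proof
          fix T
          have "exp (- (u + T)) = exp (- u) * exp (- T)" by (simp add: mult_exp_exp)
          then show "norm (airy_moment k (of_real (u + T))) \<le> (C * exp (- u)) * exp (- T)"
            using C[of "u + T"] by (simp only: mult.assoc)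
        qed
      qed (rule tendsto_exp_neg_at_top)
    qed
    show ?thesis by (intro tendsto_intros lim)
  qed
  ultimately have "(LBINT r. indicator {0..} r *\<^sub>R (?f r)) = - ?F 0"
    using tendsto_unique[OF trivial_limit_at_top_linorder] by fastforce
  then have "of_real (y - x) * airy_overlap x y = - ?F 0"
    unfolding feq airy_overlap_def Airy_Ai_eq_moment by (simp only: integral_mult_right_zero)
  then show ?thesis using assms
    by (simp add: Airy_quotient_def deriv_Airy_Ai Airy_Ai_eq_moment field_simps)
qed

lemma airy_overlap_tendsto:
  assumes "X \<longlonglongrightarrow> x" "Y \<longlonglongrightarrow> y"
  shows "(\<lambda>n. airy_overlap (X n) (Y n)) \<longlonglongrightarrow> airy_overlap x y"
proof -
  obtain C where C: "C \<ge> 0" "\<And>x. norm (Airy_Ai (of_real x)) \<le> C * exp (- x)" using Airy_Ai_bound by blast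
  obtain R where R: "\<And>n. norm (X n) \<le> R" using assms(1) by (meson BseqE convergentI convergent_imp_Bseq)
  obtain S where S: "\<And>n. norm (Y n) \<le> S" using assms(2) by (meson BseqE convergentI convergent_imp_Bseq)
  show ?thesis unfolding airy_overlap_def
  proof (rule integral_dominated_convergence[where w = "\<lambda>r. C * C * exp R * exp S * (indicator {0..} r *\<^sub>R exp (- 2 * r))"])
    show "integrable lborel (\<lambda>r. C * C * exp R * exp S * (indicator {0..} r *\<^sub>R exp (- 2 * r)))"
      by (intro integrable_mult_right integrable_exp_neg_halfline) auto
    have c: "isCont Airy_Ai z" for z
      using DERIV_isCont[OF airy_moment_has_field_derivative[of 0 z]] by (simp add: Airy_Ai_eq_moment[abs_def])
    show "AE r in lborel. (\<lambda>n. indicator {0..} r *\<^sub>R (Airy_Ai (of_real (X n + r)) * Airy_Ai (of_real (Y n + r))))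
        \<longlonglongrightarrow> indicator {0..} r *\<^sub>R (Airy_Ai (of_real (x + r)) * Airy_Ai (of_real (y + r)))"
      by (intro AE_I2 tendsto_intros isCont_tendsto_compose[OF c] assms)
    fix n
    show "AE r in lborel. norm (indicator {0..} r *\<^sub>R (Airy_Ai (of_real (X n + r)) * Airy_Ai (of_real (Y n + r))))
       \<le> C * C * exp R * exp S * (indicator {0..} r *\<^sub>R exp (- 2 * r))"
    proof (intro AE_I2)
      fix r :: real
      have "norm (Airy_Ai (of_real (X n + r)) * Airy_Ai (of_real (Y n + r))) \<le> (C * exp (- (X n + r))) * (C * exp (- (Y n + r)))"
        unfolding norm_mult by (intro mult_mono C) (use C in auto)
      also have "\<dots> = (C * C * exp (- 2 * r)) * exp (- X n - Y n)"
        by (simp add: mult_exp_exp mult_ac)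
      also have "\<dots> \<le> (C * C * exp (- 2 * r)) * exp (R + S)"
        using R[of n] S[of n] C(1) by (intro mult_left_mono) auto
      also have "\<dots> = C * C * exp R * exp S * exp (- 2 * r)"
        by (simp add: exp_add mult_ac)
      finally show "norm (indicator {0..} r *\<^sub>R (Airy_Ai (of_real (X n + r)) * Airy_Ai (of_real (Y n + r))))
       \<le> C * C * exp R * exp S * (indicator {0..} r *\<^sub>R exp (- 2 * r))"
        by (auto simp: indicator_def)
    qed
  qed (use airy_overlap_integrable in auto)
qed

lemma airy_overlap_isCont: "continuous (at (x, y)) (\<lambda>(u, v). airy_overlap u v)"
  unfolding continuous_at_sequentially
proof (intro allI impI)
  fix f assume "f \<longlonglongrightarrow> (x, y)"
  from airy_overlap_tendsto[OF tendsto_fst[OF this] tendsto_snd[OF this]]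
  show "((\<lambda>(u, v). airy_overlap u v) \<circ> f) \<longlonglongrightarrow> (case (x, y) of (u, v) \<Rightarrow> airy_overlap u v)"
    by (simp add: o_def case_prod_beta)
qed

text \<open>On the diagonal the overlap integral is the required limit because it is continuous on
  the whole plane; \<open>Lim\<close> returns it because (x, x) is a limit point of the off-diagonal
  set.\<close>

lemma Airy_kernel_eq_overlap: "Airy_kernel x y = airy_overlap x y"
proof (cases "x = y")
  case True
  have "((\<lambda>(u, v). airy_overlap u v) \<longlongrightarrow> airy_overlap x x) (at (x, x) within {(u, v). u \<noteq> v})"
    using airy_overlap_isCont[of x x] by (auto simp: continuous_at intro: tendsto_within_subset)
  then have lim: "((\<lambda>(u, v). Airy_quotient u v) \<longlongrightarrow> airy_overlap x x) (at (x, x) within {(u, v). u \<noteq> v})"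
    by (rule Lim_transform_eventually)
       (auto simp: eventually_at_filter airy_overlap_eq_quotient intro!: always_eventually)
  have "(x, x) islimpt {(u, v). u \<noteq> v}"
    unfolding islimpt_approachable
  proof (intro allI impI)
    fix e :: real assume "e > 0"
    then show "\<exists>x'\<in>{(u, v). u \<noteq> v}. x' \<noteq> (x, x) \<and> dist x' (x, x) < e"
      by (intro bexI[of _ "(x + e / 2, x)"]) (auto simp: dist_Pair_Pair dist_norm)
  qed
  then have "at (x, x) within {(u, v). u \<noteq> v} \<noteq> bot"
    by (simp add: trivial_limit_within)
  from tendsto_Lim[OF this lim] show ?thesis using True by (simp add: Airy_kernel_def)
qed (simp add: Airy_kernel_def airy_overlap_eq_quotient)

section \<open>Factorization of the correlation kernel\<close>

lemma prod_falling_eq_pochhammer: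
  fixes z :: "'a::comm_ring_1"
  shows "(\<Prod>k<n. z - of_nat k) = pochhammer (z - of_nat n + 1) n"
proof -
  have "(\<Prod>k<n. z - of_nat k) = (\<Prod>i<n. z - of_nat (n - Suc i))"
    by (rule prod.nat_diff_reindex[symmetric])
  also have "\<dots> = (\<Prod>i<n. z - of_nat n + 1 + of_nat i)"
    by (intro prod.cong refl) (auto simp: of_nat_diff)
  finally show ?thesis by (simp add: pochhammer_prod atLeast0LessThan)
qed

lemma Gamma_quotient_falling:
  fixes z :: complex
  assumes "z - of_nat n + 1 \<notin> \<int>\<^sub>\<le>\<^sub>0"
  shows "(\<Prod>k<n. z - of_nat k) = Gamma (z + 1) / Gamma (z - of_nat n + 1)"
  using pochhammer_Gamma[OF assms, of n] by (simp add: prod_falling_eq_pochhammer)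

lemma Re_pos_not_nonpos_Int: "Re z > 0 \<Longrightarrow> z \<notin> \<int>\<^sub>\<le>\<^sub>0"
  by (auto elim!: nonpos_Ints_cases')

text \<open>N uses of the functional equation trade a larger real part for decay in the imaginary
  direction. The case N = 2 makes the vertical integrals converge.\<close>

lemma norm_Gamma_le_power:
  fixes z :: complex
  assumes "Re z > 0"
  shows "norm (Gamma z) \<le> Gamma (Re z + real N) / norm z ^ N"
proof -
  have z0: "norm z > 0" using assms by auto
  have g: "Gamma (z + of_nat N) = pochhammer z N * Gamma z"
    using pochhammer_Gamma[of z N] Re_pos_not_nonpos_Int[OF assms] by (simp add: Gamma_eq_zero_iff)
  have "norm z ^ N = (\<Prod>i<N. norm z)" by simp
  also have "\<dots> \<le> (\<Prod>i<N. norm (z + of_nat i))"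
    using assms by (intro prod_mono) (auto simp: cmod_def intro!: real_sqrt_le_mono power_mono)
  also have "\<dots> = norm (pochhammer z N)" by (simp add: pochhammer_prod prod_norm atLeast0LessThan)
  finally have "norm z ^ N * norm (Gamma z) \<le> norm (Gamma (z + of_nat N))"
    unfolding g norm_mult by (intro mult_right_mono) auto
  also have "\<dots> \<le> Gamma (Re (z + of_nat N))" using assms by (intro norm_Gamma_le_Re) auto
  finally show ?thesis using z0 by (simp add: field_simps)
qed

lemma Gamma_bounded_Icc:
  fixes a b :: real
  assumes "a > 0"
  obtains C where "C > 0" "\<And>x. x \<in> {a..b} \<Longrightarrow> Gamma x \<le> C"
proof -
  have "compact (Gamma ` {a..b})"
    using assms by (intro compact_continuous_image continuous_on_Gamma continuous_on_id) (auto elim!: nonpos_Ints_cases')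
  then obtain C where "\<And>y. y \<in> Gamma ` {a..b} \<Longrightarrow> norm y \<le> C"
    using compact_imp_bounded bounded_iff by metis
  then have "\<And>x. x \<in> {a..b} \<Longrightarrow> Gamma x \<le> \<bar>C\<bar> + 1" by fastforce
  then show ?thesis using that[of "\<bar>C\<bar> + 1"] by simp
qed

lemma integral_exp_complex_halfline:
  fixes w :: complex
  assumes "Re w > 0"
  shows "integrable lborel (\<lambda>r. indicator {0..} r *\<^sub>R exp (- of_real r * w))"
    and "(LBINT r. indicator {0..} r *\<^sub>R exp (- of_real r * w)) = 1 / w"
proof -
  have w: "w \<noteq> 0" using assms by auto
  show int: "integrable lborel (\<lambda>r. indicator {0..} r *\<^sub>R exp (- of_real r * w))"
  proof (rule Bochner_Integration.integrable_bound)
    show "integrable lborel (\<lambda>r. indicator {0..} r *\<^sub>R exp (- Re w * r))"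
      by (intro integrable_exp_neg_halfline assms)
    have "(\<lambda>r. indicator {0..} r *\<^sub>R exp (- of_real r * w)) \<in> borel_measurable borel"
      by (intro borel_measurable_continuous_on_indicator continuous_intros) auto
    then show "(\<lambda>r. indicator {0..} r *\<^sub>R exp (- of_real r * w)) \<in> borel_measurable lborel" by simp
  qed (auto simp: indicator_def)
  let ?F = "\<lambda>r::real. - exp (- of_real r * w) / w"
  have "((\<lambda>T. ?F T - ?F 0) \<longlongrightarrow> (LBINT r. indicator {0..} r *\<^sub>R exp (- of_real r * w))) at_top"
  proof (rule FTC_halfline[OF _ _ int])
    fix x :: real
    have "((\<lambda>r. - exp (- r * w) / w) has_field_derivative exp (- of_real x * w)) (at (of_real x))"
      using w by (auto intro!: derivative_eq_intros)
    from has_vector_derivative_real_field[OF this]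
    show "(?F has_vector_derivative exp (- of_real x * w)) (at x)" .
  qed (auto intro!: continuous_intros)
  moreover have "((\<lambda>T. ?F T - ?F 0) \<longlongrightarrow> 0 - ?F 0) at_top"
  proof (intro tendsto_diff tendsto_const)
    show "(?F \<longlongrightarrow> 0) at_top"
    proof (rule Lim_null_comparison)
      show "\<forall>\<^sub>F T in at_top. norm (?F T) \<le> exp (- Re w * T) / norm w"
        by (intro always_eventually) (auto simp: norm_divide mult.commute)
      show "((\<lambda>T. exp (- Re w * T) / norm w) \<longlongrightarrow> 0) at_top"
        using assms w by real_asymp
    qed
  qed
  ultimately show "(LBINT r. indicator {0..} r *\<^sub>R exp (- of_real r * w)) = 1 / w"
    using tendsto_unique[OF trivial_limit_at_top_linorder] by fastforce
qed

section \<open>The integrand as a product and the residue sum\<close>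

locale truncated_product =
  fixes M \<kappa> :: nat and \<nu> :: "nat \<Rightarrow> nat"
  assumes M: "M \<ge> 2" and nu0: "\<nu> 0 = 0" and kappa: "\<kappa> > \<nu> 1"
begin

text \<open>Through \<open>rGamma\<close> this is holomorphic for Re t > -1, so the poles of
  \<open>Fac\<close> there come only from the denominator, and \<open>coef\<close> collects the
  residues.\<close>

definition "Phi n t = Gamma (t + of_nat n + of_nat \<kappa>) * (\<Prod>j=1..M. rGamma (t + of_nat (\<nu> j) + 1))"
  for t :: complex

definition "Fac n t = Phi n t / (\<Prod>k<n. t - of_nat k)"

text \<open>The reciprocal of \<open>Fac\<close>, written without division so that its zeros at
  \<open>0, ..., n - 1\<close> are explicit factors.\<close>

definition "Ginv n s = (\<Prod>j=1..M. Gamma (s + of_nat (\<nu> j) + 1)) * rGamma (s + of_nat n + of_nat \<kappa>) * (\<Prod>k<n. s - of_nat k)"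
  for s :: complex

definition "coef n k = Phi n (of_nat k) / (\<Prod>j\<in>{..<n} - {k}. of_nat k - of_nat j)"

definition "Ppoly n x = (\<Sum>k<n. coef n k * of_real x ^ k)" for x :: real

lemma kernel_integrand_eq:
  assumes s: "Re s > -1" "s - of_nat n + 1 \<notin> \<int>\<^sub>\<le>\<^sub>0" and t: "Re t > -1" "t - of_nat n + 1 \<notin> \<int>\<^sub>\<le>\<^sub>0"
  shows "kernel_integrand M \<nu> \<kappa> n x y s t = Fac n t * Ginv n s * (of_real x powr t * of_real y powr (- s - 1) / (s - t))"
proof -
  have g: "Gamma (z + of_nat (\<nu> j) + 1) \<noteq> 0" if "Re z > -1" for z j
    using that by (auto simp: Gamma_eq_zero_iff intro!: Re_pos_not_nonpos_Int)
  have g1: "Gamma (z + 1) \<noteq> 0" if "Re z > -1" for z :: complex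
    using g[of z 0] nu0 that by simp
  have "(\<Prod>j=0..M. Gamma (s + of_nat (\<nu> j) + 1) / Gamma (t + of_nat (\<nu> j) + 1)) =
      Gamma (s + 1) / Gamma (t + 1) * ((\<Prod>j=1..M. Gamma (s + of_nat (\<nu> j) + 1)) * (\<Prod>j=1..M. rGamma (t + of_nat (\<nu> j) + 1)))"
    by (simp add: prod.atLeast_Suc_atMost nu0 prod_dividef rGamma_inverse_Gamma prod_inversef [unfolded o_def, symmetric] divide_inverse prod.distrib)
  moreover have "Gamma (s + 1) = (\<Prod>k<n. s - of_nat k) * Gamma (s - of_nat n + 1)"
    using Gamma_quotient_falling[OF s(2)] s(2) by (simp add: Gamma_eq_zero_iff)
  moreover have "Gamma (t + 1) = (\<Prod>k<n. t - of_nat k) * Gamma (t - of_nat n + 1)"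
    using Gamma_quotient_falling[OF t(2)] t(2) by (simp add: Gamma_eq_zero_iff)
  moreover have "Gamma (s - of_nat n + 1) \<noteq> 0" "Gamma (t - of_nat n + 1) \<noteq> 0"
    using s t by (auto simp: Gamma_eq_zero_iff)
  ultimately show ?thesis
    unfolding kernel_integrand_def Fac_def Ginv_def Phi_def
    by (simp add: rGamma_inverse_Gamma field_simps)
qed

lemma Phi_holomorphic: "Phi n holomorphic_on {t. Re t > -1}"
  unfolding Phi_def using kappa
  by (intro holomorphic_intros) (auto intro!: Re_pos_not_nonpos_Int)

text \<open>The bound c serves two cases: -1/2 for the contour of the kernel and -1 for the
  rectangle in the analysis of the polynomial. With c < 0 the half-plane contains all poles.\<close>

lemma contour_integral_Fac:
  assumes c: "c \<ge> -1" and h: "h holomorphic_on {t. Re t > c}"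
    and g: "valid_path g" "pathfinish g = pathstart g" "path_image g \<subseteq> {t. Re t > c} - of_nat ` {..<n}"
    and w: "\<And>k. k < n \<Longrightarrow> winding_number g (of_nat k) = 1"
    and kc: "c < 0"
  shows "contour_integral g (\<lambda>t. Fac n t * h t) = 2 * of_real pi * \<i> * (\<Sum>k<n. coef n k * h (of_nat k))"
proof -
  let ?S = "{t::complex. Re t > c}" and ?p = "of_nat ` {..<n} :: complex set"
  have op: "open ?S" by (simp add: open_halfspace_Re_gt)
  have cv: "convex ?S" by (simp add: convex_halfspace_Re_gt)
  have Ph: "Phi n holomorphic_on ?S" by (rule holomorphic_on_subset[OF Phi_holomorphic]) (use c in auto)
  have "contour_integral g (\<lambda>t. Fac n t * h t) = 2 * pi * \<i> * (\<Sum>p\<in>?p. winding_number g p * residue (\<lambda>t. Fac n t * h t) p)"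
  proof (rule Residue_theorem)
    show "(\<lambda>t. Fac n t * h t) holomorphic_on ?S - ?p"
      unfolding Fac_def
      by (intro holomorphic_intros holomorphic_on_subset[OF Ph] holomorphic_on_subset[OF h]) auto
    show "\<forall>z. z \<notin> ?S \<longrightarrow> winding_number g z = 0"
      using winding_number_zero_outside[OF valid_path_imp_path[OF g(1)] cv g(2)] g(3) by blast
  qed (use op cv g convex_connected in auto)
  also have "(\<Sum>p\<in>?p. winding_number g p * residue (\<lambda>t. Fac n t * h t) p) = (\<Sum>k<n. coef n k * h (of_nat k))"
  proof (subst sum.reindex)
    show "inj_on (of_nat :: nat \<Rightarrow> complex) {..<n}" by (simp add: inj_on_def)
    show "sum ((\<lambda>p. winding_number g p * residue (\<lambda>t. Fac n t * h t) p) \<circ> of_nat) {..<n} = (\<Sum>k<n. coef n k * h (of_nat k))"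
    proof (rule sum.cong[OF refl], simp only: o_def)
      fix k assume k: "k \<in> {..<n}"
      let ?f = "\<lambda>w. Phi n w / (\<Prod>j\<in>{..<n} - {k}. w - of_nat j) * h w"
      let ?T = "?S - of_nat ` ({..<n} - {k})"
      have eq: "(\<lambda>t. Fac n t * h t) = (\<lambda>w. ?f w / (w - of_nat k))"
        using k by (intro ext) (simp add: Fac_def prod.remove[of "{..<n}" k] divide_simps)
      have "residue (\<lambda>w. ?f w / (w - of_nat k)) (of_nat k) = ?f (of_nat k)"
      proof (rule residue_simple)
        show "open ?T" using op by (intro open_Diff finite_imp_closed) auto
        show "of_nat k \<in> ?T" using kc by auto
        show "?f holomorphic_on ?T"
          by (intro holomorphic_intros holomorphic_on_subset[OF Ph] holomorphic_on_subset[OF h]) auto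
      qed
      then show "winding_number g (of_nat k) * residue (\<lambda>t. Fac n t * h t) (of_nat k) = coef n k * h (of_nat k)"
        unfolding eq using w k by (simp add: coef_def)
    qed
  qed
  finally show ?thesis by simp
qed

lemma inner_contour_integral:
  assumes "admissible_contour n g" "Re s = -1/2" "x > 0"
  shows "contour_integral g (kernel_integrand M \<nu> \<kappa> n x y s) =
    2 * of_real pi * \<i> * (\<Sum>k<n. coef n k * of_real x ^ k * (Ginv n s * of_real y powr (- s - 1) / (s - of_nat k)))"
proof -
  let ?h = "\<lambda>t. Ginv n s * (of_real x powr t * of_real y powr (- s - 1) / (s - t))"
  \<comment> \<open>The exceptional z are the integers up to n - 1; those with real part above -1
    are the excluded points.\<close>
  have nin: "z - of_nat n + 1 \<notin> \<int>\<^sub>\<le>\<^sub>0" if "Re z > -1" "z \<notin> of_nat ` {..<n}" for z :: complex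
  proof
    assume "z - of_nat n + 1 \<in> \<int>\<^sub>\<le>\<^sub>0"
    then obtain m where "z - of_nat n + 1 = - of_nat m" by (auto elim!: nonpos_Ints_cases')
    then have z: "z = of_int (int n - 1 - int m)" by (simp add: algebra_simps)
    then have "int n - 1 - int m \<ge> 0" using that by simp
    then have "z = of_nat (n - 1 - m)" "n - 1 - m < n"
      using z by (auto simp: of_nat_diff nat_less_real_le split: if_splits)
    then show False using that by auto
  qed
  have ns: "s - of_nat n + 1 \<notin> \<int>\<^sub>\<le>\<^sub>0" using assms(2) by (intro nin) auto
  have g: "valid_path g" "pathfinish g = pathstart g" "path_image g \<subseteq> {t. Re t > -1/2} - of_nat ` {..<n}"
     "\<And>k. k < n \<Longrightarrow> winding_number g (of_nat k) = 1"
    using assms(1) by (auto simp: admissible_contour_def)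
  have "contour_integral g (kernel_integrand M \<nu> \<kappa> n x y s) = contour_integral g (\<lambda>t. Fac n t * ?h t)"
  proof (rule contour_integral_eq)
    fix t assume "t \<in> path_image g"
    then have "Re t > -1" "t \<notin> of_nat ` {..<n}" using g(3) by force+
    then show "kernel_integrand M \<nu> \<kappa> n x y s t = Fac n t * ?h t"
      using kernel_integrand_eq[OF _ ns _ nin] assms(2) by simp
  qed
  also have "\<dots> = 2 * of_real pi * \<i> * (\<Sum>k<n. coef n k * ?h (of_nat k))"
    using assms g by (intro contour_integral_Fac) (auto intro!: holomorphic_intros)
  also have "(\<Sum>k<n. coef n k * ?h (of_nat k)) = (\<Sum>k<n. coef n k * of_real x ^ k * (Ginv n s * of_real y powr (- s - 1) / (s - of_nat k)))"
    using assms(3) by (intro sum.cong refl) (simp add: powr_nat' field_simps)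
  finally show ?thesis .
qed

text \<open>The Gamma factor for j = 1 is spent on \<open>rGamma (s + n + \<kappa>)\<close> and the
  polynomial: together these have modulus at most 1. The factor for j = 2, present because M \<ge>
  2, supplies the quadratic decay, and the others are bounded on the strip.\<close>

lemma Ginv_bound:
  assumes "n \<ge> 1"
  obtains C where "C > 0" "\<And>s. - 1 / 2 \<le> Re s \<Longrightarrow> Re s \<le> \<sigma> \<Longrightarrow> norm (Ginv n s) \<le> C / (1 + (Im s)\<^sup>2)"
proof -
  define B where "B = (\<lambda>j. SOME C. C > 0 \<and> (\<forall>x\<in>{1 / 2..\<sigma> + real (\<nu> j) + 3}. Gamma x \<le> C))"
  have B: "B j > 0 \<and> (\<forall>x\<in>{1 / 2..\<sigma> + real (\<nu> j) + 3}. Gamma x \<le> B j)" for j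
    unfolding B_def by (rule someI_ex) (metis Gamma_bounded_Icc half_gt_zero zero_less_one)
  define C where "C = 4 * (\<Prod>j=2..M. B j)"
  have "C > 0" unfolding C_def using B by (auto intro!: mult_pos_pos prod_pos)
  moreover have "norm (Ginv n s) \<le> C / (1 + (Im s)\<^sup>2)" if s: "- 1 / 2 \<le> Re s" "Re s \<le> \<sigma>" for s
  proof -
    \<comment> \<open>N is the difference of the two Gamma arguments. By \<open>kappa\<close> it is
      at least n, so the Pochhammer symbol has a factor to match every s - k.\<close>
    define N where "N = n + \<kappa> - \<nu> 1 - 1"
    have N: "N \<ge> n" "\<nu> 1 + 1 + N = n + \<kappa>" using kappa by (auto simp: N_def)
    have "Re (s + of_nat (\<nu> 1) + 1) > 0" using s by simp
    then have "s + of_nat (\<nu> 1) + 1 \<notin> \<int>\<^sub>\<le>\<^sub>0" by (rule Re_pos_not_nonpos_Int)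
    then have poch: "pochhammer (s + of_nat (\<nu> 1) + 1) N = Gamma (s + of_nat (\<nu> 1) + 1 + of_nat N) / Gamma (s + of_nat (\<nu> 1) + 1)"
      "Gamma (s + of_nat (\<nu> 1) + 1) \<noteq> 0"
      by (auto simp: pochhammer_Gamma Gamma_eq_zero_iff)
    have e: "s + of_nat (\<nu> 1) + 1 + of_nat N = s + of_nat n + of_nat \<kappa>"
      using arg_cong[OF N(2), of "of_nat :: nat \<Rightarrow> complex"] by (simp add: algebra_simps)
    have "Re (s + of_nat n + of_nat \<kappa>) > 0" using s assms by simp
    then have "Gamma (s + of_nat n + of_nat \<kappa>) \<noteq> 0" using Re_pos_not_nonpos_Int[of "s + of_nat n + of_nat \<kappa>"] by (simp add: Gamma_eq_zero_iff)
    then have q: "Gamma (s + of_nat (\<nu> 1) + 1) * rGamma (s + of_nat n + of_nat \<kappa>) = 1 / pochhammer (s + of_nat (\<nu> 1) + 1) N"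
      unfolding poch(1) e rGamma_inverse_Gamma by (simp add: divide_inverse)
    \<comment> \<open>The points i and - i - 1 are mirror images in the line Re s = -1/2. To the
      right of it s is at least as far from - i - 1 as from i, and not closer to - i - 1 - \<nu>
      1.\<close>
    have lower: "norm (s + of_nat (\<nu> 1) + 1 + of_nat i) \<ge> norm (s - of_nat i)" for i
    proof -
      have "\<bar>Re (s - of_nat i)\<bar> \<le> \<bar>Re (s + of_nat (\<nu> 1) + 1 + of_nat i)\<bar>" using s by (simp add: abs_le_iff)
      then have "(Re (s - of_nat i))\<^sup>2 \<le> (Re (s + of_nat (\<nu> 1) + 1 + of_nat i))\<^sup>2" by (simp only: abs_le_square_iff)
      then show ?thesis by (simp add: cmod_def)
    qed
    have big: "norm (s + of_nat (\<nu> 1) + 1 + of_nat i) \<ge> 1" if "i \<ge> n" for i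
    proof -
      have "real i \<ge> 1" using that assms by simp
      then have "Re (s + of_nat (\<nu> 1) + 1 + of_nat i) \<ge> 1" using s by simp
      then show ?thesis using complex_Re_le_cmod[of "s + of_nat (\<nu> 1) + 1 + of_nat i"] by linarith
    qed
    have "norm (\<Prod>k<n. s - of_nat k) = (\<Prod>k<n. norm (s - of_nat k)) * 1" by (simp add: prod_norm)
    also have "\<dots> \<le> (\<Prod>k<n. norm (s + of_nat (\<nu> 1) + 1 + of_nat k)) * (\<Prod>k\<in>{n..<N}. norm (s + of_nat (\<nu> 1) + 1 + of_nat k))"
      by (intro mult_mono prod_mono prod_ge_1 prod_nonneg) (use lower big in auto)
    also have "\<dots> = norm (pochhammer (s + of_nat (\<nu> 1) + 1) N)"
      using N(1) prod.atLeastLessThan_concat[of 0 n N "\<lambda>k. norm (s + of_nat (\<nu> 1) + 1 + of_nat k)"]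
      by (simp add: pochhammer_prod prod_norm atLeast0LessThan)
    finally have r1: "norm (Gamma (s + of_nat (\<nu> 1) + 1) * rGamma (s + of_nat n + of_nat \<kappa>) * (\<Prod>k<n. s - of_nat k)) \<le> 1"
      unfolding q norm_mult norm_divide by (simp add: divide_le_eq_1)
    have M2: "{1..M} = insert 1 {2..M}" using M by auto
    have "Ginv n s = (\<Prod>j=2..M. Gamma (s + of_nat (\<nu> j) + 1)) * (Gamma (s + of_nat (\<nu> 1) + 1) * rGamma (s + of_nat n + of_nat \<kappa>) * (\<Prod>k<n. s - of_nat k))"
      unfolding Ginv_def M2 by simp
    also have "norm \<dots> \<le> norm (\<Prod>j=2..M. Gamma (s + of_nat (\<nu> j) + 1)) * 1"
      unfolding norm_mult[of "prod _ _"] by (intro mult_left_mono r1) auto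
    also have "\<dots> = norm (Gamma (s + of_nat (\<nu> 2) + 1)) * (\<Prod>j=3..M. norm (Gamma (s + of_nat (\<nu> j) + 1)))"
    proof -
      have "{2..M} = insert 2 {3..M}" using M by auto
      then show ?thesis by (simp add: norm_mult prod_norm)
    qed
    also have "\<dots> \<le> (B 2 * 4 / (1 + (Im s)\<^sup>2)) * (\<Prod>j=3..M. B j)"
    proof (intro mult_mono prod_mono conjI)
      let ?z = "s + of_nat (\<nu> 2) + 1"
      have "1 / 4 + (Im s)\<^sup>2 \<le> (norm ?z)\<^sup>2"
      proof -
        have "(1 / 2)\<^sup>2 \<le> (Re ?z)\<^sup>2" using s by (intro power_mono) auto
        then show ?thesis unfolding cmod_power2 by (simp add: power2_eq_square)
      qed
      then have z2: "(1 + (Im s)\<^sup>2) / 4 \<le> (norm ?z)\<^sup>2"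
        by (rule order_trans[rotated]) (simp add: field_simps)
      have "norm (Gamma ?z) \<le> Gamma (Re ?z + real 2) / (norm ?z)\<^sup>2"
        using s by (intro norm_Gamma_le_power) auto
      also have "\<dots> \<le> B 2 / ((1 + (Im s)\<^sup>2) / 4)"
        using z2 B[of 2] s by (intro frac_le) (auto simp: add_pos_nonneg add.commute add.left_commute)
      finally show "norm (Gamma ?z) \<le> B 2 * 4 / (1 + (Im s)\<^sup>2)" by simp
      fix j
      have "norm (Gamma (s + of_nat (\<nu> j) + 1)) \<le> Gamma (Re (s + of_nat (\<nu> j) + 1))"
        using s by (intro norm_Gamma_le_Re) auto
      also have "\<dots> \<le> B j" using B[of j] s by auto
      finally show "norm (Gamma (s + of_nat (\<nu> j) + 1)) \<le> B j" .
      have B0: "0 \<le> B j" for j using B[of j] by linarith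
      have "1 + (Im s)\<^sup>2 \<ge> 0" by (simp add: add_nonneg_nonneg)
      then show "0 \<le> B 2 * 4 / (1 + (Im s)\<^sup>2)"
        using B0[of 2] by (intro divide_nonneg_nonneg) auto
    qed (auto intro!: prod_nonneg)
    also have "\<dots> = C / (1 + (Im s)\<^sup>2)"
    proof -
      have "{2..M} = insert 2 {3..M}" using M by auto
      then show ?thesis by (simp add: C_def)
    qed
    finally show ?thesis .
  qed
  ultimately show ?thesis using that by blast
qed

end

section \<open>Moving the vertical line to the right of the poles\<close>

lemma has_vector_derivative_vertical:
  assumes "(W has_field_derivative g (Complex c u)) (at (Complex c u))"
  shows "((\<lambda>u. W (Complex c u)) has_vector_derivative \<i> * g (Complex c u)) (at u)"
proof -
  have e: "Complex c u = of_real c + \<i> * of_real u" for u by (simp add: complex_eq_iff)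
  have "((\<lambda>x. W (of_real c + \<i> * x)) has_field_derivative g (Complex c u) * \<i>) (at (of_real u))"
    by (rule DERIV_chain2[where f = W]) (use assms in \<open>auto intro!: derivative_eq_intros simp: e\<close>)
  from has_vector_derivative_real_field[OF this] show ?thesis by (simp add: e mult.commute)
qed

lemma continuous_on_Complex: "continuous_on A (\<lambda>u. Complex c u)"
proof -
  have "(\<lambda>u. Complex c u) = (\<lambda>u. of_real c + \<i> * of_real u)" by (auto simp: complex_eq_iff)
  then show ?thesis by (simp add: continuous_intros)
qed

text \<open>A primitive is compared at the ends of the two lines; the horizontal segments between
  them contribute at most (b - a) C / (1 + T^2). The bound is only required for |Im s| \<ge> 1,
  which in the application keeps s at distance at least 1 from the removed pole k.\<close>

lemma vertical_line_shift:
  fixes g :: "complex \<Rightarrow> complex"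
  assumes holo: "g holomorphic_on {s. Re s > c}" and ab: "c < a" "a \<le> b"
    and bound: "\<And>s. a \<le> Re s \<Longrightarrow> Re s \<le> b \<Longrightarrow> \<bar>Im s\<bar> \<ge> 1 \<Longrightarrow> norm (g s) \<le> C / (1 + (Im s)\<^sup>2)"
    and int: "integrable lborel (\<lambda>u. g (Complex a u))" "integrable lborel (\<lambda>u. g (Complex b u))"
  shows "(LBINT u. g (Complex a u)) = (LBINT u. g (Complex b u))"
proof -
  obtain W where W: "\<And>s. Re s > c \<Longrightarrow> (W has_field_derivative g s) (at s)"
    using holomorphic_convex_primitive'[of "{s. Re s > c}" g] holo
    by (auto simp: convex_halfspace_Re_gt open_halfspace_Re_gt at_within_open[OF _ open_halfspace_Re_gt])
  have vert: "((\<lambda>T. W (Complex d T) - W (Complex d (- T))) \<longlongrightarrow> \<i> * (LBINT u. g (Complex d u))) at_top"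
    if d: "d > c" "integrable lborel (\<lambda>u. g (Complex d u))" for d
  proof -
    have "((\<lambda>T. W (Complex d T) - W (Complex d (- T))) \<longlongrightarrow> (LBINT u. \<i> * g (Complex d u))) at_top"
    proof (rule FTC_line)
      show "continuous_on UNIV (\<lambda>u. \<i> * g (Complex d u))"
        by (intro continuous_intros continuous_on_compose2[OF holomorphic_on_imp_continuous_on[OF holo]] continuous_on_Complex)
           (use d in auto)
    qed (use d in \<open>auto intro!: has_vector_derivative_vertical W integrable_mult_right\<close>)
    then show ?thesis by simp
  qed
  have join: "((\<lambda>T. W (Complex b (s * T)) - W (Complex a (s * T))) \<longlongrightarrow> 0) at_top" if s1: "s = 1 \<or> s = -1" for s :: real
  proof (rule Lim_null_comparison)
    show "((\<lambda>T::real. C / (1 + T\<^sup>2) * (b - a)) \<longlongrightarrow> 0) at_top" by real_asymp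
    show "\<forall>\<^sub>F T in at_top. norm (W (Complex b (s * T)) - W (Complex a (s * T))) \<le> C / (1 + T\<^sup>2) * (b - a)"
      using eventually_ge_at_top[of 1]
    proof eventually_elim
      case (elim T)
      have "norm (W (Complex b (s * T)) - W (Complex a (s * T))) \<le> C / (1 + T\<^sup>2) * norm (Complex b (s * T) - Complex a (s * T))"
      proof (rule field_differentiable_bound[where S = "closed_segment (Complex a (s * T)) (Complex b (s * T))" and f' = g])
        fix v assume "v \<in> closed_segment (Complex a (s * T)) (Complex b (s * T))"
        then have v: "Im v = s * T" "Re v \<ge> a" "Re v \<le> b"
          using ab by (auto simp: closed_segment_same_Im closed_segment_eq_real_ivl)
        show "(W has_field_derivative g v) (at v within closed_segment (Complex a (s * T)) (Complex b (s * T)))"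
          by (rule has_field_derivative_at_within[OF W]) (use v ab in auto)
        have "(Im v)\<^sup>2 = T\<^sup>2" "\<bar>Im v\<bar> \<ge> 1" using v s1 elim by auto
        then show "norm (g v) \<le> C / (1 + T\<^sup>2)" using bound[of v] v by simp
      qed auto
      also have "norm (Complex b (s * T) - Complex a (s * T)) = b - a"
        using ab by (simp add: cmod_def)
      finally show ?case .
    qed
  qed
  have "((\<lambda>T. (W (Complex b T) - W (Complex b (- T))) - (W (Complex b (1 * T)) - W (Complex a (1 * T)))
      + (W (Complex b (- 1 * T)) - W (Complex a (- 1 * T)))) \<longlongrightarrow> \<i> * (LBINT u. g (Complex b u)) - 0 + 0) at_top"
    by (intro tendsto_add tendsto_diff vert join) (use ab int in auto)
  then have "((\<lambda>T. W (Complex a T) - W (Complex a (- T))) \<longlongrightarrow> \<i> * (LBINT u. g (Complex b u))) at_top"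
    by simp
  from tendsto_unique[OF trivial_limit_at_top_linorder this vert[OF ab(1) int(1)]] show ?thesis by simp
qed

lemma integrable_inverse_quadratic: "integrable lborel (\<lambda>u::real. 1 / (1 + u\<^sup>2))"
proof -
  have h: "integrable lborel (\<lambda>x::real. indicator {0..} x *\<^sub>R (1 / (1 + x\<^sup>2)))"
  proof (rule integrableI_bounded)
    have "(\<integral>\<^sup>+x. ennreal (1 / (1 + x\<^sup>2)) * indicator {0..} x \<partial>lborel) = ennreal (pi / 2 - arctan 0)"
      by (rule nn_integral_FTC_atLeast)
         (auto intro!: derivative_eq_intros tendsto_arctan_at_top simp: field_simps add_nonneg_eq_0_iff)
    also have "(\<integral>\<^sup>+x. ennreal (1 / (1 + x\<^sup>2)) * indicator {0..} x \<partial>lborel) =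
       (\<integral>\<^sup>+x. ennreal (norm (indicator {0..} (x::real) *\<^sub>R (1 / (1 + x\<^sup>2)))) \<partial>lborel)"
      by (intro nn_integral_cong) (auto simp: indicator_def add_nonneg_nonneg)
    finally show "(\<integral>\<^sup>+x. ennreal (norm (indicator {0..} (x::real) *\<^sub>R (1 / (1 + x\<^sup>2)))) \<partial>lborel) < \<infinity>" by simp
  qed simp
  let ?g = "\<lambda>x::real. indicator {0..} x *\<^sub>R (1 / (1 + x\<^sup>2))"
  have "integrable lborel (\<lambda>x. ?g (0 + (-1) * x))"
    by (intro lborel_integrable_real_affine h) auto
  then have "integrable lborel (\<lambda>x. ?g x + ?g (0 + (-1) * x))"
    by (intro Bochner_Integration.integrable_add h)
  then show ?thesis
    by (rule Bochner_Integration.integrable_bound) (auto intro!: AE_I2 simp: indicator_def)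
qed

context truncated_product
begin

lemma Ginv_remove_holomorphic:
  assumes "k < n"
  obtains H where "H holomorphic_on {s. Re s > -1}" "\<And>s. s \<noteq> of_nat k \<Longrightarrow> H s = Ginv n s / (s - of_nat k)"
proof
  let ?H = "\<lambda>s. (\<Prod>j=1..M. Gamma (s + of_nat (\<nu> j) + 1)) * rGamma (s + of_nat n + of_nat \<kappa>) * (\<Prod>j\<in>{..<n} - {k}. s - of_nat j)"
  show "?H holomorphic_on {s. Re s > -1}"
    by (intro holomorphic_intros) (auto intro!: Re_pos_not_nonpos_Int)
  fix s :: complex assume "s \<noteq> of_nat k"
  then show "?H s = Ginv n s / (s - of_nat k)"
    using assms by (simp add: Ginv_def prod.remove[of "{..<n}" k])
qed

lemma Ginv_continuous: "continuous_on {s. Re s > -1} (Ginv n)"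
proof -
  have "Ginv n holomorphic_on {s. Re s > -1}"
    unfolding Ginv_def by (intro holomorphic_intros) (auto intro!: Re_pos_not_nonpos_Int)
  then show ?thesis by (rule holomorphic_on_imp_continuous_on)
qed

lemma Ginv_vertical_measurable:
  assumes "\<sigma> > -1"
  shows "(\<lambda>u. Ginv n (Complex \<sigma> u)) \<in> borel_measurable borel"
  by (intro borel_measurable_continuous_onI continuous_on_compose2[OF Ginv_continuous] continuous_on_Complex)
     (use assms in auto)

definition "qline n \<sigma> y u = Ginv n (Complex \<sigma> u) * of_real y powr (- Complex \<sigma> u - 1)" for y u :: real

lemma qline_measurable [measurable]:
  assumes "\<sigma> > -1" "y > 0"
  shows "qline n \<sigma> y \<in> borel_measurable borel"
proof -
  have "continuous_on UNIV (\<lambda>u. of_real y powr (- Complex \<sigma> u - 1))"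
    using assms by (intro continuous_intros continuous_on_Complex) auto
  then show ?thesis unfolding qline_def[abs_def]
    by (intro borel_measurable_times Ginv_vertical_measurable borel_measurable_continuous_onI assms)
qed

lemma integrable_qline_mult:
  assumes n: "n \<ge> 1" and s: "\<sigma> \<ge> -1/2" and y: "y > 0"
    and m: "f \<in> borel_measurable borel" and b: "\<And>u. norm (f u) \<le> B"
  shows "integrable lborel (\<lambda>u. qline n \<sigma> y u * f u)"
proof -
  obtain C where C: "C > 0" "\<And>s. - 1 / 2 \<le> Re s \<Longrightarrow> Re s \<le> \<sigma> \<Longrightarrow> norm (Ginv n s) \<le> C / (1 + (Im s)\<^sup>2)"
    using Ginv_bound[OF n] by blast
  have B0: "B \<ge> 0" using norm_ge_zero b order_trans by blast
  show ?thesis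
  proof (rule Bochner_Integration.integrable_bound)
    show "integrable lborel (\<lambda>u. (C * y powr (- \<sigma> - 1) * B) * (1 / (1 + u\<^sup>2)))"
      by (intro integrable_mult_right integrable_inverse_quadratic)
    show "(\<lambda>u. qline n \<sigma> y u * f u) \<in> borel_measurable lborel"
      using m qline_measurable[of \<sigma> y n] s y by (intro borel_measurable_times) auto
    show "AE u in lborel. norm (qline n \<sigma> y u * f u) \<le> norm ((C * y powr (- \<sigma> - 1) * B) * (1 / (1 + u\<^sup>2)))"
    proof (intro AE_I2)
      fix u :: real
      have "norm (qline n \<sigma> y u * f u) = norm (Ginv n (Complex \<sigma> u)) * y powr (- \<sigma> - 1) * norm (f u)"
        using y by (simp add: qline_def norm_mult norm_powr_real_powr)
      also have "\<dots> \<le> C / (1 + u\<^sup>2) * y powr (- \<sigma> - 1) * B"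
        using C(2)[of "Complex \<sigma> u"] C(1) s b B0
        by (intro mult_mono mult_nonneg_nonneg) (auto simp: add_nonneg_nonneg)
      finally show "norm (qline n \<sigma> y u * f u) \<le> norm ((C * y powr (- \<sigma> - 1) * B) * (1 / (1 + u\<^sup>2)))"
        using C(1) B0 by (simp add: add_nonneg_nonneg mult_ac)
    qed
  qed
qed

lemma qline_shift:
  assumes n: "n \<ge> 1" and k: "k < n" and s: "\<sigma> > real n - 1" and y: "y > 0"
  shows "(LBINT u. qline n (-1/2) y u / (Complex (-1/2) u - of_nat k)) = (LBINT u. qline n \<sigma> y u / (Complex \<sigma> u - of_nat k))"
proof -
  obtain H where H: "H holomorphic_on {s. Re s > -1}" "\<And>s. s \<noteq> of_nat k \<Longrightarrow> H s = Ginv n s / (s - of_nat k)"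
    using Ginv_remove_holomorphic[OF k] by blast
  obtain C where C: "C > 0" "\<And>s. - 1 / 2 \<le> Re s \<Longrightarrow> Re s \<le> \<sigma> \<Longrightarrow> norm (Ginv n s) \<le> C / (1 + (Im s)\<^sup>2)"
    using Ginv_bound[OF n] by blast
  have sk: "\<sigma> > real k" using k s by linarith
  let ?g = "\<lambda>s. H s * of_real y powr (- s - 1)"
  have eq: "?g (Complex c u) = qline n c y u / (Complex c u - of_nat k)" if "c \<noteq> real k" for c u
    using that by (subst H) (auto simp: qline_def complex_eq_iff)
  have int: "integrable lborel (\<lambda>u. ?g (Complex c u))" if c: "c \<noteq> real k" "c \<ge> -1/2" for c
  proof -
    have "integrable lborel (\<lambda>u. qline n c y u * (1 / (Complex c u - of_nat k)))"
    proof (rule integrable_qline_mult[OF n c(2) y])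
      have "Complex c u - of_nat k \<noteq> 0" for u using c by (auto simp: complex_eq_iff)
      then show "(\<lambda>u. 1 / (Complex c u - of_nat k)) \<in> borel_measurable borel"
        by (intro borel_measurable_continuous_onI continuous_intros continuous_on_Complex) auto
      fix u
      have "\<bar>c - real k\<bar> \<le> norm (Complex c u - of_nat k)"
        using abs_Re_le_cmod[of "Complex c u - of_nat k"] by simp
      then show "norm (1 / (Complex c u - of_nat k)) \<le> 1 / \<bar>c - real k\<bar>"
        unfolding norm_divide using c by (intro frac_le) auto
    qed
    then show ?thesis using eq[OF c(1)] by simp
  qed
  \<comment> \<open>The power of y is monotone in Re s, in a direction that depends on whether y
    \<ge> 1. The sum of its two end values bounds it in either case.\<close>
  define m where "m = y powr (- (-1/2) - 1) + y powr (- \<sigma> - 1)"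
  have "(LBINT u. ?g (Complex (-1/2) u)) = (LBINT u. ?g (Complex \<sigma> u))"
  proof (rule vertical_line_shift[where c = "-1" and C = "C * m"])
    show "?g holomorphic_on {s. - 1 < Re s}" using y by (intro holomorphic_intros H(1)) auto
    fix s assume s': "- 1 / 2 \<le> Re s" "Re s \<le> \<sigma>" "1 \<le> \<bar>Im s\<bar>"
    have nk: "norm (s - of_nat k) \<ge> 1" using abs_Im_le_cmod[of "s - of_nat k"] s' by simp
    have "y powr (- Re s - 1) \<le> m"
    proof (cases "y \<ge> 1")
      case True
      then have "y powr (- Re s - 1) \<le> y powr (- (-1/2) - 1)" using s' by (intro powr_mono) auto
      then show ?thesis unfolding m_def by (rule order_trans) simp
    next
      case False
      then have "y powr (- Re s - 1) \<le> y powr (- \<sigma> - 1)" using s' y by (intro powr_mono') auto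
      then show ?thesis unfolding m_def by (rule order_trans) simp
    qed
    moreover have "norm (Ginv n s) / norm (s - of_nat k) \<le> (C / (1 + (Im s)\<^sup>2)) / 1"
      using C(2)[of s] C(1) s' nk by (intro frac_le) (auto simp: add_nonneg_nonneg)
    ultimately have "norm (Ginv n s) / norm (s - of_nat k) * y powr (- Re s - 1) \<le> (C / (1 + (Im s)\<^sup>2)) * m"
      using C(1) by (intro mult_mono) (auto simp: add_nonneg_nonneg)
    moreover have "s \<noteq> of_nat k" using nk by auto
    ultimately show "norm (?g s) \<le> C * m / (1 + (Im s)\<^sup>2)"
      using y by (simp add: H(2) norm_mult norm_divide norm_powr_real_powr)
  qed (use sk s n in \<open>auto intro!: int\<close>)
  then show ?thesis using eq sk by simp
qed

lemma corr_kernel_eq_sum: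
  assumes n: "n \<ge> 1" and s: "\<sigma> > real n - 1" and xy: "x > 0" "y > 0" and g: "admissible_contour n g"
  shows "corr_kernel M \<nu> \<kappa> g n x y =
    1 / (2 * of_real pi) * (\<Sum>k<n. coef n k * of_real x ^ k * (LBINT u. qline n \<sigma> y u / (Complex \<sigma> u - of_nat k)))"
proof -
  have int: "integrable lborel (\<lambda>u. qline n (-1/2) y u / (Complex (-1/2) u - of_nat k))" for k
  proof -
    have "integrable lborel (\<lambda>u. qline n (-1/2) y u * (1 / (Complex (-1/2) u - of_nat k)))"
    proof (rule integrable_qline_mult[OF n _ xy(2)])
      have "Complex (-1/2) u - of_nat k \<noteq> 0" for u by (auto simp: complex_eq_iff)
      then show "(\<lambda>u. 1 / (Complex (-1/2) u - of_nat k)) \<in> borel_measurable borel"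
        by (intro borel_measurable_continuous_onI continuous_intros continuous_on_Complex) auto
      fix u
      have "1 / 2 \<le> norm (Complex (-1/2) u - of_nat k)"
        using abs_Re_le_cmod[of "Complex (-1/2) u - of_nat k"] by simp
      then show "norm (1 / (Complex (-1/2) u - of_nat k)) \<le> 1 / (1/2)"
        unfolding norm_divide by (intro frac_le) auto
    qed simp
    then show ?thesis by simp
  qed
  have "corr_kernel M \<nu> \<kappa> g n x y = 1 / (2 * of_real pi * \<i>)\<^sup>2 * (\<i> * (LBINT u.
      2 * of_real pi * \<i> * (\<Sum>k<n. coef n k * of_real x ^ k * (qline n (-1/2) y u / (Complex (-1/2) u - of_nat k)))))"
    unfolding corr_kernel_def vertical_line_integral_def
    by (subst inner_contour_integral[OF g]) (use xy in \<open>auto simp: qline_def\<close>)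
  also have "(LBINT u. 2 * of_real pi * \<i> * (\<Sum>k<n. coef n k * of_real x ^ k * (qline n (-1/2) y u / (Complex (-1/2) u - of_nat k)))) =
      2 * of_real pi * \<i> * (\<Sum>k<n. coef n k * of_real x ^ k * (LBINT u. qline n (-1/2) y u / (Complex (-1/2) u - of_nat k)))"
  proof -
    have "(LBINT u. (\<Sum>k<n. coef n k * of_real x ^ k * (qline n (-1/2) y u / (Complex (-1/2) u - of_nat k)))) =
      (\<Sum>k<n. LBINT u. coef n k * of_real x ^ k * (qline n (-1/2) y u / (Complex (-1/2) u - of_nat k)))"
      by (rule Bochner_Integration.integral_sum) (intro integrable_mult_right int)
    then show ?thesis by (simp only: integral_mult_right_zero)
  qed
  also have "(\<Sum>k<n. coef n k * of_real x ^ k * (LBINT u. qline n (-1/2) y u / (Complex (-1/2) u - of_nat k))) =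
      (\<Sum>k<n. coef n k * of_real x ^ k * (LBINT u. qline n \<sigma> y u / (Complex \<sigma> u - of_nat k)))"
    by (intro sum.cong refl) (use qline_shift[OF n _ s xy(2)] in simp)
  finally show ?thesis by (simp add: power2_eq_square field_simps)
qed

text \<open>With exponent - s in place of - s - 1, replacing y by y exp (b r) produces exactly exp
  (- b r s); the factor 1 / y stays outside as a constant.\<close>

definition "Qfun n \<sigma> y = 1 / (2 * of_real pi) * (LBINT u. Ginv n (Complex \<sigma> u) * of_real y powr (- Complex \<sigma> u))" for y :: real

text \<open>To the right of n - 1 the real part of s - k is a positive constant along the line. So
  the Laplace integral for 1 / (s - k) converges absolutely, the modulus of the double integrand is
  a product of a function of r and one of u, and Fubini applies.\<close>

lemma qline_quotient_eq:
  assumes n: "n \<ge> 1" and k: "k < n" and s: "\<sigma> > real n - 1" and y: "y > 0" and b: "b > 0"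
  shows "integrable lborel (\<lambda>r. indicator {0..} r *\<^sub>R (exp (of_real (b * r * real k)) * Qfun n \<sigma> (y * exp (b * r))))" (is ?A)
    and "1 / (2 * of_real pi) * (LBINT u. qline n \<sigma> y u / (Complex \<sigma> u - of_nat k)) =
     of_real (b / y) * (LBINT r. indicator {0..} r *\<^sub>R (exp (of_real (b * r * real k)) * Qfun n \<sigma> (y * exp (b * r))))" (is ?B)
proof -
  have sk: "\<sigma> > real k" using k s by linarith
  define f where "f = (\<lambda>u r. indicator {0..} r *\<^sub>R exp (- of_real r * (of_real b * (Complex \<sigma> u - of_nat k))) * qline n \<sigma> y u)"
  have s12: "\<sigma> \<ge> -1/2" "\<sigma> > -1" using s n by auto
  have qint: "integrable lborel (\<lambda>u. qline n \<sigma> y u)"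
    using integrable_qline_mult[OF n s12(1) y, of "\<lambda>_. 1" 1] by simp
  have e: "norm (f u r) = (indicator {0..} r *\<^sub>R exp (- (b * (\<sigma> - real k)) * r)) * norm (qline n \<sigma> y u)" for u r
    by (simp add: f_def norm_mult mult_ac)
  have m: "case_prod f \<in> borel_measurable (lborel \<Otimes>\<^sub>M lborel)"
  proof -
    have C: "Complex \<sigma> u = of_real \<sigma> + \<i> * of_real u" for u by (simp add: complex_eq_iff)
    have [measurable]: "qline n \<sigma> y \<in> borel_measurable borel" using s12 y by (rule_tac qline_measurable) auto
    show ?thesis unfolding f_def C by measurable
  qed
  have F: "integrable (lborel \<Otimes>\<^sub>M lborel) (case_prod f)"
  proof (rule lborel_pair.Fubini_integrable[OF m])
    show "integrable lborel (\<lambda>x. LBINT y. norm (case_prod f (x, y)))"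
      by (simp add: e qint)
    show "AE x in lborel. integrable lborel (\<lambda>y. case_prod f (x, y))"
    proof (intro AE_I2)
      fix u
      have "integrable lborel (\<lambda>r. indicator {0..} r *\<^sub>R exp (- of_real r * (of_real b * (Complex \<sigma> u - of_nat k))) * qline n \<sigma> y u)"
        by (intro integrable_mult_left integral_exp_complex_halfline(1)) (use b sk in auto)
      then show "integrable lborel (\<lambda>y. case_prod f (u, y))" by (simp add: f_def)
    qed
  qed
  have inner1: "(LBINT r. f u r) = of_real (1 / b) * (qline n \<sigma> y u / (Complex \<sigma> u - of_nat k))" for u
  proof -
    have "(LBINT r. f u r) = 1 / (of_real b * (Complex \<sigma> u - of_nat k)) * qline n \<sigma> y u"
      unfolding f_def by (subst integral_mult_left_zero, subst integral_exp_complex_halfline(2)) (use b sk in auto)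
    then show ?thesis by (simp add: field_simps)
  qed
  have inner2: "(LBINT u. f u r) = of_real (2 * pi / y) * (indicator {0..} r *\<^sub>R (exp (of_real (b * r * real k)) * Qfun n \<sigma> (y * exp (b * r))))" for r
  proof -
    have "f u r = of_real (1 / y) * (indicator {0..} r *\<^sub>R exp (of_real (b * r * real k))) * (Ginv n (Complex \<sigma> u) * of_real (y * exp (b * r)) powr (- Complex \<sigma> u))" for u
    proof -
      let ?s = "Complex \<sigma> u"
      have "of_real y powr (- ?s - 1) = of_real y powr (- ?s) / of_real y"
        using y by (simp add: powr_diff)
      moreover have "of_real (y * exp (b * r)) powr (- ?s) = of_real y powr (- ?s) * exp (- ?s * of_real (b * r))"
        using y by (simp add: powr_def ln_mult Ln_of_real exp_add[symmetric] algebra_simps flip: of_real_mult)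
      moreover have "exp (- of_real r * (of_real b * (?s - of_nat k))) = exp (of_real (b * r * real k)) * exp (- ?s * of_real (b * r))"
        by (simp add: mult_exp_exp algebra_simps)
      ultimately show ?thesis by (simp add: f_def qline_def field_simps)
    qed
    then have "(LBINT u. f u r) = of_real (1 / y) * (indicator {0..} r *\<^sub>R exp (of_real (b * r * real k))) * (LBINT u. Ginv n (Complex \<sigma> u) * of_real (y * exp (b * r)) powr (- Complex \<sigma> u))"
      by (simp only: integral_mult_right_zero)
    then show ?thesis by (simp add: Qfun_def field_simps)
  qed
  have "integrable lborel (\<lambda>r. LBINT u. f u r)" by (rule lborel_pair.integrable_snd[OF F])
  then have "integrable lborel (\<lambda>r. of_real (y / (2 * pi)) * (of_real (2 * pi / y) * (indicator {0..} r *\<^sub>R (exp (of_real (b * r * real k)) * Qfun n \<sigma> (y * exp (b * r))))))"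
    unfolding inner2 by (rule integrable_mult_right)
  then show ?A using y by (simp add: field_simps)
  have "(LBINT r. LBINT u. f u r) = (LBINT u. LBINT r. f u r)"
    by (rule lborel_pair.Fubini_integral[OF F])
  then have "of_real (2 * pi / y) * (LBINT r. indicator {0..} r *\<^sub>R (exp (of_real (b * r * real k)) * Qfun n \<sigma> (y * exp (b * r)))) =
     of_real (1 / b) * (LBINT u. qline n \<sigma> y u / (Complex \<sigma> u - of_nat k))"
    unfolding inner1 inner2 by (simp only: integral_mult_right_zero)
  then show ?B using b y by (simp add: field_simps)
qed

lemma corr_kernel_eq_overlap:
  assumes n: "n \<ge> 1" and s: "\<sigma> > real n - 1" and xy: "x > 0" "y > 0" and g: "admissible_contour n g" and b: "b > 0"
  shows "corr_kernel M \<nu> \<kappa> g n x y =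
    of_real (b / y) * (LBINT r. indicator {0..} r *\<^sub>R (Ppoly n (x * exp (b * r)) * Qfun n \<sigma> (y * exp (b * r))))"
proof -
  let ?I = "\<lambda>k r. indicator {0..} r *\<^sub>R (exp (of_real (b * r * real k)) * Qfun n \<sigma> (y * exp (b * r)))"
  have "corr_kernel M \<nu> \<kappa> g n x y = (\<Sum>k<n. coef n k * of_real x ^ k * (1 / (2 * of_real pi) * (LBINT u. qline n \<sigma> y u / (Complex \<sigma> u - of_nat k))))"
    unfolding corr_kernel_eq_sum[OF n s xy g] by (simp add: sum_distrib_left mult_ac)
  also have "\<dots> = (\<Sum>k<n. coef n k * of_real x ^ k * (of_real (b / y) * (LBINT r. ?I k r)))"
    by (intro sum.cong refl) (use qline_quotient_eq(2)[OF n _ s xy(2) b] in simp)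
  also have "\<dots> = of_real (b / y) * (\<Sum>k<n. LBINT r. coef n k * of_real x ^ k * ?I k r)"
    by (simp only: integral_mult_right_zero sum_distrib_left mult_ac)
  also have "(\<Sum>k<n. LBINT r. coef n k * of_real x ^ k * ?I k r) = (LBINT r. (\<Sum>k<n. coef n k * of_real x ^ k * ?I k r))"
    by (intro Bochner_Integration.integral_sum[symmetric] integrable_mult_right qline_quotient_eq(1)) (use n s xy b in auto)
  also have "(\<lambda>r. \<Sum>k<n. coef n k * of_real x ^ k * ?I k r) =
      (\<lambda>r. indicator {0..} r *\<^sub>R (Ppoly n (x * exp (b * r)) * Qfun n \<sigma> (y * exp (b * r))))"
  proof
    fix r
    have "exp (complex_of_real (b * r * real k)) = of_real (exp (b * r)) ^ k" for k
      by (simp add: exp_of_real[symmetric] exp_of_nat_mult[symmetric] mult_ac)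
    then show "(\<Sum>k<n. coef n k * of_real x ^ k * ?I k r) = indicator {0..} r *\<^sub>R (Ppoly n (x * exp (b * r)) * Qfun n \<sigma> (y * exp (b * r)))"
      by (cases "r \<ge> 0") (simp_all add: Ppoly_def sum_distrib_left sum_distrib_right power_mult_distrib mult_ac)
  qed
  finally show ?thesis .
qed

end

section \<open>The phase function\<close>

definition zs :: "nat \<Rightarrow> real" where "zs M = sqrt ((real M + 1) / (real M - 1))"

text \<open>\<open>fp\<close> is the limit of the \<open>t\<close>-derivative \<open>dLF n t\<close> of the phase at \<open>t = n z\<close> for \<open>x = n\<^sup>M\<^sup>-\<^sup>1 x_star\<close>;
  \<open>zs\<close> is the common zero of \<open>fp\<close> and its derivative \<open>fpp\<close>.\<close>

definition fp :: "nat \<Rightarrow> complex \<Rightarrow> complex" where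
  "fp M z = Ln (z - 1) + Ln (z + 1) - (of_nat M + 1) * Ln z + of_real (ln (x_star M))"

definition fpp :: "nat \<Rightarrow> complex \<Rightarrow> complex" where
  "fpp M z = 1 / (z - 1) + 1 / (z + 1) - (of_nat M + 1) / z"

lemma zs_squared: "M \<ge> 2 \<Longrightarrow> (zs M)\<^sup>2 = (real M + 1) / (real M - 1)"
  by (simp add: zs_def)

lemma zs_gt_1: "M \<ge> 2 \<Longrightarrow> zs M > 1"
  by (simp add: zs_def)

lemma zs_squared_minus_1: "M \<ge> 2 \<Longrightarrow> (zs M)\<^sup>2 - 1 = 2 / (real M - 1)"
  by (simp add: zs_squared field_simps)

lemma x_star_pos: "M \<ge> 2 \<Longrightarrow> x_star M > 0"
  by (simp add: x_star_def)

text \<open>This is the condition that \<open>fp\<close> vanishes at \<open>zs\<close>. The zero of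
  \<open>fpp\<close> does not involve x, and \<open>x_star\<close> is the value of x for which it
  becomes a zero of \<open>fp\<close> too.\<close>

lemma ln_x_star:
  assumes "M \<ge> 2"
  shows "ln (x_star M) = (real M + 1) * ln (zs M) - ln ((zs M)\<^sup>2 - 1)"
proof -
  have p: "real M - 1 > 0" "real M + 1 > 0" using assms by auto
  have 1: "ln (x_star M) = (real M + 1) / 2 * ln (real M + 1) - (ln 2 + (real M - 1) / 2 * ln (real M - 1))"
    using p by (simp add: x_star_def ln_div ln_mult ln_powr)
  have 2: "ln (zs M) = (ln (real M + 1) - ln (real M - 1)) / 2"
    using p by (simp add: zs_def ln_sqrt ln_div)
  have 3: "ln ((zs M)\<^sup>2 - 1) = ln 2 - ln (real M - 1)"
    using p assms by (simp add: zs_squared_minus_1 ln_div)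
  show ?thesis unfolding 1 2 3 by (simp add: field_simps)
qed

lemma fp_zs:
  assumes "M \<ge> 2"
  shows "fp M (of_real (zs M)) = 0"
proof -
  have z: "zs M > 1" using zs_gt_1[OF assms] .
  have a: "Ln (of_real (zs M) - 1) = of_real (ln (zs M - 1))"
    using z Ln_of_real[of "zs M - 1"] by simp
  have b: "Ln (of_real (zs M) + 1) = of_real (ln (zs M + 1))"
    using z Ln_of_real[of "zs M + 1"] by simp
  have c: "Ln (of_real (zs M)) = of_real (ln (zs M))" using z by (intro Ln_of_real) auto
  have "ln ((zs M)\<^sup>2 - 1) = ln ((zs M - 1) * (zs M + 1))"
    by (simp add: power2_eq_square algebra_simps)
  also have "\<dots> = ln (zs M - 1) + ln (zs M + 1)" using z by (intro ln_mult_pos) auto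
  finally have "ln (zs M - 1) + ln (zs M + 1) - (real M + 1) * ln (zs M) + ln (x_star M) = 0"
    by (simp add: ln_x_star[OF assms])
  then have "complex_of_real (ln (zs M - 1) + ln (zs M + 1) - (real M + 1) * ln (zs M) + ln (x_star M)) = 0"
    by simp
  then show ?thesis unfolding fp_def a b c by (simp only: of_real_add of_real_diff of_real_mult of_real_of_nat_eq of_real_1)
qed

lemma fp_has_field_derivative:
  assumes "z - 1 \<notin> \<real>\<^sub>\<le>\<^sub>0"
  shows "(fp M has_field_derivative fpp M z) (at z)"
proof -
  have "z + 1 \<notin> \<real>\<^sub>\<le>\<^sub>0" "z \<notin> \<real>\<^sub>\<le>\<^sub>0" using assms by (auto simp: complex_nonpos_Reals_iff)
  with assms show ?thesis unfolding fp_def fpp_def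
    by (auto intro!: derivative_eq_intros simp: divide_inverse)
qed

lemma fpp_factor:
  assumes "M \<ge> 2" "z \<noteq> 0" "z \<noteq> 1" "z \<noteq> -1"
  shows "fpp M z = - (of_nat M - 1) * (z - of_real (zs M)) * ((z + of_real (zs M)) / (z * (z\<^sup>2 - 1)))"
proof -
  have sq: "complex_of_real (zs M) ^ 2 = (of_nat M + 1) / (of_nat M - 1)"
    using arg_cong[OF zs_squared[OF assms(1)], of complex_of_real] by simp
  have M1: "(of_nat M - 1 :: complex) \<noteq> 0" using assms(1) by (auto simp: complex_eq_iff)
  have n: "z\<^sup>2 - 1 \<noteq> 0" "z - 1 \<noteq> 0" "z + 1 \<noteq> 0"
    using assms by (auto simp: power2_eq_1_iff eq_neg_iff_add_eq_0)
  have "z\<^sup>2 - 1 = (z - 1) * (z + 1)" by (simp add: power2_eq_square algebra_simps)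
  have "fpp M z = (2 * z\<^sup>2 - (of_nat M + 1) * (z\<^sup>2 - 1)) / (z * (z\<^sup>2 - 1))"
    unfolding fpp_def \<open>z\<^sup>2 - 1 = (z - 1) * (z + 1)\<close> using n assms
    by (simp add: divide_simps) (simp add: algebra_simps power2_eq_square)
  also have "2 * z\<^sup>2 - (of_nat M + 1) * (z\<^sup>2 - 1) = - (of_nat M - 1) * (z\<^sup>2 - complex_of_real (zs M) ^ 2)"
    unfolding sq using M1 by (simp add: field_simps)
  also have "z\<^sup>2 - complex_of_real (zs M) ^ 2 = (z - of_real (zs M)) * (z + of_real (zs M))"
    by (simp add: power2_eq_square algebra_simps)
  finally show ?thesis by simp
qed

text \<open>Since zs^2 - 1 = 2 / (M - 1), the simple zero of \<open>fpp\<close> at \<open>zs\<close>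
  has derivative - (M - 1)^2. Integration from the zero of \<open>fp\<close> yields the quadratic
  term.\<close>

lemma fp_taylor:
  assumes M: "M \<ge> 2" and e: "\<epsilon> > 0"
  obtains d where "d > 0"
    "\<And>w. norm w < d \<Longrightarrow> norm (fp M (of_real (zs M) + w) + (of_nat M - 1)\<^sup>2 / 2 * w\<^sup>2) \<le> \<epsilon> * (norm w)\<^sup>2"
proof -
  let ?z = "complex_of_real (zs M)"
  \<comment> \<open>w times q w is the error in the linear approximation of \<open>fpp\<close>, so
    the claim reduces to q being continuous with q 0 = 0.\<close>
  define q where "q = (\<lambda>w. - (of_nat M - 1) * ((?z + w + ?z) / ((?z + w) * ((?z + w)\<^sup>2 - 1))) + (of_nat M - 1)\<^sup>2)"
  have z: "zs M > 1" using zs_gt_1[OF M] .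
  have sq: "?z\<^sup>2 - 1 = 2 / (of_nat M - 1)"
    using arg_cong[OF zs_squared_minus_1[OF M], of complex_of_real] by simp
  have M1: "(of_nat M - 1 :: complex) \<noteq> 0" using M by (auto simp: complex_eq_iff)
  have "isCont q 0"
    unfolding q_def using z M1 sq by (intro continuous_intros) (auto simp: add_0_right)
  moreover have "q 0 = 0"
  proof -
    have "(?z + ?z) / (?z * (2 / (of_nat M - 1))) = of_nat M - 1"
      using z M1 by (simp add: field_simps)
    moreover have "q 0 = - (of_nat M - 1) * ((?z + ?z) / (?z * (?z\<^sup>2 - 1))) + (of_nat M - 1)\<^sup>2" by (simp add: q_def)
    ultimately have "q 0 = - (of_nat M - 1) * (of_nat M - 1) + (of_nat M - 1)\<^sup>2" unfolding sq by (simp only:)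
    then show ?thesis by (simp only: power2_eq_square mult_minus_left) simp
  qed
  ultimately obtain d1 where d1: "d1 > 0" "\<And>w. norm w < d1 \<Longrightarrow> norm (q w) < \<epsilon>"
    using e unfolding continuous_at_eps_delta by (metis diff_zero dist_norm)
  define d where "d = min d1 (zs M - 1)"
  have "d > 0" using d1 z by (simp add: d_def)
  moreover have "norm (fp M (?z + w) + (of_nat M - 1)\<^sup>2 / 2 * w\<^sup>2) \<le> \<epsilon> * (norm w)\<^sup>2" if w: "norm w < d" for w
  proof -
    let ?g = "\<lambda>w. fp M (?z + w) + (of_nat M - 1)\<^sup>2 / 2 * w\<^sup>2"
    have "norm (?g w - ?g 0) \<le> (\<epsilon> * norm w) * norm (w - 0)"
    proof (rule field_differentiable_bound[where S = "closed_segment 0 w" and f' = "\<lambda>v. fpp M (?z + v) + (of_nat M - 1)\<^sup>2 * v"])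
      fix v assume v: "v \<in> closed_segment 0 w"
      have nv: "norm v \<le> norm w" using segment_bound1[OF v] by simp
      have "norm w < zs M - 1" using w by (simp add: d_def)
      then have "zs M + Re v > 1" using abs_Re_le_cmod[of v] nv by linarith
      then have re: "Re (?z + v) > 1" by simp
      then have nn: "?z + v - 1 \<notin> \<real>\<^sub>\<le>\<^sub>0" by (auto simp: complex_nonpos_Reals_iff)
      have "((\<lambda>w. fp M (?z + w)) has_field_derivative fpp M (?z + v) * 1) (at v)"
        by (rule DERIV_chain2[where f = "fp M" and g = "\<lambda>w. ?z + w"]) (use nn in \<open>auto intro!: derivative_eq_intros fp_has_field_derivative\<close>)
      moreover have "((\<lambda>w. k / 2 * w\<^sup>2) has_field_derivative k * v) (at v)" for k :: complex
        by (auto intro!: derivative_eq_intros)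
      ultimately have "(?g has_field_derivative fpp M (?z + v) * 1 + (of_nat M - 1)\<^sup>2 * v) (at v)"
        by (intro DERIV_add)
      then show "(?g has_field_derivative fpp M (?z + v) + (of_nat M - 1)\<^sup>2 * v) (at v within closed_segment 0 w)"
        by (simp only: mult_1_right has_field_derivative_at_within)
      have "?z + v \<noteq> 0" "?z + v \<noteq> 1" "?z + v \<noteq> -1" using re by (auto simp: complex_eq_iff)
      then have "fpp M (?z + v) + (of_nat M - 1)\<^sup>2 * v = v * q v"
      proof -
        assume *: "?z + v \<noteq> 0" "?z + v \<noteq> 1" "?z + v \<noteq> -1"
        have "fpp M (?z + v) = v * (- (of_nat M - 1) * ((?z + v + ?z) / ((?z + v) * ((?z + v)\<^sup>2 - 1))))"
          unfolding fpp_factor[OF M *] by (simp only: add_diff_cancel_left' mult_ac)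
        then show ?thesis unfolding q_def by (simp only: distrib_left mult.commute)
      qed
      moreover have "norm (v * q v) \<le> norm w * \<epsilon>"
        unfolding norm_mult[of v] using d1(2)[of v] nv w by (intro mult_mono) (auto simp: d_def)
      ultimately show "norm (fpp M (?z + v) + (of_nat M - 1)\<^sup>2 * v) \<le> \<epsilon> * norm w"
        by (simp only: mult.commute)
    qed auto
    then show ?thesis using fp_zs[OF M] by (simp add: power2_eq_square mult_ac)
  qed
  ultimately show ?thesis using that by blast
qed

text \<open>The direction \<open>\<i> - 1\<close> of the first contour segment. Its endpoint \<open>u = 2 / (M + 1)\<close> is where
  \<open>c\<^sup>2 - 1 - 4 u\<^sup>2 = 2 / (M - 1) - 4 u\<^sup>2\<close> can still be guaranteed to be nonnegative.\<close>

lemma segment_polynomial: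
  fixes a u c :: real
  assumes "c = a + u" and "4 * u\<^sup>2 \<le> c\<^sup>2 - 1" and "a > 0" "u \<ge> 0" "c > 1"
  shows "a * (a ^ 3 - 3 * a * u\<^sup>2 - a) + c * (3 * a\<^sup>2 * u - u ^ 3 - u) > 0"
proof -
  have "a * (a ^ 3 - 3 * a * u\<^sup>2 - a) + c * (3 * a\<^sup>2 * u - u ^ 3 - u)
      = (a\<^sup>2 + a * u + u\<^sup>2) * (c\<^sup>2 - 1 - 4 * u\<^sup>2) + 2 * u ^ 4"
    unfolding assms(1) by (simp add: power2_eq_square power3_eq_cube power4_eq_xxxx algebra_simps)
  also have "\<dots> > 0"
  proof (cases "u = 0")
    case True
    then show ?thesis using assms by (simp add: zero_less_mult_iff)
  next
    case False
    then have "0 < 2 * u ^ 4" using assms by simp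
    moreover have "0 \<le> (a\<^sup>2 + a * u + u\<^sup>2) * (c\<^sup>2 - 1 - 4 * u\<^sup>2)"
      using assms by (intro mult_nonneg_nonneg add_nonneg_nonneg) auto
    ultimately show ?thesis by linarith
  qed
  finally show ?thesis .
qed

text \<open>The first inequality reduces to (M - 3)^2 \<ge> 0; at M = 3 the endpoint 2 / (M + 1)
  attains equality.\<close>

lemma zs_bounds:
  assumes M: "M \<ge> 2" and u: "0 \<le> u" "u \<le> 2 / (real M + 1)"
  shows "4 * u\<^sup>2 \<le> (zs M)\<^sup>2 - 1" "zs M - u > 0"
proof -
  have "u\<^sup>2 \<le> (2 / (real M + 1))\<^sup>2" using u by (intro power_mono) auto
  also have "4 * (2 / (real M + 1))\<^sup>2 \<le> 2 / (real M - 1)"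
  proof -
    have "0 \<le> (real M - 3)\<^sup>2" by simp
    then have "8 * (real M - 1) \<le> (real M + 1)\<^sup>2" by (simp add: power2_eq_square algebra_simps)
    then show ?thesis using M by (simp add: field_simps power2_eq_square)
  qed
  finally show "4 * u\<^sup>2 \<le> (zs M)\<^sup>2 - 1" using zs_squared_minus_1[OF M] by simp
  have "2 / (real M + 1) \<le> 1" using M by simp
  then show "zs M - u > 0" using zs_gt_1[OF M] u by linarith
qed

text \<open>By \<open>fpp_factor\<close> and (\<i> - 1)^3 = 2 (1 + \<i>), a negative multiple of
  this real part is the derivative of Re ((\<i> - 1) fp) along the segment. Multiplying by the
  conjugate of the denominator leaves the polynomial of \<open>segment_polynomial\<close>.\<close>

lemma segment_derivative_sign:
  assumes M: "M \<ge> 2" and u: "0 \<le> u" "u \<le> 2 / (real M + 1)"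
  defines "\<zeta> \<equiv> of_real (zs M) + of_real u * (\<i> - 1)"
  shows "Re ((1 + \<i>) * ((\<zeta> + of_real (zs M)) / (\<zeta> * (\<zeta>\<^sup>2 - 1)))) > 0"
    and "\<zeta> \<noteq> 0" "\<zeta> \<noteq> 1" "\<zeta> \<noteq> -1" "\<zeta> - 1 \<notin> \<real>\<^sub>\<le>\<^sub>0"
proof -
  define a where "a = zs M - u"
  have z: "zs M > 1" using zs_gt_1[OF M] .
  have zeta: "\<zeta> = Complex a u" by (simp add: \<zeta>_def a_def complex_eq_iff)
  have a: "a > 0" using zs_bounds[OF M u] by (simp add: a_def)
  show n: "\<zeta> \<noteq> 0" "\<zeta> \<noteq> 1" "\<zeta> \<noteq> -1" "\<zeta> - 1 \<notin> \<real>\<^sub>\<le>\<^sub>0"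
    using a z by (auto simp: zeta complex_eq_iff a_def complex_nonpos_Reals_iff)
  let ?p = "(1 + \<i>) * (\<zeta> + of_real (zs M))" and ?w = "\<zeta> * (\<zeta>\<^sup>2 - 1)"
  have p: "?p = Complex (2 * a) (2 * zs M)" by (simp add: zeta complex_eq_iff a_def)
  have w: "?w = Complex (a ^ 3 - 3 * a * u\<^sup>2 - a) (3 * a\<^sup>2 * u - u ^ 3 - u)"
    by (simp add: zeta complex_eq_iff power2_eq_square power3_eq_cube algebra_simps)
  have w0: "?w \<noteq> 0" using n by (auto simp: power2_eq_1_iff)
  have "(1 + \<i>) * ((\<zeta> + of_real (zs M)) / (\<zeta> * (\<zeta>\<^sup>2 - 1))) = ?p / ?w" by simp
  also have "Re \<dots> = Re (?p * cnj ?w) / (norm ?w)\<^sup>2"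
    by (subst complex_div_cnj) (simp add: Re_divide_of_real)
  also have "Re (?p * cnj ?w) = 2 * (a * (a ^ 3 - 3 * a * u\<^sup>2 - a) + zs M * (3 * a\<^sup>2 * u - u ^ 3 - u))"
    unfolding p w by (simp add: algebra_simps)
  finally show "Re ((1 + \<i>) * ((\<zeta> + of_real (zs M)) / (\<zeta> * (\<zeta>\<^sup>2 - 1)))) > 0"
    using segment_polynomial[of "zs M" a u] zs_bounds[OF M u] a z u w0 by (simp add: a_def)
qed

lemma nonneg_derivative_imp_le:
  fixes f g f' g' :: "real \<Rightarrow> real"
  assumes "0 \<le> b" "\<And>x. 0 \<le> x \<Longrightarrow> x \<le> b \<Longrightarrow> (f has_real_derivative f' x) (at x)"
    "\<And>x. 0 \<le> x \<Longrightarrow> x \<le> b \<Longrightarrow> (g has_real_derivative g' x) (at x)"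
    "\<And>x. 0 \<le> x \<Longrightarrow> x \<le> b \<Longrightarrow> f' x \<le> g' x" "f 0 \<le> g 0"
  shows "f b \<le> g b"
proof -
  have "g 0 - f 0 \<le> g b - f b"
    by (rule DERIV_nonneg_imp_nondecreasing[OF assms(1)])
       (use assms in \<open>auto intro!: exI[of _ "g' _ - f' _"] derivative_eq_intros\<close>)
  then show ?thesis using assms(5) by linarith
qed

lemma has_real_derivative_Re_line:
  fixes f :: "complex \<Rightarrow> complex"
  assumes "(f has_field_derivative D) (at (a + of_real r * d))"
  shows "((\<lambda>r. Re (k * f (a + of_real r * d))) has_real_derivative Re (k * (D * d))) (at r)"
proof -
  have "((\<lambda>r. f (a + r * d)) has_field_derivative D * d) (at (of_real r))"
    by (rule DERIV_chain2[where f = f and g = "\<lambda>r. a + r * d"]) (use assms in \<open>auto intro!: derivative_eq_intros\<close>)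
  then have "((\<lambda>r. k * f (a + r * d)) has_field_derivative k * (D * d)) (at (of_real r))"
    by (rule DERIV_cmult)
  from has_vector_derivative_real_field[OF this]
  have "((\<lambda>r. k * f (a + of_real r * d)) has_vector_derivative k * (D * d)) (at r)" .
  then show ?thesis
    by (simp add: has_vector_derivative_complex_iff has_real_derivative_iff_has_vector_derivative)
qed

text \<open>The positive real part of \<open>segment_derivative_sign\<close> has a positive minimum
  K by compactness. Hence the derivative in u is at most - 2 c u, and integration starts from the
  zero of \<open>fp\<close>.\<close>

lemma fp_segment:
  assumes M: "M \<ge> 2"
  obtains c where "c > 0"
    "\<And>u. 0 \<le> u \<Longrightarrow> u \<le> 2 / (real M + 1) \<Longrightarrow> Re ((\<i> - 1) * fp M (of_real (zs M) + of_real u * (\<i> - 1))) \<le> - c * u\<^sup>2"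
proof -
  let ?\<zeta> = "\<lambda>u. of_real (zs M) + of_real u * (\<i> - 1) :: complex"
  let ?h = "\<lambda>u. Re ((1 + \<i>) * ((?\<zeta> u + of_real (zs M)) / (?\<zeta> u * ((?\<zeta> u)\<^sup>2 - 1))))"
  let ?b = "2 / (real M + 1)"
  have "continuous_on {0..?b} ?h"
    using segment_derivative_sign[OF M] by (intro continuous_intros) (auto simp: power2_eq_1_iff)
  then obtain u0 where u0: "u0 \<in> {0..?b}" "\<And>u. u \<in> {0..?b} \<Longrightarrow> ?h u0 \<le> ?h u"
    using continuous_attains_inf[of "{0..?b}" ?h] by auto
  define K where "K = ?h u0"
  define c where "c = (real M - 1) * K"
  have "K > 0" unfolding K_def using u0(1) by (intro segment_derivative_sign(1)[OF M]) auto
  then have "c > 0" using M by (simp add: c_def)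
  moreover have "Re ((\<i> - 1) * fp M (?\<zeta> u)) \<le> - c * u\<^sup>2" if u: "0 \<le> u" "u \<le> ?b" for u
  proof (rule nonneg_derivative_imp_le[OF u(1), where f' = "\<lambda>x. Re ((\<i> - 1) * (fpp M (?\<zeta> x) * (\<i> - 1)))" and g' = "\<lambda>x. - c * (2 * x)"])
    fix x assume x: "0 \<le> x" "x \<le> u"
    then have x2: "x \<le> ?b" using u by linarith
    note sgn = segment_derivative_sign[OF M x(1) x2]
    show "((\<lambda>x. Re ((\<i> - 1) * fp M (?\<zeta> x))) has_real_derivative Re ((\<i> - 1) * (fpp M (?\<zeta> x) * (\<i> - 1)))) (at x)"
      by (intro has_real_derivative_Re_line fp_has_field_derivative sgn)
    show "((\<lambda>x. - c * x\<^sup>2) has_real_derivative - c * (2 * x)) (at x)"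
      by (auto intro!: derivative_eq_intros)
    have d3: "(\<i> - 1) * ((\<i> - 1) * (\<i> - 1)) = 2 * (1 + \<i>)"
      by (simp add: complex_eq_iff)
    have "(\<i> - 1) * (fpp M (?\<zeta> x) * (\<i> - 1)) = - of_real ((real M - 1) * x) * ((\<i> - 1) * ((\<i> - 1) * (\<i> - 1))) * ((?\<zeta> x + of_real (zs M)) / (?\<zeta> x * ((?\<zeta> x)\<^sup>2 - 1)))"
      by (subst fpp_factor[OF M sgn(2-4)]) (simp add: algebra_simps)
    also have "\<dots> = of_real (- (real M - 1) * x * 2) * ((1 + \<i>) * ((?\<zeta> x + of_real (zs M)) / (?\<zeta> x * ((?\<zeta> x)\<^sup>2 - 1))))"
      unfolding d3 by (simp add: algebra_simps)
    also have "Re \<dots> = - (real M - 1) * x * 2 * ?h x"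
    proof -
      have "Re (of_real p * w) = p * Re w" for p w by simp
      then show ?thesis by blast
    qed
    also have "\<dots> \<le> - (real M - 1) * x * 2 * K"
    proof -
      have "K \<le> ?h x" unfolding K_def using u0(2)[of x] x x2 by auto
      then have "(real M - 1) * x * 2 * K \<le> (real M - 1) * x * 2 * ?h x"
        using x M by (intro mult_left_mono) auto
      then show ?thesis by (simp only: mult_minus_left neg_le_iff_le)
    qed
    also have "- (real M - 1) * x * 2 * K = - c * (2 * x)"
      unfolding c_def by (simp add: algebra_simps)
    finally show "Re ((\<i> - 1) * (fpp M (?\<zeta> x) * (\<i> - 1))) \<le> - c * (2 * x)" .
  qed (simp add: fp_zs[OF M])
  ultimately show ?thesis using that by blast
qed

text \<open>Here A is |z + \<i> \<tau>|^2 - 1. The fractions are brought to this form because every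
  term of the numerator then has a definite sign for z \<ge> zs.\<close>

lemma Re_fpp_vertical:
  assumes M: "M \<ge> 2" and z: "z \<ge> zs M"
  defines "A \<equiv> \<lambda>\<tau>. z\<^sup>2 - 1 + \<tau>\<^sup>2"
  shows "Re (fpp M (Complex z \<tau>)) = - z * ((real M - 1) * A \<tau> * (z\<^sup>2 - (zs M)\<^sup>2 + \<tau>\<^sup>2) + 4 * (real M + 1) * \<tau>\<^sup>2) /
     ((A \<tau> + 1) * ((A \<tau>)\<^sup>2 + 4 * \<tau>\<^sup>2))"
proof -
  have z1: "z > 1" using zs_gt_1[OF M] z by linarith
  have p: "(z - 1)\<^sup>2 + \<tau>\<^sup>2 > 0" "(z + 1)\<^sup>2 + \<tau>\<^sup>2 > 0" "z\<^sup>2 + \<tau>\<^sup>2 > 0" using z1 by (auto intro!: add_pos_nonneg)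
  have A: "A \<tau> > 0" using one_less_power[OF z1, of 2] zero_le_power2[of \<tau>] unfolding A_def by linarith
  have 1: "Re (1 / (Complex z \<tau> - 1)) = (z - 1) / ((z - 1)\<^sup>2 + \<tau>\<^sup>2)"
    by (simp add: Re_divide)
  have 2: "Re (1 / (Complex z \<tau> + 1)) = (z + 1) / ((z + 1)\<^sup>2 + \<tau>\<^sup>2)"
    by (simp add: Re_divide)
  have 3: "Re ((of_nat M + 1) / Complex z \<tau>) = (real M + 1) * z / (z\<^sup>2 + \<tau>\<^sup>2)"
    by (simp add: Re_divide)
  have B: "((z - 1)\<^sup>2 + \<tau>\<^sup>2) * ((z + 1)\<^sup>2 + \<tau>\<^sup>2) = (A \<tau>)\<^sup>2 + 4 * \<tau>\<^sup>2"
    by (simp add: A_def power2_eq_square algebra_simps)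
  have "(z - 1) / ((z - 1)\<^sup>2 + \<tau>\<^sup>2) + (z + 1) / ((z + 1)\<^sup>2 + \<tau>\<^sup>2) =
      ((z - 1) * ((z + 1)\<^sup>2 + \<tau>\<^sup>2) + (z + 1) * ((z - 1)\<^sup>2 + \<tau>\<^sup>2)) / (((z - 1)\<^sup>2 + \<tau>\<^sup>2) * ((z + 1)\<^sup>2 + \<tau>\<^sup>2))"
    by (rule add_frac_eq) (use p in auto)
  also have "(z - 1) * ((z + 1)\<^sup>2 + \<tau>\<^sup>2) + (z + 1) * ((z - 1)\<^sup>2 + \<tau>\<^sup>2) = 2 * z * A \<tau>"
    by (simp add: A_def power2_eq_square algebra_simps)
  finally have 4: "Re (fpp M (Complex z \<tau>)) = 2 * z * A \<tau> / ((A \<tau>)\<^sup>2 + 4 * \<tau>\<^sup>2) - (real M + 1) * z / (A \<tau> + 1)"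
    unfolding fpp_def plus_complex.simps minus_complex.simps 1 2 3 B by (simp add: A_def)
  have q: "(A \<tau>)\<^sup>2 + 4 * \<tau>\<^sup>2 > 0" "A \<tau> + 1 > 0" using A by (auto intro!: add_pos_nonneg)
  have eq: "(real M - 1) * A \<tau> * (z\<^sup>2 - (zs M)\<^sup>2 + \<tau>\<^sup>2) = (real M - 1) * (A \<tau>)\<^sup>2 - 2 * A \<tau>"
  proof -
    have "z\<^sup>2 - (zs M)\<^sup>2 + \<tau>\<^sup>2 = A \<tau> - 2 / (real M - 1)"
      using zs_squared_minus_1[OF M] by (simp add: A_def)
    then show ?thesis using M by (simp add: right_diff_distrib power2_eq_square)
  qed
  have "2 * z * A \<tau> / ((A \<tau>)\<^sup>2 + 4 * \<tau>\<^sup>2) - (real M + 1) * z / (A \<tau> + 1) =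
      (2 * z * A \<tau> * (A \<tau> + 1) - (real M + 1) * z * ((A \<tau>)\<^sup>2 + 4 * \<tau>\<^sup>2)) / (((A \<tau>)\<^sup>2 + 4 * \<tau>\<^sup>2) * (A \<tau> + 1))"
    by (rule diff_frac_eq) (use q in auto)
  also have "2 * z * A \<tau> * (A \<tau> + 1) - (real M + 1) * z * ((A \<tau>)\<^sup>2 + 4 * \<tau>\<^sup>2) =
      - z * ((real M - 1) * (A \<tau>)\<^sup>2 - 2 * A \<tau> + 4 * (real M + 1) * \<tau>\<^sup>2)"
    by (simp add: algebra_simps power2_eq_square)
  finally show ?thesis unfolding 4 eq by (simp only: mult.commute)
qed

lemma Re_fpp_vertical_nonpos:
  assumes M: "M \<ge> 2" and z: "z \<ge> zs M"
  shows "Re (fpp M (Complex z \<tau>)) \<le> 0"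
proof -
  have z1: "z > 1" using zs_gt_1[OF M] z by linarith
  have A: "z\<^sup>2 - 1 + \<tau>\<^sup>2 > 0" using one_less_power[OF z1, of 2] zero_le_power2[of \<tau>] by linarith
  have "(zs M)\<^sup>2 \<le> z\<^sup>2" using z zs_gt_1[OF M] by (intro power_mono) auto
  then have "0 \<le> (real M - 1) * (z\<^sup>2 - 1 + \<tau>\<^sup>2) * (z\<^sup>2 - (zs M)\<^sup>2 + \<tau>\<^sup>2) + 4 * (real M + 1) * \<tau>\<^sup>2"
    using A M one_less_power[OF z1, of 2] by (intro add_nonneg_nonneg mult_nonneg_nonneg) auto
  moreover have "0 \<le> (z\<^sup>2 - 1 + \<tau>\<^sup>2 + 1) * ((z\<^sup>2 - 1 + \<tau>\<^sup>2)\<^sup>2 + 4 * \<tau>\<^sup>2)"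
    using A one_less_power[OF z1, of 2] by (intro mult_nonneg_nonneg add_nonneg_nonneg) auto
  ultimately show ?thesis unfolding Re_fpp_vertical[OF assms]
    using z1 by (intro divide_nonpos_nonneg mult_nonpos_nonneg) auto
qed

text \<open>The estimate degenerates at the saddle point, so it must record the distance from it:
  linearly in z - zs and quadratically in \<tau>. On the box the denominator is bounded by
  K.\<close>

lemma Re_fpp_vertical_le:
  assumes M: "M \<ge> 2"
  obtains c where "c > 0"
    "\<And>z \<tau>. zs M \<le> z \<Longrightarrow> z \<le> zs M + 1 \<Longrightarrow> \<bar>\<tau>\<bar> \<le> 1 \<Longrightarrow> Re (fpp M (Complex z \<tau>)) \<le> - c * ((z - zs M) + \<tau>\<^sup>2)"
proof -
  define K where "K = ((zs M + 1)\<^sup>2 + 1) * (((zs M + 1)\<^sup>2)\<^sup>2 + 4)"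
  have K: "K > 0" by (auto simp: K_def intro!: mult_pos_pos add_nonneg_pos)
  have "2 / K > 0" using K by simp
  moreover have "Re (fpp M (Complex z \<tau>)) \<le> - (2 / K) * ((z - zs M) + \<tau>\<^sup>2)"
    if z: "zs M \<le> z" "z \<le> zs M + 1" and t: "\<bar>\<tau>\<bar> \<le> 1" for z \<tau>
  proof -
    define A where "A = z\<^sup>2 - 1 + \<tau>\<^sup>2"
    define N where "N = z * ((real M - 1) * A * (z\<^sup>2 - (zs M)\<^sup>2 + \<tau>\<^sup>2) + 4 * (real M + 1) * \<tau>\<^sup>2)"
    define D where "D = (A + 1) * (A\<^sup>2 + 4 * \<tau>\<^sup>2)"
    have z1: "z > 1" "zs M > 1" using zs_gt_1[OF M] z by linarith+
    have t2: "\<tau>\<^sup>2 \<le> 1" using t by (simp add: abs_square_le_1)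
    have A0: "A \<ge> 2 / (real M - 1)"
    proof -
      have "(zs M)\<^sup>2 \<le> z\<^sup>2" using z z1 by (intro power_mono) auto
      then show ?thesis using zs_squared_minus_1[OF M] by (simp add: A_def add_increasing2)
    qed
    have Ap: "A > 0" using A0 M by (intro less_le_trans[OF _ A0]) auto
    have A1: "A \<le> (zs M + 1)\<^sup>2"
    proof -
      have "z\<^sup>2 \<le> (zs M + 1)\<^sup>2" using z z1 by (intro power_mono) auto
      then show ?thesis using t2 by (simp add: A_def)
    qed
    have D: "0 < D" "D \<le> K"
    proof -
      show "0 < D" unfolding D_def using Ap by (intro mult_pos_pos add_pos_nonneg) auto
      have "A\<^sup>2 \<le> ((zs M + 1)\<^sup>2)\<^sup>2" using A1 Ap by (intro power_mono) auto
      then show "D \<le> K" unfolding D_def K_def using A1 Ap t2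
        by (intro mult_mono add_mono) (auto intro!: add_nonneg_nonneg)
    qed
    have N: "2 * ((z - zs M) + \<tau>\<^sup>2) \<le> N"
    proof -
      have "z - zs M \<le> (z - zs M) * (z + zs M)" using z z1 mult_left_mono[of 1 "z + zs M" "z - zs M"] by simp
      then have "z - zs M + \<tau>\<^sup>2 \<le> z\<^sup>2 - (zs M)\<^sup>2 + \<tau>\<^sup>2" by (simp add: power2_eq_square algebra_simps)
      moreover have "2 \<le> (real M - 1) * A" using A0 M by (simp add: field_simps)
      ultimately have "2 * (z - zs M + \<tau>\<^sup>2) \<le> (real M - 1) * A * (z\<^sup>2 - (zs M)\<^sup>2 + \<tau>\<^sup>2)"
        using z by (intro mult_mono) auto
      also have "\<dots> \<le> (real M - 1) * A * (z\<^sup>2 - (zs M)\<^sup>2 + \<tau>\<^sup>2) + 4 * (real M + 1) * \<tau>\<^sup>2" by simp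
      also have "\<dots> \<le> N"
      proof -
        have "0 \<le> (real M - 1) * A * (z\<^sup>2 - (zs M)\<^sup>2 + \<tau>\<^sup>2) + 4 * (real M + 1) * \<tau>\<^sup>2"
          using calculation z by (smt (verit) zero_le_power2 mult_nonneg_nonneg)
        then show ?thesis unfolding N_def using z1 by (simp add: mult_le_cancel_right1)
      qed
      finally show ?thesis .
    qed
    have "2 * ((z - zs M) + \<tau>\<^sup>2) / K \<le> N / D"
    proof -
      have "0 \<le> 2 * ((z - zs M) + \<tau>\<^sup>2)" using z by (intro mult_nonneg_nonneg add_nonneg_nonneg) auto
      then have "0 \<le> N" using N by (rule order_trans)
      then show ?thesis using N D by (intro frac_le) auto
    qed
    moreover have "Re (fpp M (Complex z \<tau>)) = - (N / D)"
      unfolding Re_fpp_vertical[OF M z(1)] N_def D_def A_def by simp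
    ultimately show ?thesis by simp
  qed
  ultimately show ?thesis using that by blast
qed

text \<open>Upwards along a vertical line the derivative of Re (- LF) is n Im fp up to a bounded
  error, so these bounds are decay rates of the line integrand. \<open>fp\<close> is real on the
  real axis beyond 1, and the \<tau>-derivative of its imaginary part is Re fpp; above height 1 only
  monotonicity is used.\<close>

lemma Im_fp_vertical:
  assumes M: "M \<ge> 2"
  obtains c where "c > 0"
    "\<And>z \<tau>. zs M \<le> z \<Longrightarrow> z \<le> zs M + 1 \<Longrightarrow> 0 \<le> \<tau> \<Longrightarrow> \<tau> \<le> 1 \<Longrightarrow> Im (fp M (Complex z \<tau>)) \<le> - c * (z - zs M) * \<tau>"
    "\<And>z \<tau>. zs M \<le> z \<Longrightarrow> z \<le> zs M + 1 \<Longrightarrow> 1 \<le> \<tau> \<Longrightarrow> Im (fp M (Complex z \<tau>)) \<le> - c"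
proof -
  obtain c where c: "c > 0"
    "\<And>z \<tau>. zs M \<le> z \<Longrightarrow> z \<le> zs M + 1 \<Longrightarrow> \<bar>\<tau>\<bar> \<le> 1 \<Longrightarrow> Re (fpp M (Complex z \<tau>)) \<le> - c * ((z - zs M) + \<tau>\<^sup>2)"
    using Re_fpp_vertical_le[OF M] by blast
  have C: "Complex z \<tau> = of_real z + of_real \<tau> * \<i>" for z \<tau> by (simp add: complex_eq_iff)
  have der: "((\<lambda>\<tau>. Im (fp M (Complex z \<tau>))) has_real_derivative Re (fpp M (Complex z \<tau>))) (at \<tau>)" if "zs M \<le> z" for z \<tau>
  proof -
    have "Complex z \<tau> - 1 \<notin> \<real>\<^sub>\<le>\<^sub>0" using that zs_gt_1[OF M] by (auto simp: complex_nonpos_Reals_iff)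
    then have "((\<lambda>\<tau>. Re (- \<i> * fp M (of_real z + of_real \<tau> * \<i>))) has_real_derivative Re (- \<i> * (fpp M (of_real z + of_real \<tau> * \<i>) * \<i>))) (at \<tau>)"
      by (intro has_real_derivative_Re_line fp_has_field_derivative) (simp_all add: C)
    then show ?thesis by (simp add: C)
  qed
  have 0: "Im (fp M (Complex z 0)) = 0" if "zs M \<le> z" for z
  proof -
    have z: "z > 1" using that zs_gt_1[OF M] by linarith
    have "Im (Ln (of_real z - 1)) = 0" "Im (Ln (of_real z + 1)) = 0" "Im (Ln (of_real z)) = 0"
      using z Ln_of_real[of "z - 1"] Ln_of_real[of "z + 1"] Ln_of_real[of z] by auto
    then show ?thesis by (simp add: fp_def C)
  qed
  have 1: "Im (fp M (Complex z \<tau>)) \<le> - c * ((z - zs M) * \<tau> + \<tau> ^ 3 / 3)" if z: "zs M \<le> z" "z \<le> zs M + 1" and t: "0 \<le> \<tau>" "\<tau> \<le> 1" for z \<tau>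
    by (rule nonneg_derivative_imp_le[OF t(1) der[OF z(1)], where g' = "\<lambda>\<tau>. - c * ((z - zs M) + \<tau>\<^sup>2)"])
       (use z t 0 c in \<open>auto intro!: derivative_eq_intros\<close>)
  have 2: "Im (fp M (Complex z \<tau>)) \<le> - c / 3" if z: "zs M \<le> z" "z \<le> zs M + 1" and t: "1 \<le> \<tau>" for z \<tau>
  proof -
    have "Im (fp M (Complex z \<tau>)) \<le> Im (fp M (Complex z 1))"
      by (rule DERIV_nonpos_imp_nonincreasing[OF t]) (use der[OF z(1)] Re_fpp_vertical_nonpos[OF M z(1)] in blast)
    also have "\<dots> \<le> - c * ((z - zs M) * 1 + 1 ^ 3 / 3)" using z by (intro 1) auto
    also have "\<dots> \<le> - c / 3" using c(1) z by (simp add: algebra_simps)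
    finally show ?thesis .
  qed
  show ?thesis
  \<comment> \<open>c / 3 is what the term \<tau>^3 / 3 has contributed at height 1, even when z =
    zs.\<close>
  proof (rule that[of "c / 3"])
    fix z \<tau> :: real assume z: "zs M \<le> z" "z \<le> zs M + 1" "0 \<le> \<tau>" "\<tau> \<le> 1"
    have "0 \<le> c * \<tau> ^ 3" "0 \<le> c * (z - zs M) * \<tau>" using c(1) z by auto
    moreover have "- (c / 3) * (z - zs M) * \<tau> = - (c * (z - zs M) * \<tau>) / 3" by simp
    moreover have "- c * ((z - zs M) * \<tau> + \<tau> ^ 3 / 3) = - (c * (z - zs M) * \<tau>) - c * \<tau> ^ 3 / 3"
      by (simp add: algebra_simps)
    ultimately show "Im (fp M (Complex z \<tau>)) \<le> - (c / 3) * (z - zs M) * \<tau>"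
      using 1[OF z] by linarith
  qed (use c 2 in auto)
qed

section \<open>The phase on the horizontal sides of the contour\<close>

lemma x_star_ge:
  assumes M: "M \<ge> 2"
  shows "x_star M \<ge> (real M + 1) / 2"
proof -
  have p: "real M - 1 > 0" "real M + 1 > 0" using M by auto
  have "(real M + 1) powr ((real M + 1) / 2) = (real M + 1) powr ((real M - 1) / 2) * (real M + 1)"
  proof -
    have "(real M + 1) / 2 = (real M - 1) / 2 + 1" by (simp add: field_simps)
    then show ?thesis using p by (simp only: powr_add) simp
  qed
  moreover have "(real M - 1) powr ((real M - 1) / 2) \<le> (real M + 1) powr ((real M - 1) / 2)"
    using p by (intro powr_mono2) auto
  moreover have B: "(real M - 1) powr ((real M - 1) / 2) > 0" using p by simp
  ultimately have "x_star M = (real M + 1) / 2 * ((real M + 1) powr ((real M - 1) / 2) / (real M - 1) powr ((real M - 1) / 2))"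
    and "1 \<le> (real M + 1) powr ((real M - 1) / 2) / (real M - 1) powr ((real M - 1) / 2)"
    by (simp_all add: x_star_def)
  moreover from this(2) have "(real M + 1) / 2 * 1 \<le> (real M + 1) / 2 * ((real M + 1) powr ((real M - 1) / 2) / (real M - 1) powr ((real M - 1) / 2))"
    using p by (intro mult_left_mono) auto
  ultimately show ?thesis by simp
qed

text \<open>On the horizontal segment at height s the modulus of z is largest at the corner, while
  |z^2 - 1| is at least 2 s. This is the inequality that these two facts leave to be checked for Re
  fp \<ge> 0.\<close>

lemma corner_norm:
  assumes M: "M \<ge> 2"
  defines "s \<equiv> 2 / (real M + 1)"
  shows "((zs M - s)\<^sup>2 + s\<^sup>2) ^ (M + 1) \<le> (2 * s * x_star M)\<^sup>2"
proof -
  define R where "R = (zs M - s)\<^sup>2 + s\<^sup>2"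
  have zl: "zs M \<ge> (real M + 1) / real M"
  proof (rule power2_le_imp_le)
    show "((real M + 1) / real M)\<^sup>2 \<le> (zs M)\<^sup>2"
      unfolding zs_squared[OF M] using M by (simp add: power_divide divide_simps power2_eq_square) (simp add: algebra_simps)
  qed (use zs_gt_1[OF M] in auto)
  have R: "R = (zs M)\<^sup>2 - 2 * s * zs M + 2 * s\<^sup>2"
    by (simp add: R_def power2_eq_square algebra_simps)
  have Rle: "R \<le> (real M + 1) / (real M - 1) - 4 / real M + 8 / (real M + 1)\<^sup>2"
  proof -
    have "2 * s * ((real M + 1) / real M) \<le> 2 * s * zs M"
      using zl M by (intro mult_left_mono) (auto simp: s_def)
    moreover have "s * (real M + 1) = 2"
    proof -
      have "real M + 1 \<noteq> 0" by linarith
      then have "(s = 2 / (real M + 1)) = (s * (real M + 1) = 2)" by (rule nonzero_eq_divide_eq)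
      with s_def show ?thesis by blast
    qed
    then have "2 * s * ((real M + 1) / real M) = 4 / real M"
      by (simp add: mult.assoc)
    moreover have "2 * s\<^sup>2 = 8 / (real M + 1)\<^sup>2" by (simp add: s_def power_divide)
    ultimately show ?thesis unfolding R zs_squared[OF M] by linarith
  qed
  have R0: "R \<ge> 0" by (simp add: R_def)
  have s1: "2 * s * x_star M \<ge> 2"
  proof -
    have "2 * s * ((real M + 1) / 2) \<le> 2 * s * x_star M"
      using x_star_ge[OF M] M by (intro mult_left_mono) (auto simp: s_def)
    moreover have "2 * s * ((real M + 1) / 2) = 2"
    proof -
      have "real M + 1 \<noteq> 0" by linarith
      then have "(s = 2 / (real M + 1)) = (s * (real M + 1) = 2)" by (rule nonzero_eq_divide_eq)
      with s_def have "s * (real M + 1) = 2" by blast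
      then show ?thesis by (simp add: mult.assoc)
    qed
    ultimately show ?thesis by linarith
  qed
  then have s2: "(2 * s * x_star M)\<^sup>2 \<ge> 4" using power_mono[OF s1, of 2] by simp
  \<comment> \<open>From M = 4 on the base R is at most 1. For M = 2 and M = 3 it exceeds 1 and is
    estimated numerically.\<close>
  consider "M = 2" | "M = 3" | "M \<ge> 4" using M by linarith
  then have "R ^ (M + 1) \<le> (2 * s * x_star M)\<^sup>2"
  proof cases
    case 1
    have zz: "zs 2 = sqrt 3" by (simp add: zs_def)
    have sq: "sqrt 3 \<ge> (17/10::real)" by (rule real_le_rsqrt) (simp add: power2_eq_square)
    have "R \<le> 1.63" unfolding R using 1 sq by (simp add: s_def zz power2_eq_square)
    then have "R ^ (M + 1) \<le> 1.63 ^ 3" using R0 1 by (simp add: power_mono)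
    also have "\<dots> \<le> (2 * s * x_star M)\<^sup>2"
    proof -
      have xs: "x_star 2 = 3 powr (3 / 2) / 2" by (simp add: x_star_def)
      have p2: "(3 powr (3 / 2) :: real)\<^sup>2 = 27"
        by (simp add: power2_eq_square powr_add[symmetric])
      have "(x_star 2)\<^sup>2 = 27 / 4" unfolding xs power_divide p2 by simp
      then have "(2 * s * x_star M)\<^sup>2 = 12" using 1 by (simp add: s_def power_mult_distrib power_divide)
      then show ?thesis by (simp add: power3_eq_cube)
    qed
    finally show ?thesis .
  next
    case 2
    have zz: "zs 3 = sqrt 2" by (simp add: zs_def)
    have sq: "sqrt 2 \<ge> (14/10::real)" by (rule real_le_rsqrt) (simp add: power2_eq_square)
    have "R \<le> 1.1" unfolding R using 2 sq by (simp add: s_def zz power2_eq_square)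
    then have "R ^ (M + 1) \<le> 1.1 ^ 4" using R0 2 by (simp add: power_mono)
    also have "\<dots> \<le> 4" by (simp add: power4_eq_xxxx)
    finally show ?thesis using s2 by linarith
  next
    case 3
    define x where "x = real M"
    have x: "x \<ge> 4" using 3 by (simp add: x_def)
    have "(x + 1) / (x - 1) - 4 / x + 8 / (x + 1)\<^sup>2 \<le> 1"
    proof -
      have "(x + 1) / (x - 1) - 4 / x + 8 / (x + 1)\<^sup>2 - 1 = (2 * x * (x + 1)\<^sup>2 - 4 * (x - 1) * (x + 1)\<^sup>2 + 8 * x * (x - 1)) / (x * (x - 1) * (x + 1)\<^sup>2)"
        using x by (simp add: divide_simps) (simp add: algebra_simps power2_eq_square)
      also have "2 * x * (x + 1)\<^sup>2 - 4 * (x - 1) * (x + 1)\<^sup>2 + 8 * x * (x - 1) = - (2 * (x - 4) * x\<^sup>2 + (2 * x - 4))"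
        by (simp add: algebra_simps power2_eq_square)
      also have "\<dots> / (x * (x - 1) * (x + 1)\<^sup>2) \<le> 0"
      proof -
        have "0 \<le> 2 * (x - 4) * x\<^sup>2 + (2 * x - 4)" using x by (intro add_nonneg_nonneg mult_nonneg_nonneg) auto
        moreover have "0 \<le> x * (x - 1) * (x + 1)\<^sup>2" using x by (intro mult_nonneg_nonneg) auto
        ultimately show ?thesis by (intro divide_nonpos_nonneg) linarith+
      qed
      finally show ?thesis by simp
    qed
    then have "R \<le> 1" using Rle by (simp add: x_def)
    then have "R ^ (M + 1) \<le> 1" using R0 by (intro power_le_one)
    then show ?thesis using s2 by linarith
  qed
  then show ?thesis by (simp add: R_def)
qed

text \<open>Re fp is the logarithm of x_star |z^2 - 1| / |z|^(M + 1). Its sign means that the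
  modulus of the polynomial's integrand does not decrease towards the right, up to a bounded factor,
  so the horizontal side is controlled by the corner.\<close>

lemma Re_fp_horizontal:
  assumes M: "M \<ge> 2"
  defines "s \<equiv> 2 / (real M + 1)"
  assumes \<sigma>: "\<bar>\<sigma>\<bar> \<le> zs M - s"
  shows "Re (fp M (Complex \<sigma> s)) \<ge> 0"
proof -
  let ?z = "Complex \<sigma> s"
  have s0: "s > 0" by (simp add: s_def)
  have nz: "?z \<noteq> 0" "?z - 1 \<noteq> 0" "?z + 1 \<noteq> 0" using s0 by (auto simp: complex_eq_iff)
  have re: "Re (fp M ?z) = ln (norm (?z - 1) * norm (?z + 1) * x_star M) - (real M + 1) * ln (norm ?z)"
    using nz x_star_pos[OF M] by (simp add: fp_def ln_mult)
  have a: "(norm (?z - 1) * norm (?z + 1))\<^sup>2 \<ge> (2 * s)\<^sup>2"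
  proof -
    have "(norm (?z - 1) * norm (?z + 1))\<^sup>2 = ((\<sigma> - 1)\<^sup>2 + s\<^sup>2) * ((\<sigma> + 1)\<^sup>2 + s\<^sup>2)"
      by (simp add: power_mult_distrib cmod_power2)
    also have "\<dots> = (\<sigma>\<^sup>2 + s\<^sup>2 - 1)\<^sup>2 + (2 * s)\<^sup>2"
      by (simp add: power2_eq_square algebra_simps)
    finally show ?thesis by simp
  qed
  have "(norm ?z)\<^sup>2 \<le> (zs M - s)\<^sup>2 + s\<^sup>2"
    using \<sigma> by (simp add: cmod_power2 abs_le_square_iff[symmetric] del: abs_le_square_iff)
  then have "((norm ?z)\<^sup>2) ^ (M + 1) \<le> ((zs M - s)\<^sup>2 + s\<^sup>2) ^ (M + 1)" by (intro power_mono) auto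
  also have "\<dots> \<le> (2 * s * x_star M)\<^sup>2" using corner_norm[OF M] by (simp add: s_def)
  also have "\<dots> = (2 * s)\<^sup>2 * (x_star M)\<^sup>2" by (simp add: power_mult_distrib)
  also have "\<dots> \<le> (norm (?z - 1) * norm (?z + 1))\<^sup>2 * (x_star M)\<^sup>2" by (intro mult_right_mono a) auto
  finally have "(norm ?z ^ (M + 1))\<^sup>2 \<le> (norm (?z - 1) * norm (?z + 1) * x_star M)\<^sup>2"
    by (simp only: power_mult_distrib power_mult[symmetric] mult.commute)
  then have "norm ?z ^ (M + 1) \<le> norm (?z - 1) * norm (?z + 1) * x_star M"
    by (rule power2_le_imp_le) (use x_star_pos[OF M] in auto)
  then have "ln (norm ?z ^ (M + 1)) \<le> ln (norm (?z - 1) * norm (?z + 1) * x_star M)"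
    using nz x_star_pos[OF M] by (intro ln_mono) auto
  moreover have "ln (norm ?z ^ (M + 1)) = (real M + 1) * ln (norm ?z)"
    by (subst ln_realpow) (use nz in auto)
  ultimately show ?thesis unfolding re by simp
qed

section \<open>Local expansion at the saddle point\<close>

context truncated_product
begin

definition "X0 n = real n ^ (M - 1) * x_star M"

text \<open>A logarithm of \<open>Fac n t\<close> times \<open>X0 n\<close> to the power t. Built
  from \<open>ln_Gamma\<close>, it is differentiable off the cut of t - n + 1 and lives only there,
  whereas its exponential extends meromorphically.\<close>

definition "LF n t = ln_Gamma (t - of_nat n + 1) + ln_Gamma (t + of_nat n + of_nat \<kappa>)
   - (\<Sum>j=0..M. ln_Gamma (t + of_nat (\<nu> j) + 1)) + t * of_real (ln (X0 n))" for t :: complex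

definition "dLF n t = Digamma (t - of_nat n + 1) + Digamma (t + of_nat n + of_nat \<kappa>)
   - (\<Sum>j=0..M. Digamma (t + of_nat (\<nu> j) + 1)) + of_real (ln (X0 n))" for t :: complex

lemma X0_pos: "n \<ge> 1 \<Longrightarrow> X0 n > 0"
  using x_star_pos[OF M] by (simp add: X0_def)

lemma shifts_not_nonpos_Reals:
  fixes t :: complex
  assumes "t - of_nat n + 1 \<notin> \<real>\<^sub>\<le>\<^sub>0"
  shows "t + of_nat n + of_nat \<kappa> \<notin> \<real>\<^sub>\<le>\<^sub>0" "t + of_nat k + 1 \<notin> \<real>\<^sub>\<le>\<^sub>0"
  using assms kappa by (auto simp: complex_nonpos_Reals_iff)

lemma LF_has_field_derivative:
  assumes "t - of_nat n + 1 \<notin> \<real>\<^sub>\<le>\<^sub>0"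
  shows "(LF n has_field_derivative dLF n t) (at t)"
  unfolding LF_def[abs_def] dLF_def
  using assms shifts_not_nonpos_Reals[OF assms]
  by (auto intro!: derivative_eq_intros)

lemma exp_LF:
  assumes t: "t - of_nat n + 1 \<notin> \<real>\<^sub>\<le>\<^sub>0"
  shows "exp (LF n t) = Fac n t * exp (t * of_real (ln (X0 n)))"
proof -
  note s = shifts_not_nonpos_Reals[OF t]
  have nI: "z \<notin> \<real>\<^sub>\<le>\<^sub>0 \<Longrightarrow> z \<notin> \<int>\<^sub>\<le>\<^sub>0" for z :: complex using nonpos_Ints_subset_nonpos_Reals by blast
  have g: "exp (ln_Gamma z) = Gamma z" if "z \<notin> \<real>\<^sub>\<le>\<^sub>0" for z :: complex
    using nI[OF that] by (simp add: Gamma_complex_altdef)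
  have "exp (LF n t) = Gamma (t - of_nat n + 1) * Gamma (t + of_nat n + of_nat \<kappa>) / (\<Prod>j=0..M. Gamma (t + of_nat (\<nu> j) + 1)) * exp (t * of_real (ln (X0 n)))"
    unfolding LF_def exp_add exp_diff exp_sum[OF finite_atLeastAtMost] using t s by (simp add: g)
  also have "(\<Prod>j=0..M. Gamma (t + of_nat (\<nu> j) + 1)) = Gamma (t + 1) * (\<Prod>j=1..M. Gamma (t + of_nat (\<nu> j) + 1))"
    by (simp add: prod.atLeast_Suc_atMost nu0)
  also have "Gamma (t - of_nat n + 1) * Gamma (t + of_nat n + of_nat \<kappa>) / (Gamma (t + 1) * (\<Prod>j=1..M. Gamma (t + of_nat (\<nu> j) + 1))) = Fac n t"
    unfolding Fac_def Phi_def Gamma_quotient_falling[OF nI[OF t]]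
    by (simp add: rGamma_inverse_Gamma divide_inverse prod_inversef[unfolded o_def, symmetric] mult_ac)
  finally show ?thesis .
qed

lemma exp_minus_LF:
  assumes t: "t - of_nat n + 1 \<notin> \<real>\<^sub>\<le>\<^sub>0"
  shows "exp (- LF n t) = Ginv n t * exp (- t * of_real (ln (X0 n)))"
proof -
  note s = shifts_not_nonpos_Reals[OF t]
  have nI: "z \<notin> \<real>\<^sub>\<le>\<^sub>0 \<Longrightarrow> z \<notin> \<int>\<^sub>\<le>\<^sub>0" for z :: complex using nonpos_Ints_subset_nonpos_Reals by blast
  have g: "Gamma z \<noteq> 0" if "z \<notin> \<real>\<^sub>\<le>\<^sub>0" for z :: complex
    using nI[OF that] by (simp add: Gamma_eq_zero_iff)
  have p: "(\<Prod>k<n. t - of_nat k) \<noteq> 0"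
    unfolding Gamma_quotient_falling[OF nI[OF t]] using g[OF t] g[OF s(2)[of 0]] by simp
  have q: "(\<Prod>j=1..M. Gamma (t + of_nat (\<nu> j) + 1)) \<noteq> 0" using g[OF s(2)] by simp
  have R: "(\<Prod>j=1..M. rGamma (t + of_nat (\<nu> j) + 1)) = inverse (\<Prod>j=1..M. Gamma (t + of_nat (\<nu> j) + 1))"
    unfolding rGamma_inverse_Gamma
    using prod_inversef[of "\<lambda>j. Gamma (t + of_nat (\<nu> j) + 1)" "{1..M}"] by (simp only: o_def)
  have alg: "A * inverse B * P * (B * inverse A / P) = 1" if "A \<noteq> 0" "B \<noteq> 0" "P \<noteq> 0" for A B P :: complex
    using that by (simp add: field_simps)
  have inv: "Ginv n t * Fac n t = 1"
    unfolding Ginv_def Fac_def Phi_def R unfolding rGamma_inverse_Gamma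
    by (rule alg[OF q g[OF s(1)] p])
  have "exp (- LF n t) = inverse (Fac n t) * inverse (exp (t * of_real (ln (X0 n))))"
    by (simp add: exp_minus exp_LF[OF t])
  also have "inverse (Fac n t) = Ginv n t" using inv by (simp add: inverse_unique mult.commute)
  finally show ?thesis by (simp add: exp_minus)
qed

text \<open>Each Digamma becomes a logarithm of t - n, t + n or t. Scaling these by n produces (2 -
  (M + 1)) ln n, which the power n^(M - 1) in \<open>X0\<close> cancels; this fixes the scale of
  x.\<close>

lemma dLF_approx:
  assumes \<beta>: "0 \<le> \<beta>" "\<beta> < 1" and c: "c > 0"
  obtains C N where "C > 0" "N \<ge> (1::nat)"
    "\<And>n t. n \<ge> N \<Longrightarrow> Re t \<ge> -1 \<Longrightarrow> Re t \<ge> - \<beta> * cmod t \<Longrightarrow> Re (t - of_nat n) \<ge> - \<beta> * cmod (t - of_nat n) \<Longrightarrow>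
       cmod t \<ge> c * real n \<Longrightarrow> cmod (t - of_nat n) \<ge> c * real n \<Longrightarrow>
       cmod (dLF n t - fp M (t / of_nat n)) \<le> C / real n \<and> t - of_nat n + 1 \<notin> \<real>\<^sub>\<le>\<^sub>0"
proof -
  \<comment> \<open>n \<ge> 1 / c gives the lower bound 1 on the moduli in the Digamma estimate, and
    n \<ge> 2 gives Re (t + n) \<ge> n - 1 \<ge> n / 2.\<close>
  define N where "N = nat \<lceil>1 / c\<rceil> + 2"
  define D where "D = (\<lambda>k. (4 + 2 * real k) / (1 - \<beta>))"
  define C where "C = D 1 / c + D \<kappa> / (1 / 2) + (\<Sum>j=0..M. D (\<nu> j + 1) / c)"
  have D: "D k > 0" for k using \<beta> by (simp add: D_def add_pos_nonneg)
  have "C > 0" unfolding C_def using D c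
    by (intro add_pos_nonneg add_pos_pos sum_nonneg divide_pos_pos) (auto intro: less_imp_le)
  moreover have "N \<ge> 1" by (simp add: N_def)
  moreover have "cmod (dLF n t - fp M (t / of_nat n)) \<le> C / real n \<and> t - of_nat n + 1 \<notin> \<real>\<^sub>\<le>\<^sub>0"
    if n: "n \<ge> N" and t: "Re t \<ge> -1" "Re t \<ge> - \<beta> * cmod t" "Re (t - of_nat n) \<ge> - \<beta> * cmod (t - of_nat n)"
       "cmod t \<ge> c * real n" "cmod (t - of_nat n) \<ge> c * real n" for n t
  proof -
    have n2: "real n \<ge> 2" using n by (simp add: N_def)
    have "1 / c \<le> real n" using n real_nat_ceiling_ge[of "1 / c"] unfolding N_def by linarith
    then have cn: "c * real n \<ge> 1" using c by (simp add: field_simps)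
    have nz: "t \<noteq> 0" "t - of_nat n \<noteq> 0" using t cn by auto
    have notR: "t - of_nat n + of_real 1 \<notin> \<real>\<^sub>\<le>\<^sub>0"
      using t \<beta> nz by (intro sector_not_nonpos_Reals) auto
    have re3: "Re (t + of_nat n) \<ge> 1 / 2 * real n" using t n2 by simp
    then have a3: "cmod (t + of_nat n) \<ge> 1 / 2 * real n"
      using complex_Re_le_cmod[of "t + of_nat n"] by linarith
    have nz3: "t + of_nat n \<noteq> 0" using a3 n2 by auto
    have dl: "cmod (Digamma (z + of_nat k) - Ln z) \<le> D k / e / real n"
      if "Re z \<ge> - \<beta> * cmod z" "cmod z \<ge> e * real n" "e * real n \<ge> 1" for z k e
    proof -
      have "cmod (Digamma (z + of_nat k) - Ln z) \<le> D k / cmod z"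
        unfolding D_def using that \<beta> by (intro norm_Digamma_shift_minus_Ln_le) auto
      also have "\<dots> \<le> D k / (e * real n)"
      proof -
        have "cmod z > 0" "e * real n > 0" using that by linarith+
        then have "0 < cmod z * (e * real n)" by (rule mult_pos_pos)
        then show ?thesis using that(2) D[of k] by (intro divide_left_mono) auto
      qed
      finally show ?thesis by simp
    qed
    have 1: "cmod (Digamma (t - of_nat n + of_nat 1) - Ln (t - of_nat n)) \<le> D 1 / c / real n"
      using t cn by (intro dl) auto
    have 2: "cmod (Digamma (t + of_nat n + of_nat \<kappa>) - Ln (t + of_nat n)) \<le> D \<kappa> / (1 / 2) / real n"
    proof (intro dl a3)
      have "0 \<le> \<beta> * cmod (t + of_nat n)" using \<beta> by simp
      then show "Re (t + of_nat n) \<ge> - \<beta> * cmod (t + of_nat n)" using re3 n2 by linarith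
    qed (use n2 in auto)
    have 3: "cmod (\<Sum>j=0..M. Digamma (t + of_nat (\<nu> j + 1)) - Ln t) \<le> (\<Sum>j=0..M. D (\<nu> j + 1) / c / real n)"
      using t cn by (intro sum_norm_le dl) auto
    have lnX: "ln (X0 n) = (real M - 1) * ln (real n) + ln (x_star M)"
      using n2 x_star_pos[OF M] M by (simp add: X0_def ln_mult ln_realpow of_nat_diff)
    have l1: "Ln (t / of_nat n - 1) = Ln (t - of_nat n) - of_real (ln (real n))"
    proof -
      have "t / of_nat n - 1 = (t - of_nat n) / of_real (real n)" using n2 by (simp add: field_simps)
      then show ?thesis using Ln_divide_of_real[of "real n" "t - of_nat n"] n2 nz by simp
    qed
    have l2: "Ln (t / of_nat n + 1) = Ln (t + of_nat n) - of_real (ln (real n))"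
    proof -
      have "t / of_nat n + 1 = (t + of_nat n) / of_real (real n)" using n2 by (simp add: field_simps)
      then show ?thesis using Ln_divide_of_real[of "real n" "t + of_nat n"] n2 nz3 by simp
    qed
    have l3: "Ln (t / of_nat n) = Ln t - of_real (ln (real n))"
      using Ln_divide_of_real[of "real n" t] n2 nz by simp
    have "dLF n t - fp M (t / of_nat n) = (Digamma (t - of_nat n + of_nat 1) - Ln (t - of_nat n))
       + (Digamma (t + of_nat n + of_nat \<kappa>) - Ln (t + of_nat n))
       - (\<Sum>j=0..M. Digamma (t + of_nat (\<nu> j + 1)) - Ln t)"
      unfolding dLF_def fp_def l1 l2 l3 lnX sum_subtractf
      by (simp add: algebra_simps)
    also have "cmod \<dots> \<le> D 1 / c / real n + D \<kappa> / (1 / 2) / real n + (\<Sum>j=0..M. D (\<nu> j + 1) / c / real n)"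
      by (intro order_trans[OF norm_triangle_ineq4] order_trans[OF norm_triangle_ineq] add_mono 1 2 3)
    also have "\<dots> = C / real n"
      by (simp add: C_def add_divide_distrib sum_divide_distrib)
    finally show ?thesis using notR by simp
  qed
  ultimately show ?thesis using that by blast
qed

text \<open>The cube root of the coefficient in \<open>fp_taylor\<close>. With w = v / (acb
  n^(1/3)), the integrated quadratic term n (M - 1)^2 w^3 / 6 is v^3 / 3.\<close>

definition "acb = ((real M - 1)\<^sup>2 / 2) powr (1 / 3)"

lemma acb: "acb > 0" "acb ^ 3 = (real M - 1)\<^sup>2 / 2"
proof -
  have "(real M - 1)\<^sup>2 / 2 > 0" using M by simp
  then show "acb > 0" "acb ^ 3 = (real M - 1)\<^sup>2 / 2"
    by (auto simp: acb_def powr_realpow[symmetric] powr_powr)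
qed

text \<open>The scale \<open>b\<close> is chosen so that \<open>t = n z + v / b\<close> turns the cubic term of the phase into \<open>- v\<^sup>3 / 3\<close>.\<close>

definition "bsc n = acb / real n powr (2 / 3)" for n :: nat

definition "t0 n = real n * zs M" for n :: nat

lemma bsc_pos: "n \<ge> 1 \<Longrightarrow> bsc n > 0"
  using acb by (simp add: bsc_def)

lemma n_bsc: "n \<ge> 1 \<Longrightarrow> 1 / bsc n = real n * (1 / (acb * real n powr (1 / 3)))"
proof -
  assume n: "n \<ge> 1"
  have "real n powr (2 / 3) * real n powr (1 / 3) = real n"
    using n by (simp add: powr_add[symmetric])
  then show ?thesis using acb n by (simp add: bsc_def field_simps)
qed

text \<open>The quantity to be small is an increment over \<theta> in [0, 1]. Its derivative splits
  into the Digamma error, at most C |w|, and the Taylor error, at most \<epsilon> n |w|^3. Here w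
  tends to 0 while n |w|^3 does not depend on n.\<close>

lemma saddle_cubic_limit:
  "(\<lambda>n. LF n (of_real (t0 n) + v / of_real (bsc n)) - LF n (of_real (t0 n))) \<longlonglongrightarrow> - (v ^ 3 / 3)"
proof -
  let ?z = "zs M"
  have z: "?z > 1" using zs_gt_1[OF M] .
  define \<rho> where "\<rho> = (?z - 1) / 2"
  have \<rho>: "\<rho> > 0" using z by (simp add: \<rho>_def)
  obtain C N where CN: "C > 0" "N \<ge> (1::nat)"
    "\<And>n t. n \<ge> N \<Longrightarrow> Re t \<ge> -1 \<Longrightarrow> Re t \<ge> - 0 * cmod t \<Longrightarrow> Re (t - of_nat n) \<ge> - 0 * cmod (t - of_nat n) \<Longrightarrow>
       cmod t \<ge> \<rho> * real n \<Longrightarrow> cmod (t - of_nat n) \<ge> \<rho> * real n \<Longrightarrow>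
       cmod (dLF n t - fp M (t / of_nat n)) \<le> C / real n \<and> t - of_nat n + 1 \<notin> \<real>\<^sub>\<le>\<^sub>0"
    using dLF_approx[of 0 \<rho>] \<rho> by auto
  have near: "cmod (dLF n (of_nat n * (of_real ?z + w)) - fp M (of_real ?z + w)) \<le> C / real n \<and> of_nat n * (of_real ?z + w) - of_nat n + 1 \<notin> \<real>\<^sub>\<le>\<^sub>0"
    if n: "n \<ge> N" and w: "cmod w \<le> \<rho>" for n w
  proof -
    let ?t = "of_nat n * (of_real ?z + w)"
    have n1: "real n > 0" using n CN by linarith
    have "\<bar>Re w\<bar> \<le> \<rho>" using abs_Re_le_cmod[of w] w by linarith
    then have re: "?z - 1 + Re w \<ge> \<rho>" by (simp add: \<rho>_def field_simps)
    have e2: "Re (?t - of_nat n) = real n * (?z - 1 + Re w)" by (simp add: algebra_simps)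
    have e1: "Re ?t = real n * (?z - 1 + Re w) + real n" by (simp add: algebra_simps)
    have ge: "real n * (?z - 1 + Re w) \<ge> \<rho> * real n"
      using re n1 by (simp add: mult.commute mult_left_mono)
    have ge0: "\<rho> * real n \<ge> 0" using \<rho> by simp
    have "cmod (dLF n ?t - fp M (?t / of_nat n)) \<le> C / real n \<and> ?t - of_nat n + 1 \<notin> \<real>\<^sub>\<le>\<^sub>0"
    proof (rule CN(3)[OF n])
      show "cmod ?t \<ge> \<rho> * real n" using complex_Re_le_cmod[of ?t] e1 ge n1 by linarith
      show "cmod (?t - of_nat n) \<ge> \<rho> * real n" using complex_Re_le_cmod[of "?t - of_nat n"] e2 ge by linarith
      show "Re ?t \<ge> -1" using e1 ge ge0 n1 by linarith
      have "Re ?t \<ge> 0" using e1 ge ge0 n1 by linarith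
      then show "Re ?t \<ge> - 0 * cmod ?t" by simp
      have "Re (?t - of_nat n) \<ge> 0" using e2 ge ge0 by linarith
      then show "Re (?t - of_nat n) \<ge> - 0 * cmod (?t - of_nat n)" by simp
    qed
    then show ?thesis using n1 by simp
  qed
  define w where "w = (\<lambda>n::nat. v / of_real (acb * real n powr (1 / 3)))"
  have normw: "cmod (w n) = cmod v / (acb * real n powr (1 / 3))" for n
    using acb(1) by (simp add: w_def norm_divide norm_mult)
  have w0: "(\<lambda>n. cmod (w n)) \<longlonglongrightarrow> 0"
    unfolding normw using acb(1) by real_asymp
  have w3: "of_nat n * w n ^ 3 = v ^ 3 / of_real (acb ^ 3)" if "n \<ge> 1" for n
  proof -
    have "(real n powr (1 / 3)) ^ 3 = real n" using that by (simp add: powr_realpow[symmetric] powr_powr)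
    then have "complex_of_real (real n powr (1 / 3)) ^ 3 = of_nat n"
      by (simp flip: of_real_power)
    then show ?thesis using that acb(1) by (simp add: w_def power_divide power_mult_distrib)
  qed
  have wt: "of_real (t0 n) + v / of_real (bsc n) * \<theta> = of_nat n * (of_real ?z + \<theta> * w n)" if "n \<ge> 1" for n \<theta>
  proof -
    have "v / complex_of_real (bsc n) = v * of_real (1 / bsc n)" by simp
    also have "\<dots> = of_nat n * w n" unfolding n_bsc[OF that] by (simp add: w_def)
    finally show ?thesis by (simp add: t0_def algebra_simps)
  qed
  show ?thesis
  proof (rule LIMSEQ_I)
    fix e :: real assume e: "e > 0"
    \<comment> \<open>The summand 1 keeps the divisor in \<epsilon> positive when v = 0.\<close>
    define K where "K = cmod v ^ 3 / acb ^ 3 + 1"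
    define \<epsilon> where "\<epsilon> = e / (2 * K)"
    have p: "K > 0" unfolding K_def using acb(1) by (intro add_nonneg_pos) auto
    have \<epsilon>: "\<epsilon> > 0" using e p by (simp add: \<epsilon>_def)
    obtain d where d: "d > 0"
      "\<And>w. norm w < d \<Longrightarrow> norm (fp M (of_real ?z + w) + (of_nat M - 1)\<^sup>2 / 2 * w\<^sup>2) \<le> \<epsilon> * (norm w)\<^sup>2"
      using fp_taylor[OF M \<epsilon>] by blast
    have "eventually (\<lambda>n. cmod (w n) < min (min \<rho> d) (e / (2 * C))) sequentially"
      using w0 \<rho> d(1) e CN(1) by (intro order_tendstoD(2)) auto
    then obtain N' where N': "\<And>n. n \<ge> N' \<Longrightarrow> cmod (w n) < min (min \<rho> d) (e / (2 * C))"
      by (auto simp: eventually_sequentially)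
    show "\<exists>no. \<forall>n\<ge>no. norm (LF n (of_real (t0 n) + v / of_real (bsc n)) - LF n (of_real (t0 n)) - - (v ^ 3 / 3)) < e"
    proof (intro exI allI impI)
      fix n assume "n \<ge> max N N'"
      then have n: "n \<ge> N" "n \<ge> N'" "n \<ge> 1" using CN by auto
      have n0: "real n > 0" using n by simp
      note wn = N'[OF n(2)]
      let ?g = "\<lambda>\<theta>. LF n (of_real (t0 n) + v / of_real (bsc n) * \<theta>) + \<theta> ^ 3 * (v ^ 3 / 3)"
      let ?B = "\<epsilon> * (cmod v ^ 3 / acb ^ 3) + C * cmod (w n)"
      have "norm (?g 1 - ?g 0) \<le> ?B * norm (1 - 0 :: complex)"
      proof (rule field_differentiable_bound[where S = "closed_segment 0 1"])
        fix \<theta> :: complex assume th: "\<theta> \<in> closed_segment 0 1"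
        have th1: "cmod \<theta> \<le> 1" using segment_bound1[OF th] by simp
        let ?w = "\<theta> * w n"
        have nw: "cmod ?w \<le> cmod (w n)" unfolding norm_mult using th1 mult_right_mono[OF th1, of "cmod (w n)"] by simp
        let ?t = "of_real (t0 n) + v / of_real (bsc n) * \<theta>"
        have near': "cmod (dLF n ?t - fp M (of_real ?z + ?w)) \<le> C / real n" "?t - of_nat n + 1 \<notin> \<real>\<^sub>\<le>\<^sub>0"
          using near[OF n(1), of ?w] nw wn unfolding wt[OF n(3)] by auto
        have D: "((\<lambda>\<theta>. LF n (of_real (t0 n) + v / of_real (bsc n) * \<theta>)) has_field_derivative dLF n ?t * (v / of_real (bsc n))) (at \<theta>)"
          by (rule DERIV_chain2[where f = "LF n" and g = "\<lambda>\<theta>. of_real (t0 n) + v / of_real (bsc n) * \<theta>"])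
             (use near'(2) bsc_pos[OF n(3)] in \<open>auto intro!: derivative_eq_intros LF_has_field_derivative\<close>)
        moreover have "((\<lambda>\<theta>. \<theta> ^ 3 * (v ^ 3 / 3)) has_field_derivative \<theta>\<^sup>2 * v ^ 3) (at \<theta>)"
          by (auto intro!: derivative_eq_intros simp: power2_eq_square)
        ultimately have "(?g has_field_derivative dLF n ?t * (v / of_real (bsc n)) + \<theta>\<^sup>2 * v ^ 3) (at \<theta>)"
          by (rule DERIV_add)
        then show "(?g has_field_derivative dLF n ?t * (v / of_real (bsc n)) + \<theta>\<^sup>2 * v ^ 3) (at \<theta> within closed_segment 0 1)"
          by (rule has_field_derivative_at_within)
        have vb: "v / complex_of_real (bsc n) = of_nat n * w n"
          using wt[OF n(3), of 1] by (simp add: t0_def algebra_simps)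
        have v3: "of_nat n * w n * ((of_nat M - 1)\<^sup>2 / 2 * ?w\<^sup>2) = \<theta>\<^sup>2 * v ^ 3"
        proof -
          have "complex_of_real (acb ^ 3) = (of_nat M - 1)\<^sup>2 / 2" unfolding acb(2) by simp
          then have "of_nat n * w n ^ 3 * ((of_nat M - 1)\<^sup>2 / 2) = v ^ 3"
            using w3[OF n(3)] acb(1) M by simp
          then show ?thesis by (simp add: power_mult_distrib power2_eq_square power3_eq_cube mult_ac)
        qed
        have "dLF n ?t * (v / of_real (bsc n)) + \<theta>\<^sup>2 * v ^ 3 =
          (dLF n ?t - fp M (of_real ?z + ?w)) * (of_nat n * w n) + of_nat n * w n * (fp M (of_real ?z + ?w) + (of_nat M - 1)\<^sup>2 / 2 * ?w\<^sup>2)"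
          unfolding vb v3[symmetric] by (simp add: algebra_simps)
        also have "norm \<dots> \<le> C / real n * (real n * cmod (w n)) + real n * cmod (w n) * (\<epsilon> * (cmod (w n))\<^sup>2)"
        proof (rule order_trans[OF norm_triangle_ineq], rule add_mono)
          show "cmod ((dLF n ?t - fp M (of_real ?z + ?w)) * (of_nat n * w n)) \<le> C / real n * (real n * cmod (w n))"
            unfolding norm_mult[of "_ - _"] using near'(1) by (intro mult_mono) (auto simp: norm_mult CN(1) less_imp_le)
          have "cmod (fp M (of_real ?z + ?w) + (of_nat M - 1)\<^sup>2 / 2 * ?w\<^sup>2) \<le> \<epsilon> * (cmod ?w)\<^sup>2"
            using nw wn by (intro d(2)) auto
          also have "\<dots> \<le> \<epsilon> * (cmod (w n))\<^sup>2" using nw \<epsilon> by (intro mult_left_mono power_mono) auto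
          finally show "cmod (of_nat n * w n * (fp M (of_real ?z + ?w) + (of_nat M - 1)\<^sup>2 / 2 * ?w\<^sup>2)) \<le> real n * cmod (w n) * (\<epsilon> * (cmod (w n))\<^sup>2)"
            unfolding norm_mult[of "of_nat n * w n"] by (intro mult_mono) (auto simp: norm_mult)
        qed
        also have "\<dots> = C * cmod (w n) + \<epsilon> * (real n * cmod (w n) ^ 3)"
          using n0 by (simp add: power2_eq_square power3_eq_cube)
        also have "real n * cmod (w n) ^ 3 = cmod v ^ 3 / acb ^ 3"
          using arg_cong[OF w3[OF n(3)], of cmod] acb(1) by (simp add: norm_mult norm_power norm_divide)
        finally show "norm (dLF n ?t * (v / of_real (bsc n)) + \<theta>\<^sup>2 * v ^ 3) \<le> ?B" by (simp add: add.commute)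
      qed auto
      also have "?B < e"
      proof -
        have "C * cmod (w n) < e / 2" using wn CN(1) by (simp add: field_simps)
        moreover have "\<epsilon> * (cmod v ^ 3 / acb ^ 3) \<le> \<epsilon> * K" using \<epsilon> by (intro mult_left_mono) (auto simp: K_def)
        moreover have "\<epsilon> * K = e / 2" using p by (simp add: \<epsilon>_def)
        ultimately show ?thesis by linarith
      qed
      finally show "norm (LF n (of_real (t0 n) + v / of_real (bsc n)) - LF n (of_real (t0 n)) - - (v ^ 3 / 3)) < e"
        by (simp add: algebra_simps)
    qed
  qed
qed

section \<open>Asymptotics of the line integral\<close>

lemma cnj_Ginv: "cnj (Ginv n s) = Ginv n (cnj s)"
  by (simp add: Ginv_def cnj_Gamma cnj_rGamma)

text \<open>The length of one unit of v on the scale z = t / n.\<close>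

definition "hsc n = 1 / (acb * real n powr (1 / 3))" for n :: nat

lemma hsc:
  assumes "n \<ge> 1"
  shows "hsc n > 0" "real n * hsc n ^ 3 = 1 / acb ^ 3" "1 / acb\<^sup>2 \<le> real n * (hsc n)\<^sup>2"
    "1 / bsc n = real n * hsc n"
proof -
  define q where "q = real n powr (1 / 3)"
  have q: "q \<ge> 1" "q ^ 3 = real n"
    using assms by (auto simp: q_def powr_realpow[symmetric] powr_powr ge_one_powr_ge_zero)
  have h: "hsc n = 1 / (acb * q)" by (simp add: hsc_def q_def)
  show "hsc n > 0" using q acb(1) by (simp add: h)
  show "real n * hsc n ^ 3 = 1 / acb ^ 3"
    unfolding h using q acb(1) by (simp add: power_divide power_mult_distrib flip: q(2))
  have "real n * (hsc n)\<^sup>2 = q / acb\<^sup>2"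
    unfolding h using q acb(1) by (simp add: power_divide power_mult_distrib power2_eq_square power3_eq_cube flip: q(2))
  then show "1 / acb\<^sup>2 \<le> real n * (hsc n)\<^sup>2" using q acb(1) by (simp add: divide_right_mono)
  show "1 / bsc n = real n * hsc n" unfolding hsc_def by (rule n_bsc[OF assms])
qed

text \<open>The line v = 1 + \<i> y, to the right of the saddle point; in the limit it becomes the
  line of \<open>airy_integrand\<close>.\<close>

definition "\<sigma>l n = t0 n + 1 / bsc n" for n

lemma \<sigma>l_gt: "n \<ge> 1 \<Longrightarrow> \<sigma>l n > real n"
proof -
  assume n: "n \<ge> 1"
  have "real n * 1 < real n * zs M" using n zs_gt_1[OF M] by (intro mult_strict_left_mono) auto
  moreover have "1 / bsc n > 0" using bsc_pos[OF n] by simp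
  ultimately show ?thesis unfolding \<sigma>l_def t0_def by linarith
qed

lemma sline_eq: "n \<ge> 1 \<Longrightarrow> of_real (t0 n) + Complex 1 y / of_real (bsc n) = Complex (\<sigma>l n) (y / bsc n)"
  using bsc_pos[of n] by (simp add: complex_eq_iff \<sigma>l_def Re_divide_of_real Im_divide_of_real)

lemma sline_notin: "n \<ge> 1 \<Longrightarrow> Complex (\<sigma>l n) u - of_nat n + 1 \<notin> \<real>\<^sub>\<le>\<^sub>0"
  using \<sigma>l_gt[of n] by (auto simp: complex_nonpos_Reals_iff)

definition "Qker n y = exp (LF n (of_real (t0 n)) - LF n (Complex (\<sigma>l n) (y / bsc n)))" for y :: real

text \<open>The normalization divides by the value at the saddle point, including the contribution
  of exp (b \<eta>). \<open>Ps\<close> carries the opposite factors; what survives in the product is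
  the exponential prefactor of the theorem.\<close>

definition "Qs n \<eta> = of_real (bsc n) * exp (LF n (of_real (t0 n))) * of_real (exp (bsc n * \<eta> * t0 n)) * Qfun n (\<sigma>l n) (X0 n * exp (bsc n * \<eta>))"
  for \<eta> :: real

lemma Qker_eq: "n \<ge> 1 \<Longrightarrow> Qker n y = exp (LF n (of_real (t0 n))) * (Ginv n (Complex (\<sigma>l n) (y / bsc n)) * exp (- Complex (\<sigma>l n) (y / bsc n) * of_real (ln (X0 n))))"
  unfolding exp_minus_LF[OF sline_notin, symmetric] by (simp add: Qker_def mult_exp_exp)

lemma Qker_measurable: "n \<ge> 1 \<Longrightarrow> Qker n \<in> borel_measurable borel"
proof -
  assume n: "n \<ge> 1"
  have c: "continuous_on UNIV (\<lambda>y. Complex (\<sigma>l n) (y / bsc n))"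
    by (rule continuous_on_compose2[OF continuous_on_Complex[of UNIV]]) (auto intro!: continuous_intros bsc_pos n less_imp_neq[symmetric])
  have "continuous_on UNIV (Qker n)"
    unfolding Qker_eq[OF n, abs_def]
    by (intro continuous_intros c continuous_on_compose2[OF Ginv_continuous c]) (use \<sigma>l_gt[OF n] in auto)
  then show ?thesis by (rule borel_measurable_continuous_onI)
qed

lemma norm_Qker_minus: "n \<ge> 1 \<Longrightarrow> norm (Qker n (- y)) = norm (Qker n y)"
proof -
  assume n: "n \<ge> 1"
  have "Complex (\<sigma>l n) (- y / bsc n) = cnj (Complex (\<sigma>l n) (y / bsc n))" by (simp add: complex_eq_iff)
  then have "norm (Ginv n (Complex (\<sigma>l n) (- y / bsc n))) = norm (Ginv n (Complex (\<sigma>l n) (y / bsc n)))"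
    by (metis cnj_Ginv complex_mod_cnj)
  then show ?thesis unfolding Qker_eq[OF n] norm_mult norm_exp_eq_Re by simp
qed

lemma Qs_eq:
  assumes n: "n \<ge> 1"
  shows "Qs n \<eta> = 1 / (2 * of_real pi) * (LBINT y. Qker n y * exp (- of_real \<eta> * Complex 1 y))"
proof -
  let ?b = "bsc n"
  have b: "?b > 0" using bsc_pos[OF n] .
  have X: "X0 n > 0" using X0_pos[OF n] .
  let ?f = "\<lambda>u. Ginv n (Complex (\<sigma>l n) u) * of_real (X0 n * exp (?b * \<eta>)) powr (- Complex (\<sigma>l n) u)"
  have "(LBINT u. ?f u) = \<bar>1 / ?b\<bar> *\<^sub>R (LBINT y. ?f (0 + 1 / ?b * y))"
    by (rule lborel_integral_real_affine) (use b in auto)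
  also have "\<dots> = of_real (1 / ?b) * (LBINT y. ?f (y / ?b))" using b by (simp add: scaleR_conv_of_real)
  finally have 1: "of_real ?b * (LBINT u. ?f u) = (LBINT y. ?f (y / ?b))" using b by simp
  have 2: "exp (LF n (of_real (t0 n))) * of_real (exp (?b * \<eta> * t0 n)) * ?f (y / ?b) = Qker n y * exp (- of_real \<eta> * Complex 1 y)" for y
  proof -
    let ?s = "Complex (\<sigma>l n) (y / ?b)"
    have "of_real (X0 n * exp (?b * \<eta>)) powr (- ?s) = exp (- ?s * of_real (ln (X0 n * exp (?b * \<eta>))))"
      using X by (simp add: powr_def flip: Ln_of_real of_real_mult)
    also have "ln (X0 n * exp (?b * \<eta>)) = ln (X0 n) + ?b * \<eta>" using X by (simp add: ln_mult)
    also have "exp (- ?s * of_real (ln (X0 n) + ?b * \<eta>)) = exp (- ?s * of_real (ln (X0 n))) * exp (- ?s * of_real (?b * \<eta>))"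
      by (simp add: mult_exp_exp algebra_simps)
    finally have p: "of_real (X0 n * exp (?b * \<eta>)) powr (- ?s) = exp (- ?s * of_real (ln (X0 n))) * exp (- ?s * of_real (?b * \<eta>))" .
    have "?s = of_real (t0 n) + Complex 1 y / of_real ?b" using sline_eq[OF n] by simp
    then have "?s * of_real (?b * \<eta>) = of_real (?b * \<eta> * t0 n) + of_real \<eta> * Complex 1 y"
      using b by (simp add: field_simps)
    then have "of_real (exp (?b * \<eta> * t0 n)) * exp (- ?s * of_real (?b * \<eta>)) = exp (- of_real \<eta> * Complex 1 y)"
      by (simp add: mult_exp_exp flip: exp_of_real)
    then show ?thesis unfolding Qker_eq[OF n] p by (simp add: mult_ac)
  qed
  have "Qs n \<eta> = 1 / (2 * of_real pi) * (exp (LF n (of_real (t0 n))) * of_real (exp (?b * \<eta> * t0 n)) * (of_real ?b * (LBINT u. ?f u)))"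
    by (simp add: Qs_def Qfun_def mult_ac)
  also have "\<dots> = 1 / (2 * of_real pi) * (LBINT y. exp (LF n (of_real (t0 n))) * of_real (exp (?b * \<eta> * t0 n)) * ?f (y / ?b))"
    unfolding 1 by (simp only: integral_mult_right_zero)
  finally show ?thesis unfolding 2 .
qed

text \<open>Put z = zs + h and \<tau> = y h with h = \<open>hsc n\<close>. Up to \<tau> = 1 the
  decay exponent is of order n h \<tau>^2 = n h^3 y^2, where n h^3 is constant; above it is of order
  n \<tau>. Both give exp (- c |y|) uniformly in n. The value at y = 0 is controlled by
  \<open>saddle_cubic_limit\<close>.\<close>

lemma Qker_decay:
  obtains C c N where "C > 0" "c > 0" "N \<ge> (1::nat)" "\<And>n y. n \<ge> N \<Longrightarrow> norm (Qker n y) \<le> C * exp (- c * \<bar>y\<bar>)"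
proof -
  have z1: "zs M > 1" using zs_gt_1[OF M] .
  obtain C N1 where CN: "C > 0" "N1 \<ge> (1::nat)"
    "\<And>n t. n \<ge> N1 \<Longrightarrow> Re t \<ge> -1 \<Longrightarrow> Re t \<ge> - 0 * cmod t \<Longrightarrow> Re (t - of_nat n) \<ge> - 0 * cmod (t - of_nat n) \<Longrightarrow>
       cmod t \<ge> (zs M - 1) * real n \<Longrightarrow> cmod (t - of_nat n) \<ge> (zs M - 1) * real n \<Longrightarrow>
       cmod (dLF n t - fp M (t / of_nat n)) \<le> C / real n \<and> t - of_nat n + 1 \<notin> \<real>\<^sub>\<le>\<^sub>0"
    using dLF_approx[of 0 "zs M - 1"] z1 by auto
  have near: "cmod (dLF n (of_nat n * Complex z \<tau>) - fp M (Complex z \<tau>)) \<le> C / real n \<and> of_nat n * Complex z \<tau> - of_nat n + 1 \<notin> \<real>\<^sub>\<le>\<^sub>0"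
    if n: "n \<ge> N1" and z: "z \<ge> zs M" for n z \<tau>
  proof -
    let ?t = "of_nat n * Complex z \<tau>"
    have n1: "real n > 0" using n CN by linarith
    have e1: "Re ?t = real n * z" by simp
    have e2: "Re (?t - of_nat n) = real n * (z - 1)" by (simp add: algebra_simps)
    have ge: "real n * (z - 1) \<ge> (zs M - 1) * real n" using z n1 by (simp add: mult.commute mult_left_mono)
    have ge0: "(zs M - 1) * real n \<ge> 0" using z1 by simp
    have e3: "real n * z = real n * (z - 1) + real n" by (simp add: algebra_simps)
    have "cmod (dLF n ?t - fp M (?t / of_nat n)) \<le> C / real n \<and> ?t - of_nat n + 1 \<notin> \<real>\<^sub>\<le>\<^sub>0"
    proof (rule CN(3)[OF n])
      show "cmod ?t \<ge> (zs M - 1) * real n" using complex_Re_le_cmod[of ?t] e1 e3 ge n1 by linarith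
      show "cmod (?t - of_nat n) \<ge> (zs M - 1) * real n" using complex_Re_le_cmod[of "?t - of_nat n"] e2 ge by linarith
      show "Re ?t \<ge> -1" using e1 e3 ge ge0 n1 by linarith
      have "Re ?t \<ge> 0" using e1 e3 ge ge0 n1 by linarith
      then show "Re ?t \<ge> - 0 * cmod ?t" by simp
      have "Re (?t - of_nat n) \<ge> 0" using e2 ge ge0 by linarith
      then show "Re (?t - of_nat n) \<ge> - 0 * cmod (?t - of_nat n)" by simp
    qed
    then show ?thesis using n1 by simp
  qed
  obtain c where c: "c > 0"
    "\<And>z \<tau>. zs M \<le> z \<Longrightarrow> z \<le> zs M + 1 \<Longrightarrow> 0 \<le> \<tau> \<Longrightarrow> \<tau> \<le> 1 \<Longrightarrow> Im (fp M (Complex z \<tau>)) \<le> - c * (z - zs M) * \<tau>"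
    "\<And>z \<tau>. zs M \<le> z \<Longrightarrow> z \<le> zs M + 1 \<Longrightarrow> 1 \<le> \<tau> \<Longrightarrow> Im (fp M (Complex z \<tau>)) \<le> - c"
    using Im_fp_vertical[OF M] by blast
  have "hsc \<longlonglongrightarrow> 0" unfolding hsc_def[abs_def] using acb(1) by real_asymp
  then have ev1: "eventually (\<lambda>n. hsc n < 1) sequentially" by (rule order_tendstoD) simp
  have "(\<lambda>n. norm (exp (- (LF n (of_real (t0 n) + 1 / of_real (bsc n)) - LF n (of_real (t0 n)))))) \<longlonglongrightarrow> norm (exp (- (- (1 ^ 3 / 3 :: complex))))"
    by (intro tendsto_intros saddle_cubic_limit)
  then have "eventually (\<lambda>n. norm (exp (- (LF n (of_real (t0 n) + 1 / of_real (bsc n)) - LF n (of_real (t0 n))))) < 2) sequentially"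
  proof (rule order_tendstoD)
    have "exp (1 / 3 :: real) < 2"
    proof -
      have "exp (1 / 3 :: real) \<le> 1 + 1 / 3 + (1 / 3)\<^sup>2" by (rule exp_bound) auto
      also have "\<dots> < 2" by (simp add: power2_eq_square)
      finally show ?thesis .
    qed
    then show "norm (exp (- (- (1 ^ 3 / 3 :: complex)))) < 2" by simp
  qed
  with ev1 have "eventually (\<lambda>n. hsc n < 1 \<and> norm (exp (- (LF n (of_real (t0 n) + 1 / of_real (bsc n)) - LF n (of_real (t0 n))))) < 2) sequentially"
    by eventually_elim auto
  then obtain N2 where N2: "\<And>n. n \<ge> N2 \<Longrightarrow> hsc n < 1" "\<And>n. n \<ge> N2 \<Longrightarrow> norm (exp (- (LF n (of_real (t0 n) + 1 / of_real (bsc n)) - LF n (of_real (t0 n))))) < 2"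
    by (auto simp: eventually_sequentially)
  \<comment> \<open>For n \<ge> 2 C / c, half of the decay rate c n absorbs the error C of the phase
    derivative above height 1.\<close>
  define N where "N = max (max N1 N2) (nat \<lceil>2 * C / c\<rceil> + 1)"
  define c1 where "c1 = min (c / acb ^ 3) (c / (2 * acb\<^sup>2))"
  define C1 where "C1 = C + c / (2 * acb ^ 3)"
  have c1: "c1 > 0" using c(1) acb(1) by (simp add: c1_def)
  have N: "N \<ge> 1" using CN by (auto simp: N_def)
  have pos: "norm (Qker n y) \<le> 2 * exp C1 * exp (- c1 * y)" if n: "n \<ge> N" and y: "y \<ge> 0" for n y
  proof -
    have n1: "n \<ge> 1" "n \<ge> N1" "n \<ge> N2" using n CN by (auto simp: N_def)
    have n0: "real n > 0" using n1 by simp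
    have nC: "C \<le> c / 2 * real n"
    proof -
      have "2 * C / c \<le> real n" using n real_nat_ceiling_ge[of "2 * C / c"] unfolding N_def by linarith
      then show ?thesis using c(1) by (simp add: field_simps)
    qed
    define h where "h = hsc n"
    note hh = hsc[OF n1(1), folded h_def]
    have h1: "h < 1" using N2(1)[OF n1(3)] by (simp add: h_def)
    define z where "z = zs M + h"
    have z: "zs M \<le> z" "z \<le> zs M + 1" "z - zs M = h" using hh(1) h1 by (auto simp: z_def)
    define G where "G = (\<lambda>\<tau>. Re (- 1 * LF n (0 + (of_nat n * of_real z) + of_real \<tau> * (of_nat n * \<i>))))"
    have te: "of_nat n * of_real z + of_real \<tau> * (of_nat n * \<i>) = of_nat n * Complex z \<tau>" for \<tau>
      by (simp add: complex_eq_iff)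
    have der: "(G has_real_derivative Re (- 1 * (dLF n (of_nat n * Complex z \<tau>) * (of_nat n * \<i>)))) (at \<tau>)" for \<tau>
      unfolding G_def using near[OF n1(2) z(1), of \<tau>]
      by (intro has_real_derivative_Re_line LF_has_field_derivative) (simp_all add: te LF_has_field_derivative)
    have dval: "Re (- 1 * (dLF n (of_nat n * Complex z \<tau>) * (of_nat n * \<i>))) \<le> real n * Im (fp M (Complex z \<tau>)) + C" for \<tau>
    proof -
      let ?d = "dLF n (of_nat n * Complex z \<tau>) - fp M (Complex z \<tau>)"
      have "Re (- 1 * (dLF n (of_nat n * Complex z \<tau>) * (of_nat n * \<i>))) = real n * Im (fp M (Complex z \<tau>)) + real n * Im ?d"
        by (simp add: algebra_simps)
      moreover have "Im ?d \<le> C / real n" using near[OF n1(2) z(1), of \<tau>] abs_Im_le_cmod[of ?d] by linarith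
      then have "real n * Im ?d \<le> C" using n0 by (simp add: field_simps)
      ultimately show ?thesis by linarith
    qed
    have small: "G \<tau> \<le> G 0 - c * real n * h * \<tau>\<^sup>2 / 2 + C * \<tau>" if t: "0 \<le> \<tau>" "\<tau> \<le> 1" for \<tau>
    proof (rule nonneg_derivative_imp_le[OF t(1) der, where g' = "\<lambda>\<tau>. - (c * real n * h * \<tau>) + C"])
      fix x assume x: "0 \<le> x" "x \<le> \<tau>"
      show "((\<lambda>\<tau>. G 0 - c * real n * h * \<tau>\<^sup>2 / 2 + C * \<tau>) has_real_derivative - (c * real n * h * x) + C) (at x)"
        by (auto intro!: derivative_eq_intros)
      have "real n * Im (fp M (Complex z x)) \<le> real n * (- c * h * x)"
        using c(2)[OF z(1,2), of x] x t n0 unfolding z(3) by (intro mult_left_mono) auto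
      also have "\<dots> = - (c * real n * h * x)" by simp
      finally show "Re (- 1 * (dLF n (of_nat n * Complex z x) * (of_nat n * \<i>))) \<le> - (c * real n * h * x) + C"
        using dval[of x] by linarith
    qed auto
    have large: "G \<tau> \<le> G 1 - c / 2 * real n * (\<tau> - 1)" if t: "1 \<le> \<tau>" for \<tau>
    proof -
      have "G (1 + (\<tau> - 1)) \<le> G 1 - c / 2 * real n * (\<tau> - 1)"
      proof (rule nonneg_derivative_imp_le[where f = "\<lambda>x. G (1 + x)" and g = "\<lambda>x. G 1 - c / 2 * real n * x"
             and f' = "\<lambda>x. Re (- 1 * (dLF n (of_nat n * Complex z (1 + x)) * (of_nat n * \<i>)))" and g' = "\<lambda>x. - (c / 2 * real n)"])
        fix x assume x: "0 \<le> x" "x \<le> \<tau> - 1"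
        show "((\<lambda>x. G (1 + x)) has_real_derivative Re (- 1 * (dLF n (of_nat n * Complex z (1 + x)) * (of_nat n * \<i>)))) (at x)"
        proof -
          have "((\<lambda>x. 1 + x) has_real_derivative 1) (at x)" by (auto intro!: derivative_eq_intros)
          from DERIV_chain2[where f = G and g = "\<lambda>x. 1 + x", OF der this] show ?thesis by simp
        qed
        show "((\<lambda>x. G 1 - c / 2 * real n * x) has_real_derivative - (c / 2 * real n)) (at x)"
          by (auto intro!: derivative_eq_intros)
        have "real n * Im (fp M (Complex z (1 + x))) \<le> real n * (- c)"
          using c(3)[OF z(1,2), of "1 + x"] x n0 by (intro mult_left_mono) auto
        then show "Re (- 1 * (dLF n (of_nat n * Complex z (1 + x)) * (of_nat n * \<i>))) \<le> - (c / 2 * real n)"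
          using dval[of "1 + x"] nC by (simp add: algebra_simps)
      qed (use t in auto)
      then show ?thesis by simp
    qed
    define \<tau> where "\<tau> = y * h"
    have \<tau>0: "\<tau> \<ge> 0" using y hh(1) by (simp add: \<tau>_def)
    have "G \<tau> \<le> G 0 + C1 - c1 * y"
    proof (cases "\<tau> \<le> 1")
      case True
      have "c * real n * h * \<tau>\<^sup>2 / 2 = c / 2 * (real n * h ^ 3) * y\<^sup>2"
        by (simp add: \<tau>_def power2_eq_square power3_eq_cube)
      also have "\<dots> = c / (2 * acb ^ 3) * y\<^sup>2" unfolding hh(2) by simp
      also have "\<dots> \<ge> c / (2 * acb ^ 3) * (2 * y - 1)"
      proof (intro mult_left_mono)
        have "0 \<le> (y - 1)\<^sup>2" by simp
        then show "2 * y - 1 \<le> y\<^sup>2" by (simp add: power2_diff)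
      qed (use c(1) acb(1) in auto)
      also have "c / (2 * acb ^ 3) * (2 * y - 1) = c / acb ^ 3 * y - c / (2 * acb ^ 3)" using acb(1) by (simp add: field_simps)
      finally have "c * real n * h * \<tau>\<^sup>2 / 2 \<ge> c / acb ^ 3 * y - c / (2 * acb ^ 3)" .
      moreover have "c1 * y \<le> c / acb ^ 3 * y" using y by (intro mult_right_mono) (auto simp: c1_def)
      moreover have "C * \<tau> \<le> C * 1" using True CN(1) by (intro mult_left_mono) auto
      ultimately show ?thesis using small[OF \<tau>0 True] unfolding C1_def by linarith
    next
      case False
      then have t1: "1 \<le> \<tau>" by simp
      \<comment> \<open>The extra factor h < 1 weakens the decay to the form in which it adds up
        with the decay reached at \<tau> = 1, giving c / 2 * n h^2 y.\<close>
      have "c / 2 * real n * (\<tau> - 1) \<ge> c / 2 * real n * (h * (\<tau> - 1))"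
        using c(1) h1 t1 hh(1) mult_right_mono[of h 1 "\<tau> - 1"] by (intro mult_left_mono) auto
      moreover have "c / 2 * real n * (h * (\<tau> - 1)) + c * real n * h * 1\<^sup>2 / 2 = c / 2 * (real n * h\<^sup>2) * y"
        by (simp add: \<tau>_def power2_eq_square algebra_simps diff_divide_distrib add_divide_distrib)
      moreover have "c / 2 * (1 / acb\<^sup>2) * y \<le> c / 2 * (real n * h\<^sup>2) * y"
        using hh(3) c(1) y by (intro mult_right_mono mult_left_mono) auto
      moreover have "c1 * y \<le> c / (2 * acb\<^sup>2) * y" using y by (intro mult_right_mono) (auto simp: c1_def)
      moreover have "c / 2 * (1 / acb\<^sup>2) * y = c / (2 * acb\<^sup>2) * y" by simp
      moreover have "C \<le> C1" using c(1) acb(1) by (simp add: C1_def)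
      ultimately show ?thesis using large[OF t1] small[of 1] by linarith
    qed
    then have e1: "exp (G \<tau> - G 0) \<le> exp (C1 - c1 * y)" by simp
    have s0: "of_nat n * Complex z 0 = of_real (t0 n) + 1 / of_real (bsc n)"
    proof -
      have "of_real (t0 n) + 1 / complex_of_real (bsc n) = of_real (t0 n + 1 / bsc n)" by simp
      also have "\<dots> = of_nat n * Complex z 0" unfolding hh(4) z_def t0_def by (simp add: complex_eq_iff algebra_simps)
      finally show ?thesis by simp
    qed
    have s1: "of_nat n * Complex z \<tau> = Complex (\<sigma>l n) (y / bsc n)"
    proof -
      have "y / bsc n = y * (1 / bsc n)" by simp
      then show ?thesis unfolding \<sigma>l_def hh(4) z_def t0_def \<tau>_def by (simp add: complex_eq_iff algebra_simps)
    qed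
    have G0: "G 0 = - Re (LF n (of_real (t0 n) + 1 / of_real (bsc n)))" and Gt: "G \<tau> = - Re (LF n (Complex (\<sigma>l n) (y / bsc n)))"
      unfolding G_def using te[of 0] te[of \<tau>] by (simp_all add: s0 s1)
    have "norm (Qker n y) = norm (exp (- (LF n (of_real (t0 n) + 1 / of_real (bsc n)) - LF n (of_real (t0 n))))) * exp (G \<tau> - G 0)"
      unfolding Qker_def norm_exp_eq_Re G0 Gt exp_add[symmetric] by (simp add: mult_exp_exp)
    also have "\<dots> \<le> 2 * exp (C1 - c1 * y)"
      using N2(2)[OF n1(3)] e1 by (intro mult_mono) auto
    also have "\<dots> = 2 * exp C1 * exp (- c1 * y)" by (simp add: mult_exp_exp)
    finally show ?thesis .
  qed
  show ?thesis
  proof (rule that[of "2 * exp C1" c1 N])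
    fix n y assume n: "n \<ge> N"
    then have n1: "n \<ge> 1" using N by simp
    show "norm (Qker n y) \<le> 2 * exp C1 * exp (- c1 * \<bar>y\<bar>)"
    proof (cases "y \<ge> 0")
      case False
      then show ?thesis using pos[OF n, of "- y"] norm_Qker_minus[OF n1, of y] by simp
    qed (use pos[OF n] in simp)
  qed (use c1 N in auto)
qed

lemma norm_exp_eta: "norm (exp (- of_real \<eta> * Complex 1 y)) = exp (- \<eta>)"
  by simp

lemma Qs_bound:
  obtains C N where "C \<ge> 0" "\<And>n \<eta>. n \<ge> N \<Longrightarrow> norm (Qs n \<eta>) \<le> C * exp (- \<eta>)"
proof -
  obtain C c N where D: "C > 0" "c > 0" "N \<ge> (1::nat)" "\<And>n y. n \<ge> N \<Longrightarrow> norm (Qker n y) \<le> C * exp (- c * \<bar>y\<bar>)"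
    using Qker_decay by blast
  let ?I = "LBINT y. C * exp (- c * \<bar>y\<bar>)"
  have int: "integrable lborel (\<lambda>y. C * exp (- c * \<bar>y\<bar>))"
    by (intro integrable_mult_right integrable_exp_neg_abs D)
  show ?thesis
  proof (rule that[of "?I / (2 * pi)" N])
    show "0 \<le> ?I / (2 * pi)" using D(1) by (intro divide_nonneg_nonneg Bochner_Integration.integral_nonneg) auto
    fix n \<eta> assume n: "n \<ge> N"
    then have n1: "n \<ge> 1" using D by simp
    have "norm (LBINT y. Qker n y * exp (- of_real \<eta> * Complex 1 y)) \<le> (LBINT y. exp (- \<eta>) * (C * exp (- c * \<bar>y\<bar>)))"
    proof (rule Bochner_Integration.integral_norm_bound_integral)
      show "integrable lborel (\<lambda>y. Qker n y * exp (- of_real \<eta> * Complex 1 y))"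
      proof (rule Bochner_Integration.integrable_bound[OF integrable_mult_right[OF int, of "exp (- \<eta>)"]])
        have "(\<lambda>y. exp (- of_real \<eta> * Complex 1 y)) \<in> borel_measurable borel"
          by (intro borel_measurable_continuous_onI continuous_intros continuous_on_Complex)
        then show "(\<lambda>y. Qker n y * exp (- of_real \<eta> * Complex 1 y)) \<in> borel_measurable lborel"
          using Qker_measurable[OF n1] by simp
        show "AE y in lborel. norm (Qker n y * exp (- of_real \<eta> * Complex 1 y)) \<le> norm (exp (- \<eta>) * (C * exp (- c * \<bar>y\<bar>)))"
          using D(4)[OF n] D(1) by (intro AE_I2) (simp add: norm_mult norm_exp_eta mult.commute mult_left_mono abs_mult)
      qed
      fix y show "norm (Qker n y * exp (- of_real \<eta> * Complex 1 y)) \<le> exp (- \<eta>) * (C * exp (- c * \<bar>y\<bar>))"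
        using D(4)[OF n] by (simp add: norm_mult norm_exp_eta mult.commute mult_left_mono)
    qed (intro integrable_mult_right int)
    also have "\<dots> = exp (- \<eta>) * ?I" by (rule integral_mult_right_zero)
    finally show "norm (Qs n \<eta>) \<le> ?I / (2 * pi) * exp (- \<eta>)"
      unfolding Qs_eq[OF n1] by (simp add: norm_mult norm_divide field_simps)
  qed
qed

lemma Qs_tendsto:
  assumes "E \<longlonglongrightarrow> \<eta>"
  shows "(\<lambda>n. Qs n (E n)) \<longlonglongrightarrow> Airy_Ai (of_real \<eta>)"
proof -
  obtain C c N where D: "C > 0" "c > 0" "N \<ge> (1::nat)" "\<And>n y. n \<ge> N \<Longrightarrow> norm (Qker n y) \<le> C * exp (- c * \<bar>y\<bar>)"
    using Qker_decay by blast
  obtain R where R: "\<And>n. norm (E n) \<le> R" using assms by (meson BseqE convergentI convergent_imp_Bseq)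
  have "(\<lambda>n. LBINT y. Qker (n + N) y * exp (- of_real (E (n + N)) * Complex 1 y)) \<longlonglongrightarrow> (LBINT y. airy_integrand 0 (of_real \<eta>) y)"
  proof (rule integral_dominated_convergence[where w = "\<lambda>y. exp R * (C * exp (- c * \<bar>y\<bar>))"])
    show "integrable lborel (\<lambda>y. exp R * (C * exp (- c * \<bar>y\<bar>)))"
      by (intro integrable_mult_right integrable_exp_neg_abs D)
    fix n
    have n1: "n + N \<ge> 1" using D by simp
    have "(\<lambda>y. exp (- of_real (E (n + N)) * Complex 1 y)) \<in> borel_measurable borel"
      by (intro borel_measurable_continuous_onI continuous_intros continuous_on_Complex)
    then show "(\<lambda>y. Qker (n + N) y * exp (- of_real (E (n + N)) * Complex 1 y)) \<in> borel_measurable lborel"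
      using Qker_measurable[OF n1] by simp
    show "AE y in lborel. norm (Qker (n + N) y * exp (- of_real (E (n + N)) * Complex 1 y)) \<le> exp R * (C * exp (- c * \<bar>y\<bar>))"
    proof (intro AE_I2)
      fix y
      have "exp (- E (n + N)) \<le> exp R" using R[of "n + N"] by simp
      then have "norm (Qker (n + N) y) * exp (- E (n + N)) \<le> (C * exp (- c * \<bar>y\<bar>)) * exp R"
        using D(4)[of "n + N" y] D(1) by (intro mult_mono) auto
      then show "norm (Qker (n + N) y * exp (- of_real (E (n + N)) * Complex 1 y)) \<le> exp R * (C * exp (- c * \<bar>y\<bar>))"
        by (simp add: norm_mult norm_exp_eta mult.commute)
    qed
  next
    show "AE y in lborel. (\<lambda>n. Qker (n + N) y * exp (- of_real (E (n + N)) * Complex 1 y)) \<longlonglongrightarrow> airy_integrand 0 (of_real \<eta>) y"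
    proof (intro AE_I2 LIMSEQ_ignore_initial_segment)
      fix y
      let ?v = "Complex 1 y"
      have "(\<lambda>n. exp (- (LF n (of_real (t0 n) + ?v / of_real (bsc n)) - LF n (of_real (t0 n)))) * exp (- of_real (E n) * ?v))
         \<longlonglongrightarrow> exp (- (- (?v ^ 3 / 3))) * exp (- of_real \<eta> * ?v)"
        by (intro tendsto_intros saddle_cubic_limit assms)
      also have "exp (- (- (?v ^ 3 / 3))) * exp (- of_real \<eta> * ?v) = airy_integrand 0 (of_real \<eta>) y"
        by (simp add: airy_integrand_def mult_exp_exp)
      finally show "(\<lambda>n. Qker n y * exp (- of_real (E n) * ?v)) \<longlonglongrightarrow> airy_integrand 0 (of_real \<eta>) y"
        by (rule Lim_transform_eventually) (use eventually_ge_at_top[of 1] in \<open>eventually_elim, simp add: Qker_def sline_eq\<close>)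
    qed
  qed auto
  then have "(\<lambda>n. 1 / (2 * of_real pi) * (LBINT y. Qker (n + N) y * exp (- of_real (E (n + N)) * Complex 1 y))) \<longlonglongrightarrow> 1 / (2 * of_real pi) * (LBINT y. airy_integrand 0 (of_real \<eta>) y)"
    by (rule tendsto_mult_left)
  moreover have "1 / (2 * of_real pi) * (LBINT y. Qker (n + N) y * exp (- of_real (E (n + N)) * Complex 1 y)) = Qs (n + N) (E (n + N))" for n
    using Qs_eq[of "n + N" "E (n + N)"] D(3) by simp
  ultimately have "(\<lambda>n. Qs (n + N) (E (n + N))) \<longlonglongrightarrow> Airy_Ai (of_real \<eta>)"
    by (simp add: Airy_Ai_eq_moment airy_moment_def)
  then show ?thesis by (rule LIMSEQ_offset)
qed

end

section \<open>Asymptotics of the polynomial\<close>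

lemma ray_integral_scale:
  assumes "c > 0"
  shows "ray_integral w f = of_real c * w * (LBINT y. indicator {0..} y *\<^sub>R f (of_real y * (of_real c * w)))"
proof -
  have "(LBINT r. indicator {0..} r *\<^sub>R f (of_real r * w)) = \<bar>c\<bar> *\<^sub>R (LBINT y. indicator {0..} (0 + c * y) *\<^sub>R f (of_real (0 + c * y) * w))"
    by (rule lborel_integral_real_affine) (use assms in auto)
  also have "(\<lambda>y. indicator {0..} (0 + c * y) *\<^sub>R f (of_real (0 + c * y) * w)) = (\<lambda>y. indicator {0..} y *\<^sub>R f (of_real y * (of_real c * w)))"
    using assms by (auto simp: fun_eq_iff indicator_def zero_le_mult_iff mult_ac)
  finally show ?thesis using assms
    by (simp add: ray_integral_def set_lebesgue_integral_def scaleR_conv_of_real mult_ac)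
qed

lemma contour_integral_ray_segment:
  assumes R: "R > 0" and c: "continuous_on (closed_segment p (p + of_real R * e)) f"
  shows "contour_integral (linepath p (p + of_real R * e)) f = e * (LBINT r. indicator {0..R} r *\<^sub>R f (p + of_real r * e))"
proof -
  let ?q = "p + of_real R * e"
  have img: "p + of_real r * e \<in> closed_segment p ?q" if "0 \<le> r" "r \<le> R" for r
    unfolding closed_segment_def using that R
    by (auto intro!: exI[of _ "r / R"] simp: algebra_simps scaleR_conv_of_real)
  have cont: "continuous_on {0..1} (\<lambda>x. f (p + of_real (R * x) * e))"
  proof (rule continuous_on_compose2[OF c])
    show "(\<lambda>x. p + of_real (R * x) * e) ` {0..1} \<subseteq> closed_segment p ?q"
    proof (intro image_subsetI)
      fix x :: real assume "x \<in> {0..1}"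
      then show "p + of_real (R * x) * e \<in> closed_segment p ?q"
        by (intro img) (use R in \<open>auto simp: mult_left_le\<close>)
    qed
  qed (auto intro!: continuous_intros)
  have "contour_integral (linepath p ?q) f = integral {0..1} (\<lambda>x. f (linepath p ?q x) * vector_derivative (linepath p ?q) (at x))"
    by (rule contour_integral_integral)
  also have "\<dots> = integral {0..1} (\<lambda>x. (of_real R * e) * f (p + of_real (R * x) * e))"
    by (intro integral_cong) (simp add: linepath_def vector_derivative_linepath_at scaleR_conv_of_real algebra_simps)
  also have "\<dots> = of_real R * e * integral {0..1} (\<lambda>x. f (p + of_real (R * x) * e))"
    by (rule integral_mult_right)
  also have "integral {0..1} (\<lambda>x. f (p + of_real (R * x) * e)) = (LBINT x. indicator {0..1} x *\<^sub>R f (p + of_real (R * x) * e))"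
    using set_borel_integral_eq_integral(2)[OF borel_integrable_atLeastAtMost'[OF cont]] by (simp add: set_lebesgue_integral_def)
  also have "of_real R * e * \<dots> = e * (R *\<^sub>R (LBINT x. indicator {0..1} x *\<^sub>R f (p + of_real (R * x) * e)))"
    by (simp add: scaleR_conv_of_real)
  also have "(\<lambda>x. indicator {0..1} x *\<^sub>R f (p + of_real (R * x) * e)) = (\<lambda>x. indicator {0..R} (0 + R * x) *\<^sub>R f (p + of_real (0 + R * x) * e))"
    using R by (auto simp: fun_eq_iff indicator_def zero_le_mult_iff mult_le_cancel_left1)
  also have "R *\<^sub>R (LBINT x. indicator {0..R} (0 + R * x) *\<^sub>R f (p + of_real (0 + R * x) * e)) = (LBINT r. indicator {0..R} r *\<^sub>R f (p + of_real r * e))"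
    using lborel_integral_real_affine[of R "\<lambda>r. indicator {0..R} r *\<^sub>R f (p + of_real r * e)" 0] R by simp
  finally show ?thesis .
qed

text \<open>The extreme direction of this region is that of its corner - K + s \<i>, whose cosine is
  - K / sqrt (K^2 + s^2).\<close>

lemma Re_ge_sector_of_Im:
  assumes "Im z \<ge> s" "s > 0" "Re z \<ge> - K" "K > 0"
  shows "Re z \<ge> - (K / sqrt (K\<^sup>2 + s\<^sup>2)) * cmod z"
proof (cases "Re z \<ge> 0")
  case True
  have "(K / sqrt (K\<^sup>2 + s\<^sup>2)) * cmod z \<ge> 0" using assms by simp
  then show ?thesis using True by linarith
next
  case False
  have "(Re z)\<^sup>2 \<le> K\<^sup>2" using False assms by (simp add: abs_le_square_iff[symmetric])
  moreover have "s\<^sup>2 \<le> (Im z)\<^sup>2" using assms by (intro power_mono) auto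
  ultimately have "(Re z)\<^sup>2 * s\<^sup>2 \<le> K\<^sup>2 * (Im z)\<^sup>2" by (intro mult_mono) auto
  then have "(- Re z * sqrt (K\<^sup>2 + s\<^sup>2))\<^sup>2 \<le> (K * cmod z)\<^sup>2"
    by (simp add: power_mult_distrib cmod_power2 algebra_simps)
  then have "- Re z * sqrt (K\<^sup>2 + s\<^sup>2) \<le> K * cmod z"
    by (rule power2_le_imp_le) (use assms in auto)
  moreover have "sqrt (K\<^sup>2 + s\<^sup>2) > 0" using assms by (simp add: add_pos_pos)
  ultimately have "- Re z \<le> K * cmod z / sqrt (K\<^sup>2 + s\<^sup>2)" by (simp add: pos_le_divide_eq)
  then show ?thesis by simp
qed

section \<open>The contour of the polynomial\<close>

context truncated_product
begin

text \<open>The ratio of the integrand to its saddle value. It agrees with exp (LF t - LF t0) off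
  the cut but is defined through \<open>Fac\<close>, so it is also available where the contour
  crosses the cut of \<open>LF\<close>.\<close>

definition "Dn n t = exp (- LF n (of_real (t0 n))) * (Fac n t * exp (t * of_real (ln (X0 n))))" for t :: complex

definition "Jn n \<xi> t = Dn n t * exp (of_real (bsc n * \<xi>) * (t - of_real (t0 n)))" for \<xi> :: real

definition "Ps n \<xi> = of_real (bsc n) * exp (- LF n (of_real (t0 n))) * of_real (exp (- bsc n * \<xi> * t0 n)) * Ppoly n (X0 n * exp (bsc n * \<xi>))"
  for \<xi> :: real

definition "ssc = 2 / (real M + 1)"

definition "tc n = of_real (t0 n) + of_real (real n * ssc) * (\<i> - 1)" for n :: nat

definition "lc n = Complex (-1/2) (real n * ssc)" for n :: nat

lemma ssc: "ssc > 0" "ssc \<le> 2 / 3" "zs M - ssc > 1 / 3"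
proof -
  show s: "ssc > 0" "ssc \<le> 2 / 3" using M by (auto simp: ssc_def field_simps)
  show "zs M - ssc > 1 / 3" using s zs_gt_1[OF M] by linarith
qed

lemma tc_eq: "tc n = Complex (real n * (zs M - ssc)) (real n * ssc)"
  by (simp add: tc_def t0_def complex_eq_iff algebra_simps)

lemma t0_gt: "n \<ge> 1 \<Longrightarrow> t0 n > real n"
  using zs_gt_1[OF M] by (simp add: t0_def)

lemma cnj_Fac: "cnj (Fac n t) = Fac n (cnj t)"
  by (simp add: Fac_def Phi_def cnj_Gamma cnj_rGamma)

lemma norm_Dn_cnj: "norm (Dn n (cnj t)) = norm (Dn n t)"
proof -
  have "norm (Fac n (cnj t)) = norm (Fac n t)" by (metis cnj_Fac complex_mod_cnj)
  then show ?thesis unfolding Dn_def norm_mult norm_exp_eq_Re by simp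
qed

lemma Dn_eq_exp: "t - of_nat n + 1 \<notin> \<real>\<^sub>\<le>\<^sub>0 \<Longrightarrow> Dn n t = exp (LF n t - LF n (of_real (t0 n)))"
  by (simp add: Dn_def exp_LF[symmetric] mult_exp_exp)

lemma Dn_holomorphic: "Dn n holomorphic_on {t. Re t > -1} - of_nat ` {..<n}"
  unfolding Dn_def Fac_def
  by (intro holomorphic_intros holomorphic_on_subset[OF Phi_holomorphic]) auto

lemma Jn_holomorphic: "Jn n \<xi> holomorphic_on {t. Re t > -1} - of_nat ` {..<n}"
  unfolding Jn_def by (intro holomorphic_intros Dn_holomorphic)

text \<open>The corners of the rectangle around the poles on the side of the saddle point are cut off along
  the segments from the saddle point to \<open>tc n\<close> and to its conjugate.\<close>

lemma Ps_eq_polygon: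
  assumes n: "n \<ge> 2"
  shows "Ps n \<xi> = of_real (bsc n) / (2 * of_real pi * \<i>) *
    (contour_integral (linepath (of_real (t0 n)) (tc n)) (Jn n \<xi>)
     - contour_integral (linepath (of_real (t0 n)) (cnj (tc n))) (Jn n \<xi>)
     + contour_integral (linepath (tc n) (lc n)) (Jn n \<xi>)
     + contour_integral (linepath (lc n) (cnj (lc n))) (Jn n \<xi>)
     + contour_integral (linepath (cnj (lc n)) (cnj (tc n))) (Jn n \<xi>))"
proof -
  let ?J = "Jn n \<xi>" and ?T = "{t. Re t > -1} - of_nat ` {..<n} :: complex set"
  define Y where "Y = real n * ssc"
  have Y: "Y > 0" using n ssc by (simp add: Y_def)
  have t0n: "t0 n > real n" using t0_gt n by simp
  define p where "p = complex_of_real (t0 n)"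
  define a1 a2 a3 a4 where "a1 = Complex (-1/2) (-Y)" and "a2 = Complex (t0 n) (-Y)" and "a3 = Complex (t0 n) Y" and "a4 = Complex (-1/2) Y"
  have ac: "cnj a4 = a1" "cnj a3 = a2" "lc n = a4" by (simp_all add: a1_def a2_def a3_def a4_def lc_def Y_def complex_eq_iff)
  have tcR: "Re (tc n) = t0 n - Y" "Im (tc n) = Y" "t0 n - Y > 0"
  proof -
    show "Re (tc n) = t0 n - Y" "Im (tc n) = Y" by (simp_all add: tc_def Y_def)
    have "real n * (zs M - ssc) > 0" using n ssc by (intro mult_pos_pos) auto
    then show "t0 n - Y > 0" by (simp add: t0_def Y_def algebra_simps)
  qed
  have cT: "continuous_on ?T ?J" by (intro holomorphic_on_imp_continuous_on Jn_holomorphic)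
  have int: "?J contour_integrable_on linepath u v" if "closed_segment u v \<subseteq> ?T" for u v
    by (intro contour_integrable_continuous_linepath continuous_on_subset[OF cT] that)
  have T_Im: "t \<in> ?T" if "Re t > -1" "Im t \<noteq> 0" for t using that by auto
  have T_Re: "t \<in> ?T" if "Re t > -1" "Re t < 0 \<or> Re t > real n - 1" for t
    using that by (auto simp: nat_less_real_le)
  have seg_ge: "closed_segment u v \<subseteq> {t. Re t > -1}" if "Re u \<ge> -1/2" "Re v \<ge> -1/2" for u v
    by (intro closed_segment_subset convex_halfspace_Re_gt) (use that in auto)
  have s12: "closed_segment u v \<subseteq> ?T" if "Im u = Im v" "Im u \<noteq> 0" "Re u \<ge> -1/2" "Re v \<ge> -1/2" for u v
  proof
    fix t assume t: "t \<in> closed_segment u v"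
    have "Im t = Im u" using t that by (auto simp: closed_segment_same_Im)
    then show "t \<in> ?T" using seg_ge[of u v] t that by (intro T_Im) auto
  qed
  have s23: "closed_segment u v \<subseteq> ?T" if "Re u = Re v" "(Re u > -1 \<and> Re u < 0) \<or> Re u > real n - 1" for u v
  proof
    fix t assume t: "t \<in> closed_segment u v"
    have "Re t = Re u" using t that by (auto simp: closed_segment_same_Re)
    then show "t \<in> ?T" using that n by (intro T_Re) auto
  qed
  \<comment> \<open>The triangle lies in Re t + d Im t \<ge> t0 > n, so it meets the real axis only
    to the right of all poles.\<close>
  have hull: "convex hull {p, Complex (t0 n) (d * Y), Complex (t0 n - Y) (d * Y)} \<subseteq> ?T" if d: "d = 1 \<or> d = -1" for d :: real
  proof -
    have "convex hull {p, Complex (t0 n) (d * Y), Complex (t0 n - Y) (d * Y)} \<subseteq> {t. Re t > 0} \<inter> {t. inner (Complex 1 d) t \<ge> t0 n}"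
      by (intro hull_minimal convex_Int convex_halfspace_Re_gt convex_halfspace_ge)
         (use d Y tcR t0n n in \<open>auto simp: p_def inner_complex_def\<close>)
    also have "\<dots> \<subseteq> ?T"
      using t0n by (auto simp: inner_complex_def)
    finally show ?thesis .
  qed
  have tri: "contour_integral (linepath p (Complex (t0 n) (d * Y))) ?J + contour_integral (linepath (Complex (t0 n) (d * Y)) (Complex (t0 n - Y) (d * Y))) ?J
     + contour_integral (linepath (Complex (t0 n - Y) (d * Y)) p) ?J = 0" if d: "d = 1 \<or> d = -1" for d :: real
  proof -
    let ?b = "Complex (t0 n) (d * Y)" and ?c = "Complex (t0 n - Y) (d * Y)"
    have "(?J has_contour_integral 0) (linepath p ?b +++ linepath ?b ?c +++ linepath ?c p)"
      by (intro Cauchy_theorem_triangle holomorphic_on_subset[OF Jn_holomorphic] hull d)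
    moreover have "closed_segment p ?b \<subseteq> ?T" "closed_segment ?b ?c \<subseteq> ?T" "closed_segment ?c p \<subseteq> ?T"
      by (rule order_trans[OF _ hull[OF d]], simp add: segment_convex_hull hull_mono)+
    ultimately show ?thesis
      using int by (auto dest!: contour_integral_unique simp: contour_integrable_joinI valid_path_join add.assoc)
  qed
  have b3: "Complex (t0 n) (1 * Y) = a3" "Complex (t0 n - Y) (1 * Y) = tc n" "Complex (t0 n) (- 1 * Y) = a2" "Complex (t0 n - Y) (- 1 * Y) = cnj (tc n)"
    using tcR by (simp_all add: a3_def a2_def complex_eq_iff)
  note tri3 = tri[of 1, unfolded b3] and tri2 = tri[of "-1", unfolded b3]
  have rect: "contour_integral (rectpath a1 a3) ?J = contour_integral (linepath a1 a2) ?J + contour_integral (linepath a2 a3) ?J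
     + contour_integral (linepath a3 a4) ?J + contour_integral (linepath a4 a1) ?J"
  proof -
    have e: "rectpath a1 a3 = linepath a1 a2 +++ linepath a2 a3 +++ linepath a3 a4 +++ linepath a4 a1"
      by (simp add: rectpath_def Let_def a1_def a2_def a3_def a4_def)
    have "closed_segment a1 a2 \<subseteq> ?T" by (rule s12) (use Y t0n in \<open>auto simp: a1_def a2_def\<close>)
    moreover have "closed_segment a2 a3 \<subseteq> ?T" by (rule s23) (use Y t0n in \<open>auto simp: a2_def a3_def\<close>)
    moreover have "closed_segment a3 a4 \<subseteq> ?T" by (rule s12) (use Y t0n in \<open>auto simp: a3_def a4_def\<close>)
    moreover have "closed_segment a4 a1 \<subseteq> ?T" by (rule s23) (auto simp: a4_def a1_def)
    ultimately show ?thesis unfolding e by (simp add: int contour_integrable_joinI valid_path_join add.assoc)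
  qed
  have sp1: "contour_integral (linepath a1 a2) ?J = contour_integral (linepath a1 (cnj (tc n))) ?J + contour_integral (linepath (cnj (tc n)) a2) ?J"
  proof (rule contour_integral_split_linepath)
    show "continuous_on (closed_segment a1 a2) ?J"
      by (intro continuous_on_subset[OF cT] s12) (use Y t0n in \<open>auto simp: a1_def a2_def\<close>)
    show "cnj (tc n) \<in> closed_segment a1 a2"
      using tcR Y by (simp add: a1_def a2_def closed_segment_same_Im closed_segment_eq_real_ivl)
  qed
  have sp2: "contour_integral (linepath a3 a4) ?J = contour_integral (linepath a3 (tc n)) ?J + contour_integral (linepath (tc n) a4) ?J"
  proof (rule contour_integral_split_linepath)
    show "continuous_on (closed_segment a3 a4) ?J"
      by (intro continuous_on_subset[OF cT] s12) (use Y t0n in \<open>auto simp: a3_def a4_def\<close>)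
    show "tc n \<in> closed_segment a3 a4"
      using tcR Y by (simp add: a3_def a4_def closed_segment_same_Im closed_segment_eq_real_ivl)
  qed
  have sp3: "contour_integral (linepath a2 a3) ?J = contour_integral (linepath a2 p) ?J + contour_integral (linepath p a3) ?J"
  proof (rule contour_integral_split_linepath)
    show "continuous_on (closed_segment a2 a3) ?J"
      by (intro continuous_on_subset[OF cT] s23) (use Y t0n n in \<open>auto simp: a2_def a3_def\<close>)
    show "p \<in> closed_segment a2 a3"
      using Y by (simp add: a2_def a3_def p_def closed_segment_same_Re closed_segment_eq_real_ivl)
  qed
  have rev: "contour_integral (linepath u v) ?J = - contour_integral (linepath v u) ?J" for u v
    using contour_integral_reversepath[of "linepath v u" ?J] by simp
  have total: "contour_integral (rectpath a1 a3) ?J = contour_integral (linepath p (tc n)) ?J - contour_integral (linepath p (cnj (tc n))) ?J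
     + contour_integral (linepath (tc n) a4) ?J + contour_integral (linepath a4 a1) ?J + contour_integral (linepath a1 (cnj (tc n))) ?J"
    unfolding rect sp1 sp2 sp3 rev[of a2 p] rev[of "cnj (tc n)" a2]
    using tri3 tri2 unfolding rev[of "tc n" p] rev[of "cnj (tc n)" p] by (simp add: algebra_simps)
  let ?h = "\<lambda>t. exp (- LF n (of_real (t0 n))) * (exp (t * of_real (ln (X0 n))) * exp (of_real (bsc n * \<xi>) * (t - of_real (t0 n))))"
  have "?J = (\<lambda>t. Fac n t * ?h t)" by (auto simp: fun_eq_iff Jn_def Dn_def)
  then have "contour_integral (rectpath a1 a3) ?J = contour_integral (rectpath a1 a3) (\<lambda>t. Fac n t * ?h t)" by simp
  also have "\<dots> = 2 * of_real pi * \<i> * (\<Sum>k<n. coef n k * ?h (of_nat k))"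
  proof (rule contour_integral_Fac[where c = "-1"])
    show "path_image (rectpath a1 a3) \<subseteq> {t. - 1 < Re t} - of_nat ` {..<n}"
      using Y t0n n by (subst path_image_rectpath_cbox_minus_box) (auto simp: a1_def a3_def in_box_complex_iff in_cbox_complex_iff)
    show "winding_number (rectpath a1 a3) (of_nat k) = 1" if "k < n" for k
      using Y t0n that by (intro winding_number_rectpath) (auto simp: a1_def a3_def in_box_complex_iff)
  qed (auto intro!: holomorphic_intros)
  also have "(\<Sum>k<n. coef n k * ?h (of_nat k)) = exp (- LF n (of_real (t0 n))) * of_real (exp (- bsc n * \<xi> * t0 n)) * Ppoly n (X0 n * exp (bsc n * \<xi>))"
  proof -
    have "?h (of_nat k) = exp (- LF n (of_real (t0 n))) * of_real (exp (- bsc n * \<xi> * t0 n)) * of_real (X0 n * exp (bsc n * \<xi>)) ^ k" for k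
    proof -
      have X: "X0 n > 0" using X0_pos n by simp
      have "X0 n * exp (bsc n * \<xi>) = exp (ln (X0 n) + bsc n * \<xi>)" using X by (simp add: exp_add)
      then have "of_real (X0 n * exp (bsc n * \<xi>)) ^ k = exp (of_nat k * of_real (ln (X0 n) + bsc n * \<xi>) :: complex)"
        by (simp only: exp_of_real[symmetric] exp_of_nat_mult)
      then show ?thesis by (simp add: mult_exp_exp algebra_simps flip: exp_of_real)
    qed
    then show ?thesis by (simp add: Ppoly_def sum_distrib_left mult_ac)
  qed
  finally have "2 * of_real pi * \<i> * (exp (- LF n (of_real (t0 n))) * of_real (exp (- bsc n * \<xi> * t0 n)) * Ppoly n (X0 n * exp (bsc n * \<xi>))) = contour_integral (rectpath a1 a3) ?J" by simp
  then have "Ps n \<xi> = of_real (bsc n) / (2 * of_real pi * \<i>) * contour_integral (rectpath a1 a3) ?J"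
    by (simp add: Ps_def field_simps)
  then show ?thesis unfolding total ac by (simp add: p_def)
qed

text \<open>The derivative of Re LF along the segment is n times the bound of
  \<open>fp_segment\<close> plus an error of at most 2 C; integration turns - c u^2 into - c n u^3 /
  3.\<close>

lemma Dn_segment_decay:
  obtains C c N where "C > 0" "c > 0" "N \<ge> (2::nat)"
    "\<And>n u. n \<ge> N \<Longrightarrow> 0 \<le> u \<Longrightarrow> u \<le> ssc \<Longrightarrow> norm (Dn n (of_real (t0 n) + of_real (real n * u) * (\<i> - 1))) \<le> C * exp (- c * real n * u ^ 3)"
    "\<And>n u. n \<ge> N \<Longrightarrow> 0 \<le> u \<Longrightarrow> u \<le> ssc \<Longrightarrow> of_real (t0 n) + of_real (real n * u) * (\<i> - 1) - of_nat n + 1 \<notin> \<real>\<^sub>\<le>\<^sub>0"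
proof -
  define z where "z = zs M"
  have z1: "z > 1" using zs_gt_1[OF M] by (simp add: z_def)
  \<comment> \<open>Points of the scaled segment satisfy Re + Im = z, so their distance from 1 is at
    least (z - 1) / sqrt 2. Seen from 0 and from 1 they have Im \<ge> 0 and Re \<ge> - Im, which
    gives the sector constant 1 / sqrt 2.\<close>
  define c0 where "c0 = (z - 1) / sqrt 2"
  have c0: "c0 > 0" using z1 by (simp add: c0_def)
  have b: "0 \<le> 1 / sqrt 2" "1 / sqrt 2 < (1::real)" by auto
  obtain C N where CN: "C > 0" "N \<ge> (1::nat)"
    "\<And>n t. n \<ge> N \<Longrightarrow> Re t \<ge> -1 \<Longrightarrow> Re t \<ge> - (1 / sqrt 2) * cmod t \<Longrightarrow> Re (t - of_nat n) \<ge> - (1 / sqrt 2) * cmod (t - of_nat n) \<Longrightarrow>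
       cmod t \<ge> c0 * real n \<Longrightarrow> cmod (t - of_nat n) \<ge> c0 * real n \<Longrightarrow>
       cmod (dLF n t - fp M (t / of_nat n)) \<le> C / real n \<and> t - of_nat n + 1 \<notin> \<real>\<^sub>\<le>\<^sub>0"
    using dLF_approx[OF b c0] by blast
  let ?\<zeta> = "\<lambda>u. of_real z + of_real u * (\<i> - 1) :: complex"
  have near: "cmod (dLF n (of_nat n * ?\<zeta> u) - fp M (?\<zeta> u)) \<le> C / real n \<and> of_nat n * ?\<zeta> u - of_nat n + 1 \<notin> \<real>\<^sub>\<le>\<^sub>0"
    if n: "n \<ge> N" and u: "0 \<le> u" "u \<le> ssc" for n u
  proof -
    let ?t = "of_nat n * ?\<zeta> u"
    have n1: "real n > 0" using n CN by linarith
    have zu: "z - u > 0" using ssc(3) u by (simp add: z_def)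
    have sector: "Re w \<ge> - (1 / sqrt 2) * cmod w" if "Re w \<ge> - Im w" "Im w \<ge> 0" for w :: complex
    proof (cases "Re w \<ge> 0")
      case True
      have "(1 / sqrt 2) * cmod w \<ge> 0" by simp
      then show ?thesis using True by linarith
    next
      case False
      have "(Re w)\<^sup>2 \<le> (Im w)\<^sup>2" using that False by (simp add: abs_le_square_iff[symmetric])
      then have "(- Re w * sqrt 2)\<^sup>2 \<le> (cmod w)\<^sup>2" by (simp add: power_mult_distrib cmod_power2)
      then have "- Re w * sqrt 2 \<le> cmod w" by (rule power2_le_imp_le) simp
      then show ?thesis by (simp add: field_simps)
    qed
    have modge: "cmod w \<ge> (Re w + Im w) / sqrt 2" for w :: complex
    proof -
      have "0 \<le> (Re w - Im w)\<^sup>2" by simp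
      then have "(Re w + Im w)\<^sup>2 \<le> (cmod w * sqrt 2)\<^sup>2"
        by (simp add: power_mult_distrib cmod_power2 power2_sum power2_diff)
      then have "Re w + Im w \<le> cmod w * sqrt 2" by (rule power2_le_imp_le) simp
      then show ?thesis by (simp add: pos_divide_le_eq)
    qed
    have R: "Re ?t = real n * (z - u)" "Im ?t = real n * u" "Re (?t - of_nat n) = real n * (z - 1) - real n * u" "Im (?t - of_nat n) = real n * u"
      by (simp_all add: algebra_simps)
    have nn: "real n * (z - u) \<ge> 0" "real n * u \<ge> 0" "real n * (z - 1) \<ge> 0" using zu u z1 n1 by auto
    have "cmod (dLF n ?t - fp M (?t / of_nat n)) \<le> C / real n \<and> ?t - of_nat n + 1 \<notin> \<real>\<^sub>\<le>\<^sub>0"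
    proof (rule CN(3)[OF n])
      have aux: "-1 \<le> p" "- q \<le> p" "- q \<le> p - q" if "0 \<le> p" "0 \<le> q" for p q :: real
        using that by linarith+
      show "Re ?t \<ge> -1" unfolding R by (rule aux(1)[OF nn(1,2)])
      show "Re ?t \<ge> - (1 / sqrt 2) * cmod ?t"
        by (rule sector) (unfold R, rule aux(2)[OF nn(1,2)], rule nn(2))
      show "Re (?t - of_nat n) \<ge> - (1 / sqrt 2) * cmod (?t - of_nat n)"
        by (rule sector) (unfold R, rule aux(3)[OF nn(3,2)], rule nn(2))
      have "c0 * real n = (real n * (z - 1)) / sqrt 2" by (simp add: c0_def)
      also have "\<dots> = (Re (?t - of_nat n) + Im (?t - of_nat n)) / sqrt 2" unfolding R by simp
      finally show 1: "cmod (?t - of_nat n) \<ge> c0 * real n" using modge[of "?t - of_nat n"] by simp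
      have "c0 * real n \<le> (Re ?t + Im ?t) / sqrt 2"
        unfolding R c0_def using n1 by (simp add: divide_right_mono algebra_simps)
      then show "cmod ?t \<ge> c0 * real n" using modge[of ?t] by (rule order_trans)
    qed
    then show ?thesis using n1 by simp
  qed
  obtain c where c: "c > 0" "\<And>u. 0 \<le> u \<Longrightarrow> u \<le> 2 / (real M + 1) \<Longrightarrow> Re ((\<i> - 1) * fp M (of_real (zs M) + of_real u * (\<i> - 1))) \<le> - c * u\<^sup>2"
    using fp_segment[OF M] by blast
  have pt: "of_real (t0 n) + of_real (real n * u) * (\<i> - 1) = of_nat n * ?\<zeta> u" for n u
    by (simp add: t0_def z_def algebra_simps)
  show ?thesis
  proof (rule that[of "exp (2 * C)" "c / 3" "max N 2"])
    fix n u assume n: "n \<ge> max N 2" and u: "0 \<le> u" "u \<le> ssc"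
    then have n1: "n \<ge> N" by simp
    have n0: "real n > 0" using n by linarith
    show "of_real (t0 n) + of_real (real n * u) * (\<i> - 1) - of_nat n + 1 \<notin> \<real>\<^sub>\<le>\<^sub>0"
      using near[OF n1 u] unfolding pt by blast
    define G where "G = (\<lambda>x. Re (1 * LF n (of_real (t0 n) + of_real x * (of_nat n * (\<i> - 1)))))"
    have te: "of_real (t0 n) + of_real x * (of_nat n * (\<i> - 1)) = of_nat n * ?\<zeta> x" for x
      using pt[of n x] by (simp add: mult_ac)
    have le: "G u \<le> G 0 - c * real n * u ^ 3 / 3 + 2 * C * u"
    proof (rule nonneg_derivative_imp_le[OF u(1), where f' = "\<lambda>x. Re (1 * (dLF n (of_nat n * ?\<zeta> x) * (of_nat n * (\<i> - 1))))"
        and g' = "\<lambda>x. - c * real n * x\<^sup>2 + 2 * C"])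
      fix x assume x: "0 \<le> x" "x \<le> u"
      then have x2: "x \<le> ssc" using u by linarith
      note nx = near[OF n1 x(1) x2]
      show "(G has_real_derivative Re (1 * (dLF n (of_nat n * ?\<zeta> x) * (of_nat n * (\<i> - 1))))) (at x)"
        unfolding G_def te[symmetric] by (intro has_real_derivative_Re_line LF_has_field_derivative) (use nx in \<open>simp only: te not_False_eq_True\<close>)
      show "((\<lambda>u. G 0 - c * real n * u ^ 3 / 3 + 2 * C * u) has_real_derivative - c * real n * x\<^sup>2 + 2 * C) (at x)"
        by (auto intro!: derivative_eq_intros)
      let ?d = "dLF n (of_nat n * ?\<zeta> x) - fp M (?\<zeta> x)"
      have *: "1 * (dLF n (of_nat n * ?\<zeta> x) * (of_nat n * (\<i> - 1))) = of_real (real n) * ((\<i> - 1) * fp M (?\<zeta> x)) + of_real (real n) * ((\<i> - 1) * ?d)"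
        by (simp add: algebra_simps)
      have "Re (1 * (dLF n (of_nat n * ?\<zeta> x) * (of_nat n * (\<i> - 1)))) = real n * Re ((\<i> - 1) * fp M (?\<zeta> x)) + real n * Re ((\<i> - 1) * ?d)"
      proof -
        have "Re (of_real p * v + of_real p * w) = p * Re v + p * Re w" for p v w by simp
        then show ?thesis unfolding * .
      qed
      moreover have "real n * Re ((\<i> - 1) * fp M (?\<zeta> x)) \<le> real n * (- c * x\<^sup>2)"
        using c(2)[OF x(1)] x2 n0 unfolding ssc_def z_def by (intro mult_left_mono) auto
      moreover have "real n * Re ((\<i> - 1) * ?d) \<le> 2 * C"
      proof -
        have "cmod (\<i> - 1) \<le> 2" using norm_triangle_ineq4[of \<i> 1] by simp
        then have "cmod ((\<i> - 1) * ?d) \<le> 2 * (C / real n)"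
          unfolding norm_mult using nx by (intro mult_mono) auto
        then have "Re ((\<i> - 1) * ?d) \<le> 2 * (C / real n)" by (rule order_trans[OF complex_Re_le_cmod])
        then show ?thesis using n0 by (simp add: field_simps)
      qed
      ultimately show "Re (1 * (dLF n (of_nat n * ?\<zeta> x) * (of_nat n * (\<i> - 1)))) \<le> - c * real n * x\<^sup>2 + 2 * C"
        by (simp add: algebra_simps)
    qed auto
    have u1: "2 * C * u \<le> 2 * C * 1" using u ssc CN(1) by (intro mult_left_mono) auto
    have "norm (Dn n (of_nat n * ?\<zeta> u)) = exp (G u - G 0)"
      using Dn_eq_exp[of "of_nat n * ?\<zeta> u" n] near[OF n1 u] unfolding G_def te by (simp add: t0_def z_def)
    also have "\<dots> \<le> exp (2 * C + - (c / 3) * real n * u ^ 3)" using le u1 by simp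
    finally show "norm (Dn n (of_real (t0 n) + of_real (real n * u) * (\<i> - 1))) \<le> exp (2 * C) * exp (- (c / 3) * real n * u ^ 3)"
      unfolding pt by (simp add: mult_exp_exp)
  qed (use c in auto)
qed

text \<open>From x to the corner the main part of the derivative of Re LF is nonnegative by
  \<open>Re_fp_horizontal\<close>, and the error C / n accumulates over a length of order n to a
  constant. So the modulus is at most a constant times that at the corner, where the segment
  estimate with u = ssc is exponentially small.\<close>

lemma Dn_horizontal_decay:
  obtains C c N where "C > 0" "c > 0" "N \<ge> (2::nat)"
    "\<And>n x. n \<ge> N \<Longrightarrow> - 1 / 2 \<le> x \<Longrightarrow> x \<le> real n * (zs M - ssc) \<Longrightarrow> norm (Dn n (Complex x (real n * ssc))) \<le> C * exp (- c * real n)"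
proof -
  obtain C1 c1 N1 where S: "C1 > 0" "c1 > 0" "N1 \<ge> (2::nat)"
    "\<And>n u. n \<ge> N1 \<Longrightarrow> 0 \<le> u \<Longrightarrow> u \<le> ssc \<Longrightarrow> norm (Dn n (of_real (t0 n) + of_real (real n * u) * (\<i> - 1))) \<le> C1 * exp (- c1 * real n * u ^ 3)"
    by (rule Dn_segment_decay) blast
  \<comment> \<open>On this side Im t / n is ssc, and Re t / n and Re (t - n) / n are both at least
    -2.\<close>
  define \<beta> where "\<beta> = 2 / sqrt (2\<^sup>2 + ssc\<^sup>2)"
  have s0: "ssc > 0" using ssc by simp
  have b: "0 \<le> \<beta>" "\<beta> < 1"
  proof -
    have "2 < sqrt (2\<^sup>2 + ssc\<^sup>2)" using s0 by (intro real_less_rsqrt) auto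
    then show "\<beta> < 1" unfolding \<beta>_def by (subst divide_less_eq_1_pos) linarith+
    show "0 \<le> \<beta>" by (simp add: \<beta>_def)
  qed
  obtain C N where CN: "C > 0" "N \<ge> (1::nat)"
    "\<And>n t. n \<ge> N \<Longrightarrow> Re t \<ge> -1 \<Longrightarrow> Re t \<ge> - \<beta> * cmod t \<Longrightarrow> Re (t - of_nat n) \<ge> - \<beta> * cmod (t - of_nat n) \<Longrightarrow>
       cmod t \<ge> ssc * real n \<Longrightarrow> cmod (t - of_nat n) \<ge> ssc * real n \<Longrightarrow>
       cmod (dLF n t - fp M (t / of_nat n)) \<le> C / real n \<and> t - of_nat n + 1 \<notin> \<real>\<^sub>\<le>\<^sub>0"
    using dLF_approx[OF b s0] by blast
  show ?thesis
  proof (rule that[of "exp (C * (zs M + 1)) * C1" "c1 * ssc ^ 3" "max (max N N1) 2"])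
    fix n :: nat and x :: real
    assume n: "n \<ge> max (max N N1) 2" and x: "- 1 / 2 \<le> x" "x \<le> real n * (zs M - ssc)"
    then have n1: "n \<ge> N" "n \<ge> N1" "real n \<ge> 2" by auto
    define Y where "Y = real n * ssc"
    have Y: "Y > 0" using n1 s0 by (simp add: Y_def)
    have near: "cmod (dLF n (Complex v Y) - fp M (Complex (v / real n) ssc)) \<le> C / real n \<and> Complex v Y - of_nat n + 1 \<notin> \<real>\<^sub>\<le>\<^sub>0"
      if v: "- 1 / 2 \<le> v" for v
    proof -
      let ?t = "Complex v Y"
      have sec: "Re w \<ge> - \<beta> * cmod w" if "Im w \<ge> Y" "Re w \<ge> - 2 * real n" for w
      proof -
        have "Re (w / of_nat n) \<ge> - (2 / sqrt (2\<^sup>2 + ssc\<^sup>2)) * cmod (w / of_nat n)"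
        proof (rule Re_ge_sector_of_Im)
          show "ssc \<le> Im (w / of_nat n)" "- 2 \<le> Re (w / of_nat n)" using that n1 by (simp_all add: Y_def field_simps)
        qed (use s0 in auto)
        moreover have "Re (w / of_nat n) = Re w / real n" "cmod (w / of_nat n) = cmod w / real n"
          by (simp_all add: norm_divide)
        ultimately have "- \<beta> * (cmod w / real n) \<le> Re w / real n" unfolding \<beta>_def by (simp only:)
        then have "- \<beta> * cmod w / real n \<le> Re w / real n" by (simp only: times_divide_eq_right)
        moreover have "0 < real n" using n1 by linarith
        ultimately show ?thesis by (simp only: divide_le_cancel)
      qed
      have md: "ssc * real n \<le> cmod w" if "Im w \<ge> Y" for w
        using that abs_Im_le_cmod[of w] by (simp add: Y_def mult.commute)
      have "cmod (dLF n ?t - fp M (?t / of_nat n)) \<le> C / real n \<and> ?t - of_nat n + 1 \<notin> \<real>\<^sub>\<le>\<^sub>0"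
        by (rule CN(3)[OF n1(1)]; (intro sec md)?) (use v n1 in auto)
      moreover have "?t / of_nat n = Complex (v / real n) ssc" using n1 by (simp add: Y_def complex_eq_iff)
      ultimately show ?thesis by simp
    qed
    define B where "B = real n * (zs M - ssc)"
    define G where "G = (\<lambda>v. Re (1 * LF n (of_real x + \<i> * of_real Y + of_real v * 1)))"
    have te: "of_real x + \<i> * of_real Y + of_real v * 1 = Complex (x + v) Y" for v by (simp add: complex_eq_iff)
    have L: "0 \<le> B - x" using x by (simp add: B_def)
    have "(\<lambda>v. G 0 - C / real n * v) (B - x) \<le> G (B - x)"
    proof (rule nonneg_derivative_imp_le[OF L, where f' = "\<lambda>v. - (C / real n)" and g' = "\<lambda>v. Re (1 * (dLF n (Complex (x + v) Y) * 1))"])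
      fix v assume v: "0 \<le> v" "v \<le> B - x"
      then have xv: "- 1 / 2 \<le> x + v" using x by linarith
      note nx = near[OF xv]
      show "((\<lambda>v. G 0 - C / real n * v) has_real_derivative - (C / real n)) (at v)"
        using n1 by (auto intro!: derivative_eq_intros)
      show "(G has_real_derivative Re (1 * (dLF n (Complex (x + v) Y) * 1))) (at v)"
        unfolding G_def te[symmetric] by (intro has_real_derivative_Re_line LF_has_field_derivative) (use nx in \<open>simp only: te not_False_eq_True\<close>)
      have "\<bar>(x + v) / real n\<bar> \<le> zs M - ssc"
      proof -
        have "x + v \<le> B" using v by linarith
        then have "(x + v) / real n \<le> zs M - ssc" using n1 by (simp add: B_def field_simps)
        moreover have "- (zs M - ssc) \<le> - (1 / 3)" using ssc by linarith
        moreover have "- (1 / 3) \<le> (x + v) / real n" using xv n1 by (simp add: field_simps)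
        ultimately show ?thesis by linarith
      qed
      then have "0 \<le> Re (fp M (Complex ((x + v) / real n) ssc))" using Re_fp_horizontal[OF M] by (simp add: ssc_def)
      moreover have "\<bar>Re (dLF n (Complex (x + v) Y) - fp M (Complex ((x + v) / real n) ssc))\<bar> \<le> C / real n"
        by (rule order_trans[OF abs_Re_le_cmod]) (use nx in blast)
      ultimately show "- (C / real n) \<le> Re (1 * (dLF n (Complex (x + v) Y) * 1))" by simp
    qed simp
    then have le: "G 0 \<le> G (B - x) + C / real n * (B - x)" by simp
    have "B - x \<le> real n * (zs M + 1)"
    proof -
      have "B = real n * zs M - Y" "real n * (zs M + 1) = real n * zs M + real n"
        by (simp_all add: B_def Y_def algebra_simps)
      then show ?thesis using x Y n1 by linarith
    qed
    then have "C / real n * (B - x) \<le> C / real n * (real n * (zs M + 1))" using CN(1) n1 by (intro mult_left_mono) auto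
    then have le2: "G 0 - G (B - x) \<le> C * (zs M + 1)" using le n1 by simp
    have Bv: "- 1 / 2 \<le> B" using x by (simp add: B_def)
    have Dx: "norm (Dn n (Complex x Y)) = exp (G 0 - Re (LF n (of_real (t0 n))))"
      using Dn_eq_exp[of "Complex x Y" n] near[OF x(1)] unfolding G_def te by simp
    have DB: "norm (Dn n (Complex B Y)) = exp (G (B - x) - Re (LF n (of_real (t0 n))))"
      using Dn_eq_exp[of "Complex B Y" n] near[OF Bv] unfolding G_def te by simp
    have tcB: "of_real (t0 n) + of_real (real n * ssc) * (\<i> - 1) = Complex B Y" using tc_eq[of n] unfolding tc_def B_def Y_def .
    have "norm (Dn n (Complex x Y)) = exp (G 0 - G (B - x)) * norm (Dn n (Complex B Y))"
      unfolding Dx DB by (simp add: mult_exp_exp)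
    also have "\<dots> \<le> exp (C * (zs M + 1)) * (C1 * exp (- c1 * real n * ssc ^ 3))"
      using le2 S(4)[OF n1(2), of ssc] s0 unfolding tcB by (intro mult_mono) auto
    finally show "norm (Dn n (Complex x (real n * ssc))) \<le> exp (C * (zs M + 1)) * C1 * exp (- (c1 * ssc ^ 3) * real n)"
      unfolding Y_def by (simp add: mult_ac)
  qed (use S s0 in auto)
qed

section \<open>The left side and the negligible part of the contour\<close>

lemma norm_pochhammer_mono:
  fixes w z :: complex
  assumes "Re w = Re z" "\<bar>Im w\<bar> \<le> \<bar>Im z\<bar>"
  shows "norm (pochhammer w k) \<le> norm (pochhammer z k)"
proof -
  have "(Im w)\<^sup>2 \<le> (Im z)\<^sup>2" using assms(2) by (simp add: abs_le_square_iff)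
  then show ?thesis unfolding pochhammer_prod prod_norm[symmetric] using assms(1)
    by (intro prod_mono) (auto simp: cmod_def)
qed

text \<open>On the line \<open>Re t = - 1 / 2\<close> the reflection \<open>t - k \<mapsto> t + k + 1\<close> preserves absolute values.\<close>

lemma norm_Fac_left:
  fixes y :: real
  defines "t \<equiv> Complex (-1/2) y"
  shows "norm (Fac n t) = norm (pochhammer (t + of_nat n + 1) (\<kappa> - 1)) / norm (pochhammer (t + 1) (\<nu> 1)) *
    (\<Prod>j=2..M. norm (rGamma (t + of_nat (\<nu> j) + 1)))"
proof -
  have Ret: "Re t = - 1 / 2" by (simp add: t_def)
  have notint: "z \<notin> \<int>\<^sub>\<le>\<^sub>0" if "Re z > 0" for z :: complex using that by (rule Re_pos_not_nonpos_Int)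
  have g: "Gamma z \<noteq> 0" if "Re z > 0" for z :: complex using notint[OF that] by (simp add: Gamma_eq_zero_iff)
  have 1: "norm (\<Prod>k<n. t - of_nat k) = norm (pochhammer (t + 1) n)"
    unfolding pochhammer_prod prod_norm[symmetric] atLeast0LessThan
    by (intro prod.cong refl) (simp add: cmod_def t_def power2_eq_square algebra_simps)
  have 2: "pochhammer (t + 1) n = Gamma (t + of_nat n + 1) / Gamma (t + 1)"
    using pochhammer_Gamma[OF notint, of "t + 1" n] Ret by (simp add: add_ac)
  have 3: "Gamma (t + of_nat n + of_nat \<kappa>) = pochhammer (t + of_nat n + 1) (\<kappa> - 1) * Gamma (t + of_nat n + 1)"
  proof -
    have p: "pochhammer (t + of_nat n + 1) (\<kappa> - 1) = Gamma (t + of_nat n + 1 + of_nat (\<kappa> - 1)) / Gamma (t + of_nat n + 1)"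
      by (rule pochhammer_Gamma[OF notint]) (simp add: Ret)
    have e: "t + of_nat n + 1 + of_nat (\<kappa> - 1) = t + of_nat n + of_nat \<kappa>"
      using kappa by (simp add: of_nat_diff)
    show ?thesis using p g[of "t + of_nat n + 1"] Ret unfolding e by simp
  qed
  have 4: "rGamma (t + of_nat (\<nu> 1) + 1) = 1 / (pochhammer (t + 1) (\<nu> 1) * Gamma (t + 1))"
  proof -
    have "pochhammer (t + 1) (\<nu> 1) = Gamma (t + 1 + of_nat (\<nu> 1)) / Gamma (t + 1)"
      by (rule pochhammer_Gamma[OF notint]) (simp add: Ret)
    then have "pochhammer (t + 1) (\<nu> 1) * Gamma (t + 1) = Gamma (t + of_nat (\<nu> 1) + 1)"
      using g[of "t + 1"] Ret by (simp add: add_ac)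
    then show ?thesis by (simp add: rGamma_inverse_Gamma divide_inverse)
  qed
  have M2: "{1..M} = insert 1 {2..M}" using M by auto
  have G: "norm (Gamma (t + of_nat n + 1)) \<noteq> 0" "norm (Gamma (t + 1)) \<noteq> 0"
    using g[of "t + of_nat n + 1"] g[of "t + 1"] Ret by auto
  have "norm (Fac n t) = norm (Gamma (t + of_nat n + of_nat \<kappa>)) * (norm (rGamma (t + of_nat (\<nu> 1) + 1)) * (\<Prod>j=2..M. norm (rGamma (t + of_nat (\<nu> j) + 1)))) / norm (pochhammer (t + 1) n)"
    unfolding Fac_def Phi_def norm_divide 1 M2 by (simp add: norm_mult prod_norm)
  also have "\<dots> = norm (pochhammer (t + of_nat n + 1) (\<kappa> - 1)) / norm (pochhammer (t + 1) (\<nu> 1)) *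
    (\<Prod>j=2..M. norm (rGamma (t + of_nat (\<nu> j) + 1)))"
    unfolding 2 3 4 norm_mult norm_divide using G by (simp add: field_simps)
  finally show ?thesis .
qed

text \<open>The left side crosses the cut of \<open>LF\<close> at -1/2, where the Digamma estimate
  fails. In \<open>norm_Fac_left\<close> the numerator and the \<open>rGamma\<close> factors are
  largest at the largest |Im t|, that is at the corner; the Pochhammer symbol in the denominator
  works the other way and costs a factor polynomial in Y.\<close>

lemma norm_Dn_left:
  assumes y: "\<bar>y\<bar> \<le> Y"
  shows "norm (Dn n (Complex (-1/2) y)) \<le> (2 * (1 + real (\<nu> 1) + Y)) ^ \<nu> 1 * norm (Dn n (Complex (-1/2) Y))"
proof -
  let ?t = "Complex (-1/2) y" and ?s = "Complex (-1/2) Y"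
  have Y: "Y \<ge> 0" using y by linarith
  have yY: "\<bar>Im ?t\<bar> \<le> \<bar>Im ?s\<bar>" using y Y by simp
  define P where "P = (2 * (1 + real (\<nu> 1) + Y)) ^ \<nu> 1"
  have a: "norm (pochhammer (?t + of_nat n + 1) (\<kappa> - 1)) \<le> norm (pochhammer (?s + of_nat n + 1) (\<kappa> - 1))"
    by (rule norm_pochhammer_mono) (use yY in auto)
  have b: "(\<Prod>j=2..M. norm (rGamma (?t + of_nat (\<nu> j) + 1))) \<le> (\<Prod>j=2..M. norm (rGamma (?s + of_nat (\<nu> j) + 1)))"
  proof (intro prod_mono conjI)
    fix j
    have "norm (Gamma (?s + of_nat (\<nu> j) + 1)) \<le> norm (Gamma (?t + of_nat (\<nu> j) + 1))"
      by (rule norm_Gamma_mono) (use yY in auto)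
    moreover have "Gamma (?s + of_nat (\<nu> j) + 1) \<noteq> 0"
      using Re_pos_not_nonpos_Int[of "?s + of_nat (\<nu> j) + 1"] by (simp add: Gamma_eq_zero_iff)
    ultimately show "norm (rGamma (?t + of_nat (\<nu> j) + 1)) \<le> norm (rGamma (?s + of_nat (\<nu> j) + 1))"
      unfolding rGamma_inverse_Gamma norm_inverse by (intro le_imp_inverse_le) auto
  qed auto
  have c: "1 / norm (pochhammer (?t + 1) (\<nu> 1)) \<le> P / norm (pochhammer (?s + 1) (\<nu> 1))"
  proof -
    have lo: "(1 / 2) ^ \<nu> 1 \<le> norm (pochhammer (?t + 1) (\<nu> 1))"
    proof -
      have "(\<Prod>i<\<nu> 1. 1 / 2) \<le> (\<Prod>i<\<nu> 1. norm (?t + 1 + of_nat i))"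
      proof (intro prod_mono conjI)
        fix i have "1 / 2 \<le> Re (?t + 1 + of_nat i)" by simp
        then show "1 / 2 \<le> norm (?t + 1 + of_nat i)" using complex_Re_le_cmod order_trans by blast
      qed auto
      then show ?thesis by (simp add: pochhammer_prod prod_norm atLeast0LessThan)
    qed
    have up: "norm (pochhammer (?s + 1) (\<nu> 1)) \<le> (1 + real (\<nu> 1) + Y) ^ \<nu> 1"
    proof -
      have "(\<Prod>i<\<nu> 1. norm (?s + 1 + of_nat i)) \<le> (\<Prod>i<\<nu> 1. 1 + real (\<nu> 1) + Y)"
      proof (intro prod_mono conjI)
        fix i assume "i \<in> {..<\<nu> 1}"
        then have "real i \<le> real (\<nu> 1)" by simp
        moreover have "norm (?s + 1 + of_nat i) \<le> \<bar>Re (?s + 1 + of_nat i)\<bar> + \<bar>Im (?s + 1 + of_nat i)\<bar>" by (rule cmod_le)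
        ultimately show "norm (?s + 1 + of_nat i) \<le> 1 + real (\<nu> 1) + Y" using Y by simp
      qed auto
      then show ?thesis by (simp add: pochhammer_prod prod_norm atLeast0LessThan)
    qed
    have sp: "norm (pochhammer (?s + 1) (\<nu> 1)) > 0"
    proof -
      have "(0::real) < (1 / 2) ^ \<nu> 1" by simp
      also note lo
      also have "norm (pochhammer (?t + 1) (\<nu> 1)) \<le> norm (pochhammer (?s + 1) (\<nu> 1))"
        by (rule norm_pochhammer_mono) (use yY in auto)
      finally show ?thesis .
    qed
    have "1 / norm (pochhammer (?t + 1) (\<nu> 1)) \<le> 1 / ((1 / 2) ^ \<nu> 1)"
      by (rule frac_le[OF _ _ _ lo]) auto
    also have "\<dots> = P / (1 + real (\<nu> 1) + Y) ^ \<nu> 1"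
    proof -
      have "1 / ((1 / 2) ^ k) = (2 * q) ^ k / q ^ k" if "q > 0" for q :: real and k
        using that by (simp add: power_mult_distrib power_divide)
      moreover have "1 + real (\<nu> 1) + Y > 0" using Y by simp
      ultimately show ?thesis unfolding P_def by blast
    qed
    also have "\<dots> \<le> P / norm (pochhammer (?s + 1) (\<nu> 1))"
      using up sp Y by (intro divide_left_mono mult_pos_pos) (auto simp: P_def)
    finally show ?thesis .
  qed
  have "norm (Fac n ?t) \<le> norm (pochhammer (?s + of_nat n + 1) (\<kappa> - 1)) * (P / norm (pochhammer (?s + 1) (\<nu> 1))) *
    (\<Prod>j=2..M. norm (rGamma (?s + of_nat (\<nu> j) + 1)))"
  proof -
    have "norm (Fac n ?t) = norm (pochhammer (?t + of_nat n + 1) (\<kappa> - 1)) * (1 / norm (pochhammer (?t + 1) (\<nu> 1))) *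
      (\<Prod>j=2..M. norm (rGamma (?t + of_nat (\<nu> j) + 1)))" unfolding norm_Fac_left by simp
    also have "\<dots> \<le> norm (pochhammer (?s + of_nat n + 1) (\<kappa> - 1)) * (P / norm (pochhammer (?s + 1) (\<nu> 1))) *
      (\<Prod>j=2..M. norm (rGamma (?s + of_nat (\<nu> j) + 1)))"
      using Y by (intro mult_mono a b c mult_nonneg_nonneg prod_nonneg) (auto simp: P_def intro!: divide_nonneg_nonneg)
    finally show ?thesis .
  qed
  also have "\<dots> = P * norm (Fac n ?s)" unfolding norm_Fac_left by simp
  finally have "norm (Fac n ?t) \<le> P * norm (Fac n ?s)" .
  then have "norm (exp (- LF n (of_real (t0 n)))) * (norm (Fac n ?t) * exp (- 1 / 2 * ln (X0 n))) \<le>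
      norm (exp (- LF n (of_real (t0 n)))) * (P * norm (Fac n ?s) * exp (- 1 / 2 * ln (X0 n)))"
    by (intro mult_left_mono mult_right_mono) auto
  then show ?thesis unfolding Dn_def norm_mult P_def[symmetric] by (simp add: mult_ac)
qed

lemma cnj_notin_nonpos_Reals: "t - of_nat n + 1 \<notin> \<real>\<^sub>\<le>\<^sub>0 \<Longrightarrow> cnj t - of_nat n + 1 \<notin> \<real>\<^sub>\<le>\<^sub>0"
  by (auto simp: complex_nonpos_Reals_iff)

definition "polyrest n \<xi> = contour_integral (linepath (tc n) (lc n)) (Jn n \<xi>)
     + contour_integral (linepath (lc n) (cnj (lc n))) (Jn n \<xi>)
     + contour_integral (linepath (cnj (lc n)) (cnj (tc n))) (Jn n \<xi>)"

text \<open>With \<xi> \<ge> - R and Re t between -1/2 and t0, the factor exp (b \<xi> (t - t0)) has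
  modulus at most exp (b R (t0 + 1)). The last factor bounds the total length of the three
  sides.\<close>

lemma polyrest_bound:
  obtains C c N where "C > 0" "c > 0" "N \<ge> (2::nat)"
    "\<And>n \<xi> R. n \<ge> N \<Longrightarrow> R \<ge> 0 \<Longrightarrow> \<xi> \<ge> - R \<Longrightarrow> norm (polyrest n \<xi>) \<le>
      (2 * (1 + real (\<nu> 1) + real n * ssc)) ^ \<nu> 1 * C * exp (- c * real n) * exp (bsc n * R * (t0 n + 1)) * (4 * (real n * zs M + 1))"
proof -
  obtain C c N where D: "C > 0" "c > 0" "N \<ge> (2::nat)"
    "\<And>n x. n \<ge> N \<Longrightarrow> - 1 / 2 \<le> x \<Longrightarrow> x \<le> real n * (zs M - ssc) \<Longrightarrow> norm (Dn n (Complex x (real n * ssc))) \<le> C * exp (- c * real n)"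
    by (rule Dn_horizontal_decay) blast
  show ?thesis
  proof (rule that[OF D(1-3)])
    fix n :: nat and \<xi> R :: real assume n: "n \<ge> N" and R: "R \<ge> 0" "\<xi> \<ge> - R"
    define Y where "Y = real n * ssc"
    define P where "P = (2 * (1 + real (\<nu> 1) + Y)) ^ \<nu> 1"
    have n2: "real n \<ge> 2" using n D(3) by linarith
    have Y: "Y > 0" using n2 ssc by (simp add: Y_def)
    have P: "P \<ge> 1" unfolding P_def using Y by (intro one_le_power) auto
    define W where "W = P * C * exp (- c * real n) * exp (bsc n * R * (t0 n + 1))"
    have b: "bsc n > 0" using bsc_pos n2 by simp
    have W0: "W \<ge> 0" using P D(1) by (simp add: W_def)
    have B: "real n * (zs M - ssc) = t0 n - Y" by (simp add: t0_def Y_def algebra_simps)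
    have Bp: "t0 n - Y > 0" using n2 ssc unfolding B[symmetric] by (intro mult_pos_pos) auto
    have hor: "norm (Dn n t) \<le> P * C * exp (- c * real n)" if "Im t = Y \<or> Im t = - Y" "- 1 / 2 \<le> Re t" "Re t \<le> t0 n - Y" for t
    proof -
      have "norm (Dn n t) = norm (Dn n (Complex (Re t) Y))"
      proof (cases "Im t = Y")
        case True
        then have "Complex (Re t) Y = t" by (simp add: complex_eq_iff)
        then show ?thesis by simp
      next
        case False
        then have "Complex (Re t) Y = cnj t" using that by (auto simp: complex_eq_iff)
        then show ?thesis by (simp add: norm_Dn_cnj)
      qed
      also have "\<dots> \<le> 1 * (C * exp (- c * real n))" using D(4)[OF n that(2)] that(3) unfolding B Y_def by simp
      also have "\<dots> \<le> P * (C * exp (- c * real n))" using P D(1) by (intro mult_right_mono) auto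
      finally show ?thesis by (simp add: mult_ac)
    qed
    have left: "norm (Dn n t) \<le> P * C * exp (- c * real n)" if "Re t = - 1 / 2" "\<bar>Im t\<bar> \<le> Y" for t
    proof -
      have t: "t = Complex (-1/2) (Im t)" using that by (simp add: complex_eq_iff)
      have "norm (Dn n t) \<le> P * norm (Dn n (Complex (-1/2) Y))"
        by (subst t, unfold P_def, rule norm_Dn_left[OF that(2)])
      also have "\<dots> \<le> P * (C * exp (- c * real n))"
        using D(4)[OF n, of "-1/2"] Bp P unfolding B Y_def by (intro mult_left_mono) auto
      finally show ?thesis by (simp add: mult_ac)
    qed
    have J: "norm (Jn n \<xi> t) \<le> W" if "norm (Dn n t) \<le> P * C * exp (- c * real n)" "- 1 / 2 \<le> Re t" "Re t \<le> t0 n" for t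
    proof -
      have "bsc n * \<xi> * (Re t - t0 n) = bsc n * ((- \<xi>) * (t0 n - Re t))" by (simp add: algebra_simps)
      also have "(- \<xi>) * (t0 n - Re t) \<le> R * (t0 n - Re t)" using R that by (intro mult_right_mono) auto
      also have "\<dots> \<le> R * (t0 n + 1)" using R that by (intro mult_left_mono) auto
      finally have "bsc n * \<xi> * (Re t - t0 n) \<le> bsc n * R * (t0 n + 1)" using b by (simp add: mult.assoc)
      then have "norm (exp (of_real (bsc n * \<xi>) * (t - of_real (t0 n)))) \<le> exp (bsc n * R * (t0 n + 1))"
        by (simp add: norm_exp_eq_Re)
      moreover have "0 \<le> P * C * exp (- c * real n)" using P D(1) by (intro mult_nonneg_nonneg) auto
      ultimately show ?thesis unfolding Jn_def norm_mult W_def using that(1) by (intro mult_mono) auto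
    qed
    have lc: "lc n = Complex (-1/2) Y" by (simp add: lc_def Y_def)
    have tc: "tc n = Complex (t0 n - Y) Y" using tc_eq[of n] B by (simp add: Y_def)
    let ?T = "{t. Re t > -1} - of_nat ` {..<n} :: complex set"
    have int: "Jn n \<xi> contour_integrable_on linepath u v" if "closed_segment u v \<subseteq> ?T" for u v
      by (intro contour_integrable_continuous_linepath continuous_on_subset[OF holomorphic_on_imp_continuous_on[OF Jn_holomorphic]] that)
    have seg: "norm (contour_integral (linepath u v) (Jn n \<xi>)) \<le> W * norm (v - u)"
      if h: "\<And>t. t \<in> closed_segment u v \<Longrightarrow> norm (Dn n t) \<le> P * C * exp (- c * real n) \<and> - 1 / 2 \<le> Re t \<and> Re t \<le> t0 n \<and> (Re t < 0 \<or> Im t \<noteq> 0)" for u v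
    proof (rule contour_integral_bound_linepath[OF int W0])
      show "closed_segment u v \<subseteq> ?T"
      proof
        fix t assume "t \<in> closed_segment u v"
        from h[OF this] show "t \<in> ?T" by auto
      qed
      fix t assume "t \<in> closed_segment u v"
      with h[OF this] show "norm (Jn n \<xi> t) \<le> W" by (intro J) auto
    qed
    have 1: "norm (contour_integral (linepath (tc n) (lc n)) (Jn n \<xi>)) \<le> W * norm (lc n - tc n)"
    proof (rule seg)
      fix t assume "t \<in> closed_segment (tc n) (lc n)"
      then have t: "Im t = Y" "- 1 / 2 \<le> Re t" "Re t \<le> t0 n - Y"
        unfolding tc lc using Bp by (auto simp: closed_segment_same_Im closed_segment_eq_real_ivl split: if_splits)
      then show "norm (Dn n t) \<le> P * C * exp (- c * real n) \<and> - 1 / 2 \<le> Re t \<and> Re t \<le> t0 n \<and> (Re t < 0 \<or> Im t \<noteq> 0)"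
        using hor[of t] Y by auto
    qed
    have 2: "norm (contour_integral (linepath (lc n) (cnj (lc n))) (Jn n \<xi>)) \<le> W * norm (cnj (lc n) - lc n)"
    proof (rule seg)
      fix t assume "t \<in> closed_segment (lc n) (cnj (lc n))"
      then have t: "Re t = - 1 / 2" "\<bar>Im t\<bar> \<le> Y"
        unfolding lc using Y by (auto simp: closed_segment_same_Re closed_segment_eq_real_ivl split: if_splits)
      then show "norm (Dn n t) \<le> P * C * exp (- c * real n) \<and> - 1 / 2 \<le> Re t \<and> Re t \<le> t0 n \<and> (Re t < 0 \<or> Im t \<noteq> 0)"
        using left[of t] Y Bp by auto
    qed
    have 3: "norm (contour_integral (linepath (cnj (lc n)) (cnj (tc n))) (Jn n \<xi>)) \<le> W * norm (cnj (tc n) - cnj (lc n))"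
    proof (rule seg)
      fix t assume "t \<in> closed_segment (cnj (lc n)) (cnj (tc n))"
      then have t: "Im t = - Y" "- 1 / 2 \<le> Re t" "Re t \<le> t0 n - Y"
        unfolding tc lc using Bp by (auto simp: closed_segment_same_Im closed_segment_eq_real_ivl split: if_splits)
      then show "norm (Dn n t) \<le> P * C * exp (- c * real n) \<and> - 1 / 2 \<le> Re t \<and> Re t \<le> t0 n \<and> (Re t < 0 \<or> Im t \<noteq> 0)"
        using hor[of t] Y by auto
    qed
    have l1: "norm (lc n - tc n) \<le> t0 n + 1"
    proof -
      have "norm (lc n - tc n) = t0 n - Y + 1 / 2" unfolding tc lc using Bp by (simp add: cmod_def)
      then show ?thesis using Y by simp
    qed
    have l3: "norm (cnj (tc n) - cnj (lc n)) \<le> t0 n + 1"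
      using l1 by (metis complex_cnj_diff complex_mod_cnj norm_minus_commute)
    have l2: "norm (cnj (lc n) - lc n) \<le> 2 * (t0 n + 1)"
    proof -
      have "norm (cnj (lc n) - lc n) = 2 * Y" unfolding lc using Y by (simp add: cmod_def real_sqrt_mult)
      then show ?thesis using Bp by simp
    qed
    have "norm (polyrest n \<xi>) \<le> W * (t0 n + 1) + W * (2 * (t0 n + 1)) + W * (t0 n + 1)"
      unfolding polyrest_def
      by (intro order_trans[OF norm_triangle_ineq] add_mono order_trans[OF 1] order_trans[OF 2] order_trans[OF 3] mult_left_mono l1 l2 l3 W0)
    also have "\<dots> = W * (4 * (t0 n + 1))" by (simp add: algebra_simps)
    finally show "norm (polyrest n \<xi>) \<le>
      (2 * (1 + real (\<nu> 1) + real n * ssc)) ^ \<nu> 1 * C * exp (- c * real n) * exp (bsc n * R * (t0 n + 1)) * (4 * (real n * zs M + 1))"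
      unfolding W_def P_def Y_def by (simp add: t0_def)
  qed
qed

text \<open>b t0 is of order n^(1/3), so the decay exp (- c n) outweighs all the other
  factors.\<close>

lemma polyrest_negligible:
  assumes R: "R \<ge> 0"
  obtains E :: "nat \<Rightarrow> real" and N :: nat where "E \<longlonglongrightarrow> 0" "\<And>n \<xi>. n \<ge> N \<Longrightarrow> \<xi> \<ge> - R \<Longrightarrow> norm (of_real (bsc n) * polyrest n \<xi>) \<le> E n"
proof -
  obtain C c N where D: "C > 0" "c > 0" "N \<ge> (2::nat)"
    "\<And>n \<xi> R. n \<ge> N \<Longrightarrow> R \<ge> 0 \<Longrightarrow> \<xi> \<ge> - R \<Longrightarrow> norm (polyrest n \<xi>) \<le>
      (2 * (1 + real (\<nu> 1) + real n * ssc)) ^ \<nu> 1 * C * exp (- c * real n) * exp (bsc n * R * (t0 n + 1)) * (4 * (real n * zs M + 1))"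
    by (rule polyrest_bound) blast
  \<comment> \<open>A strictly positive parameter gives the asymptotic expansion a definite sign;
    enlarging R only weakens the bound.\<close>
  define R' where "R' = R + 1"
  have R': "R' > 0" using R by (simp add: R'_def)
  define E where "E = (\<lambda>n. bsc n * ((2 * (1 + real (\<nu> 1) + real n * ssc)) ^ \<nu> 1 * C * exp (- c * real n) * exp (bsc n * R' * (t0 n + 1)) * (4 * (real n * zs M + 1))))"
  have "E \<longlonglongrightarrow> 0"
  proof -
    define k where "k = \<nu> 1"
    define s where "s = ssc"
    define a where "a = acb"
    define z where "z = zs M"
    have p: "s > 0" "a > 0" "z > 0" using ssc acb zs_gt_1[OF M] by (auto simp: s_def a_def z_def)
    \<comment> \<open>exp (- c n) is split into halves: one beats the factors below, the other the
      power with the symbolic exponent \<nu> 1.\<close>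
    have 1: "(\<lambda>n::nat. a / real n powr (2 / 3) * (C * exp (- (c / 2) * real n) * exp (a / real n powr (2 / 3) * R' * (real n * z + 1)) * (4 * (real n * z + 1)))) \<longlonglongrightarrow> 0"
      using D(1,2) p R' by real_asymp
    have 2: "(\<lambda>n::nat. (2 * (1 + real k + real n * s)) powr real k * exp (- (c / 2) * real n)) \<longlonglongrightarrow> 0"
      using D(2) p(1) by real_asymp
    have "(\<lambda>n. (a / real n powr (2 / 3) * (C * exp (- (c / 2) * real n) * exp (a / real n powr (2 / 3) * R' * (real n * z + 1)) * (4 * (real n * z + 1)))) *
       ((2 * (1 + real k + real n * s)) powr real k * exp (- (c / 2) * real n))) \<longlonglongrightarrow> 0 * 0"
      by (intro tendsto_mult 1 2)
    moreover have "E = (\<lambda>n. (a / real n powr (2 / 3) * (C * exp (- (c / 2) * real n) * exp (a / real n powr (2 / 3) * R' * (real n * z + 1)) * (4 * (real n * z + 1)))) *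
       ((2 * (1 + real k + real n * s)) powr real k * exp (- (c / 2) * real n)))"
    proof (rule ext)
      fix n
      have q: "2 * (1 + real k + real n * s) > 0" using p(1) by (simp add: add_pos_nonneg)
      have "exp (- c * real n) = exp (- (c / 2) * real n) * exp (- (c / 2) * real n)" by (simp add: mult_exp_exp)
      then show "E n = (a / real n powr (2 / 3) * (C * exp (- (c / 2) * real n) * exp (a / real n powr (2 / 3) * R' * (real n * z + 1)) * (4 * (real n * z + 1)))) *
       ((2 * (1 + real k + real n * s)) powr real k * exp (- (c / 2) * real n))" unfolding E_def bsc_def t0_def k_def[symmetric] s_def[symmetric] a_def[symmetric] z_def[symmetric] powr_realpow[OF q]
        by (simp only: mult_ac)
    qed
    ultimately show ?thesis by (simp only: mult_zero_left)
  qed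
  moreover have "norm (of_real (bsc n) * polyrest n \<xi>) \<le> E n" if "n \<ge> N" "\<xi> \<ge> - R" for n \<xi>
  proof -
    have "bsc n > 0" using bsc_pos that D(3) by simp
    then show ?thesis unfolding E_def norm_mult using D(4)[OF that(1), of R' \<xi>] that R' by (intro mult_mono) (auto simp: R'_def)
  qed
  ultimately show ?thesis using that by blast
qed

text \<open>The descent segment in the variable y with v = y e. The direction e has modulus sqrt 2
  and is not normalized, which is why sqrt 2 reappears when the limits are identified with ray
  integrals.\<close>

definition "segint n e \<xi> = (LBINT y. indicator {0..bsc n * real n * ssc} y *\<^sub>R (Dn n (of_real (t0 n) + of_real y * e / of_real (bsc n)) * exp (of_real (\<xi> * y) * e)))"
  for \<xi> :: real

lemma segment_not_pole:
  assumes n: "n \<ge> 1" and y: "0 \<le> y" and e: "e = \<i> - 1 \<or> e = - \<i> - 1"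
  shows "of_real (t0 n) + of_real y * e / of_real (bsc n) \<notin> of_nat ` {..<n}"
proof
  assume "of_real (t0 n) + of_real y * e / of_real (bsc n) \<in> of_nat ` {..<n}"
  then obtain k where k: "k < n" "of_real (t0 n) + of_real y * e / of_real (bsc n) = of_nat k" by auto
  have b: "bsc n > 0" using bsc_pos[OF n] .
  from arg_cong[OF k(2), of Im] have "y = 0" using e b by (auto simp: Im_divide_of_real)
  with arg_cong[OF k(2), of Re] have "t0 n = real k" by simp
  then show False using t0_gt[OF n] k by simp
qed

lemma contour_integral_eq_segint:
  assumes n: "n \<ge> 2" and e: "e = \<i> - 1 \<or> e = - \<i> - 1"
  shows "of_real (bsc n) * contour_integral (linepath (of_real (t0 n)) (of_real (t0 n) + of_real (real n * ssc) * e)) (Jn n \<xi>) = e * segint n e \<xi>"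
proof -
  have n1: "n \<ge> 1" using n by simp
  have b: "bsc n > 0" using bsc_pos[OF n1] .
  let ?R = "bsc n * real n * ssc"
  let ?e = "e / of_real (bsc n)"
  have R: "?R > 0" using b n ssc by simp
  have q: "of_real (t0 n) + of_real (real n * ssc) * e = of_real (t0 n) + of_real ?R * ?e" using b by simp
  have "contour_integral (linepath (of_real (t0 n)) (of_real (t0 n) + of_real ?R * ?e)) (Jn n \<xi>) =
     ?e * (LBINT r. indicator {0..?R} r *\<^sub>R Jn n \<xi> (of_real (t0 n) + of_real r * ?e))"
  proof (rule contour_integral_ray_segment[OF R])
    have "closed_segment (of_real (t0 n)) (of_real (t0 n) + of_real ?R * ?e) \<subseteq> {t. Re t > -1} - of_nat ` {..<n}"
    proof
      fix t assume "t \<in> closed_segment (of_real (t0 n)) (of_real (t0 n) + of_real ?R * ?e)"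
      then obtain u where u: "0 \<le> u" "u \<le> 1" "t = of_real (t0 n) + of_real (u * ?R) * e / of_real (bsc n)"
        by (auto simp: closed_segment_def algebra_simps scaleR_conv_of_real)
      have "t \<notin> of_nat ` {..<n}" unfolding u(3) by (rule segment_not_pole[OF n1 _ e]) (use u R in auto)
      moreover have "Re t > -1"
      proof -
        have "Re t = t0 n - u * (real n * ssc)" unfolding u(3) using e b by (auto simp: Re_divide_of_real)
        moreover have "u * (real n * ssc) \<le> 1 * (real n * ssc)" using u ssc by (intro mult_right_mono) auto
        moreover have "real n * (zs M - ssc) \<ge> 0" using ssc by simp
        ultimately show ?thesis unfolding t0_def by (simp add: algebra_simps)
      qed
      ultimately show "t \<in> {t. Re t > -1} - of_nat ` {..<n}" by auto
    qed
    then show "continuous_on (closed_segment (of_real (t0 n)) (of_real (t0 n) + of_real ?R * ?e)) (Jn n \<xi>)"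
      by (rule continuous_on_subset[OF holomorphic_on_imp_continuous_on[OF Jn_holomorphic]])
  qed
  also have "(\<lambda>r. indicator {0..?R} r *\<^sub>R Jn n \<xi> (of_real (t0 n) + of_real r * ?e)) =
     (\<lambda>y. indicator {0..?R} y *\<^sub>R (Dn n (of_real (t0 n) + of_real y * e / of_real (bsc n)) * exp (of_real (\<xi> * y) * e)))"
    using b by (auto simp: fun_eq_iff Jn_def mult_ac)
  finally show ?thesis unfolding q segint_def using b by simp
qed

lemma segint_measurable:
  assumes n: "n \<ge> 1" and e: "e = \<i> - 1 \<or> e = - \<i> - 1"
  shows "(\<lambda>y. indicator {0..bsc n * real n * ssc} y *\<^sub>R (Dn n (of_real (t0 n) + of_real y * e / of_real (bsc n)) * exp (of_real (\<xi> * y) * e))) \<in> borel_measurable borel"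
proof (rule borel_measurable_continuous_on_indicator)
  have b: "bsc n > 0" using bsc_pos[OF n] .
  have img: "of_real (t0 n) + of_real y * e / of_real (bsc n) \<in> {t. Re t > -1} - of_nat ` {..<n}" if "y \<in> {0..bsc n * real n * ssc}" for y
  proof -
    have "Re (of_real (t0 n) + of_real y * e / of_real (bsc n)) = t0 n - y / bsc n" using e by (auto simp: Re_divide_of_real)
    moreover have "y / bsc n \<le> real n * ssc" using that b by (simp add: field_simps)
    moreover have "real n * (zs M - ssc) \<ge> 0" using ssc by simp
    ultimately have "Re (of_real (t0 n) + of_real y * e / of_real (bsc n)) > -1" unfolding t0_def by (simp add: algebra_simps)
    then show ?thesis using segment_not_pole[OF n _ e, of y] that by auto
  qed
  have "continuous_on {0..bsc n * real n * ssc} (\<lambda>y. Dn n (of_real (t0 n) + of_real y * e / of_real (bsc n)))"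
  proof (rule continuous_on_compose2[OF holomorphic_on_imp_continuous_on[OF Dn_holomorphic]])
    show "continuous_on {0..bsc n * real n * ssc} (\<lambda>y. of_real (t0 n) + of_real y * e / of_real (bsc n))"
      using b by (intro continuous_intros) auto
    show "(\<lambda>y. of_real (t0 n) + of_real y * e / of_real (bsc n)) ` {0..bsc n * real n * ssc} \<subseteq> {t. Re t > -1} - of_nat ` {..<n}"
      by (intro image_subsetI img)
  qed
  then show "continuous_on {0..bsc n * real n * ssc} (\<lambda>y. Dn n (of_real (t0 n) + of_real y * e / of_real (bsc n)) * exp (of_real (\<xi> * y) * e))"
    by (intro continuous_intros)
qed simp

text \<open>With u = y h the bound exp (- c n u^3) becomes exp (- (c / acb^3) y^3), free of n, and
  the cubic absorbs exp (R y). The lower direction follows by conjugation.\<close>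

lemma segint_dominated:
  assumes R: "R \<ge> 0"
  obtains C N where "C > 0" "N \<ge> (2::nat)"
    "\<And>n e \<xi> y. n \<ge> N \<Longrightarrow> e = \<i> - 1 \<or> e = - \<i> - 1 \<Longrightarrow> \<xi> \<ge> - R \<Longrightarrow>
      norm (indicator {0..bsc n * real n * ssc} y *\<^sub>R (Dn n (of_real (t0 n) + of_real y * e / of_real (bsc n)) * exp (of_real (\<xi> * y) * e)))
       \<le> C * (indicator {0..} y *\<^sub>R exp (- 1 * y))"
proof -
  obtain C c N where D: "C > 0" "c > 0" "N \<ge> (2::nat)"
    "\<And>n u. n \<ge> N \<Longrightarrow> 0 \<le> u \<Longrightarrow> u \<le> ssc \<Longrightarrow> norm (Dn n (of_real (t0 n) + of_real (real n * u) * (\<i> - 1))) \<le> C * exp (- c * real n * u ^ 3)"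
    by (rule Dn_segment_decay) blast
  have "c / acb ^ 3 > 0" using D(2) acb(1) by simp
  then obtain K where K: "K > 0" "\<And>r. r \<ge> 0 \<Longrightarrow> exp (R * r - c / acb ^ 3 * r ^ 3) \<le> K * exp (- 1 * r)"
    using cubic_exp_dominator[of "c / acb ^ 3" R] R by blast
  show ?thesis
  proof (rule that[of "C * K" N])
    fix n e \<xi> y assume n: "n \<ge> N" and e: "e = \<i> - 1 \<or> e = - \<i> - 1" and x: "\<xi> \<ge> - R"
    have n1: "n \<ge> 1" using n D(3) by simp
    have b: "bsc n > 0" using bsc_pos[OF n1] .
    show "norm (indicator {0..bsc n * real n * ssc} y *\<^sub>R (Dn n (of_real (t0 n) + of_real y * e / of_real (bsc n)) * exp (of_real (\<xi> * y) * e)))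
       \<le> C * K * (indicator {0..} y *\<^sub>R exp (- 1 * y))"
    proof (cases "y \<in> {0..bsc n * real n * ssc}")
      case True
      define u where "u = y * hsc n"
      have hb: "1 / bsc n = real n * hsc n" using hsc(4)[OF n1] .
      have "y / bsc n = y * (1 / bsc n)" by simp
      then have yb: "y / bsc n = real n * u" unfolding hb by (simp add: u_def)
      have u: "0 \<le> u" "u \<le> ssc"
      proof -
        show "0 \<le> u" using True hsc(1)[OF n1] by (simp add: u_def)
        have "y / bsc n \<le> real n * ssc" using True b by (simp add: field_simps)
        then show "u \<le> ssc" unfolding yb using n1 by simp
      qed
      have t: "of_real (t0 n) + of_real y * (\<i> - 1) / of_real (bsc n) = of_real (t0 n) + of_real (real n * u) * (\<i> - 1)"
        unfolding yb[symmetric] by simp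
      have "norm (Dn n (of_real (t0 n) + of_real y * e / of_real (bsc n))) = norm (Dn n (of_real (t0 n) + of_real y * (\<i> - 1) / of_real (bsc n)))"
      proof (cases "e = \<i> - 1")
        case False
        then have "of_real (t0 n) + of_real y * e / of_real (bsc n) = cnj (of_real (t0 n) + of_real y * (\<i> - 1) / of_real (bsc n))"
          using e by simp
        then show ?thesis by (simp only: norm_Dn_cnj)
      qed simp
      also have "\<dots> \<le> C * exp (- c * real n * u ^ 3)" unfolding t by (rule D(4)[OF n u])
      also have "c * real n * u ^ 3 = c * (real n * hsc n ^ 3) * y ^ 3" by (simp add: u_def power_mult_distrib)
      then have "- c * real n * u ^ 3 = - (c / acb ^ 3 * y ^ 3)" unfolding hsc(2)[OF n1] by simp
      finally have 1: "norm (Dn n (of_real (t0 n) + of_real y * e / of_real (bsc n))) \<le> C * exp (- (c / acb ^ 3 * y ^ 3))" .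
      have "(- \<xi>) * y \<le> R * y" using True x by (intro mult_right_mono) auto
      then have 2: "norm (exp (of_real (\<xi> * y) * e)) \<le> exp (R * y)" using e by (auto simp: norm_exp_eq_Re)
      have "norm (Dn n (of_real (t0 n) + of_real y * e / of_real (bsc n)) * exp (of_real (\<xi> * y) * e)) \<le> (C * exp (- (c / acb ^ 3 * y ^ 3))) * exp (R * y)"
        unfolding norm_mult using 1 2 D(1) by (intro mult_mono) auto
      also have "\<dots> = C * exp (R * y - c / acb ^ 3 * y ^ 3)" by (simp add: mult_exp_exp)
      also have "\<dots> \<le> C * (K * exp (- 1 * y))" using K(2)[of y] True D(1) by (intro mult_left_mono) auto
      finally show ?thesis using True by simp
    qed (use D(1) K(1) in \<open>auto simp: indicator_def\<close>)
  qed (use D K in auto)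
qed

lemma Ps_eq_segints:
  assumes n: "n \<ge> 2"
  shows "Ps n \<xi> = 1 / (2 * of_real pi * \<i>) * ((\<i> - 1) * segint n (\<i> - 1) \<xi> - (- \<i> - 1) * segint n (- \<i> - 1) \<xi> + of_real (bsc n) * polyrest n \<xi>)"
proof -
  have c: "cnj (tc n) = of_real (t0 n) + of_real (real n * ssc) * (- \<i> - 1)" by (simp add: tc_def)
  show ?thesis
    unfolding Ps_eq_polygon[OF n] contour_integral_eq_segint[OF n disjI1[OF refl], symmetric] contour_integral_eq_segint[OF n disjI2[OF refl], symmetric]
      tc_def[symmetric] c[symmetric] polyrest_def
    by (simp add: algebra_simps add_divide_distrib diff_divide_distrib)
qed

lemma Ps_bound:
  assumes R: "R \<ge> 0"
  obtains C N where "C \<ge> 0" "\<And>n \<xi>. n \<ge> N \<Longrightarrow> \<xi> \<ge> - R \<Longrightarrow> norm (Ps n \<xi>) \<le> C"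
proof -
  obtain C N1 where S: "C > 0" "N1 \<ge> (2::nat)"
    "\<And>n e \<xi> y. n \<ge> N1 \<Longrightarrow> e = \<i> - 1 \<or> e = - \<i> - 1 \<Longrightarrow> \<xi> \<ge> - R \<Longrightarrow>
      norm (indicator {0..bsc n * real n * ssc} y *\<^sub>R (Dn n (of_real (t0 n) + of_real y * e / of_real (bsc n)) * exp (of_real (\<xi> * y) * e)))
       \<le> C * (indicator {0..} y *\<^sub>R exp (- 1 * y))"
    by (rule segint_dominated[OF R]) blast
  obtain E N2 where E: "E \<longlonglongrightarrow> 0" "\<And>n \<xi>. n \<ge> N2 \<Longrightarrow> \<xi> \<ge> - R \<Longrightarrow> norm (of_real (bsc n) * polyrest n \<xi>) \<le> E n"
    by (rule polyrest_negligible[OF R]) blast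
  have "eventually (\<lambda>n. E n < 1) sequentially" using E(1) by (rule order_tendstoD) simp
  then obtain N3 where N3: "\<And>n. n \<ge> N3 \<Longrightarrow> E n < 1" by (auto simp: eventually_sequentially)
  let ?I = "LBINT y. C * (indicator {0..} y *\<^sub>R exp (- 1 * y))"
  have int: "integrable lborel (\<lambda>y. C * (indicator {0..} y *\<^sub>R exp (- 1 * y)))"
    by (intro integrable_mult_right integrable_exp_neg_halfline) auto
  have I0: "?I \<ge> 0" using S(1) by (intro Bochner_Integration.integral_nonneg) auto
  have seg: "norm (segint n e \<xi>) \<le> ?I" if "n \<ge> N1" "e = \<i> - 1 \<or> e = - \<i> - 1" "\<xi> \<ge> - R" for n e \<xi>
    unfolding segint_def
  proof (rule Bochner_Integration.integral_norm_bound_integral[OF _ int S(3)[OF that]])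
    show "integrable lborel (\<lambda>y. indicator {0..bsc n * real n * ssc} y *\<^sub>R (Dn n (of_real (t0 n) + of_real y * e / of_real (bsc n)) * exp (of_real (\<xi> * y) * e)))"
    proof (rule Bochner_Integration.integrable_bound[OF int])
      show "(\<lambda>y. indicator {0..bsc n * real n * ssc} y *\<^sub>R (Dn n (of_real (t0 n) + of_real y * e / of_real (bsc n)) * exp (of_real (\<xi> * y) * e))) \<in> borel_measurable lborel"
        using segint_measurable[OF _ that(2), of n \<xi>] that(1) S(2) by simp
    qed (use order_trans[OF S(3)[OF that] abs_ge_self] in auto)
  qed
  show ?thesis
  proof (rule that[of "1 / (2 * pi) * (2 * ?I + 2 * ?I + 1)" "max N1 (max N2 N3)"])
    fix n \<xi> assume n: "n \<ge> max N1 (max N2 N3)" and x: "\<xi> \<ge> - R"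
    have n2: "n \<ge> 2" using n S(2) by linarith
    have e: "cmod (\<i> - 1) \<le> 2" "cmod (- \<i> - 1) \<le> 2" using norm_triangle_ineq4[of \<i> 1] norm_triangle_ineq4[of "- \<i>" 1] by simp_all
    have s1: "norm ((\<i> - 1) * segint n (\<i> - 1) \<xi>) \<le> 2 * ?I"
      unfolding norm_mult using seg[of n "\<i> - 1" \<xi>] e n x by (intro mult_mono) auto
    have s2: "norm ((- \<i> - 1) * segint n (- \<i> - 1) \<xi>) \<le> 2 * ?I"
      unfolding norm_mult using seg[of n "- \<i> - 1" \<xi>] e n x by (intro mult_mono) auto
    have s3: "norm (of_real (bsc n) * polyrest n \<xi>) \<le> 1" using E(2)[of n \<xi>] N3[of n] n x by simp
    have "norm ((\<i> - 1) * segint n (\<i> - 1) \<xi> - (- \<i> - 1) * segint n (- \<i> - 1) \<xi> + of_real (bsc n) * polyrest n \<xi>) \<le> 2 * ?I + 2 * ?I + 1"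
      by (intro order_trans[OF norm_triangle_ineq] add_mono order_trans[OF norm_triangle_ineq4] s1 s2 s3)
    then have "norm (1 / (2 * of_real pi * \<i>)) * norm ((\<i> - 1) * segint n (\<i> - 1) \<xi> - (- \<i> - 1) * segint n (- \<i> - 1) \<xi> + of_real (bsc n) * polyrest n \<xi>)
        \<le> norm (1 / (2 * of_real pi * \<i>)) * (2 * ?I + 2 * ?I + 1)" by (intro mult_left_mono) auto
    then show "norm (Ps n \<xi>) \<le> 1 / (2 * pi) * (2 * ?I + 2 * ?I + 1)"
      unfolding Ps_eq_segints[OF n2] norm_mult[of "1 / (2 * of_real pi * \<i>)"] by (simp add: norm_divide norm_mult)
  qed (use I0 in auto)
qed

text \<open>The limiting exponent - v^3 / 3 + \<xi> v at v = y e is the Airy exponent at - v: the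
  contour leaves the saddle point to the left, and reflection turns it into the rays of the Airy
  integral.\<close>

lemma segint_tendsto:
  assumes X: "X \<longlonglongrightarrow> \<xi>" and e: "e = \<i> - 1 \<or> e = - \<i> - 1"
  shows "(\<lambda>n. segint n e (X n)) \<longlonglongrightarrow> (LBINT y. indicator {0..} y *\<^sub>R exp ((of_real y * (- e)) ^ 3 / 3 - of_real \<xi> * (of_real y * (- e))))"
proof -
  obtain R where R: "\<And>n. norm (X n) \<le> R" using X by (meson BseqE convergentI convergent_imp_Bseq)
  have R0: "R \<ge> 0" using R[of 0] norm_ge_zero order_trans by blast
  have XR: "X n \<ge> - R" for n using R[of n] by (simp add: abs_le_iff)
  obtain C N where S: "C > 0" "N \<ge> (2::nat)"
    "\<And>n e \<xi> y. n \<ge> N \<Longrightarrow> e = \<i> - 1 \<or> e = - \<i> - 1 \<Longrightarrow> \<xi> \<ge> - R \<Longrightarrow>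
      norm (indicator {0..bsc n * real n * ssc} y *\<^sub>R (Dn n (of_real (t0 n) + of_real y * e / of_real (bsc n)) * exp (of_real (\<xi> * y) * e)))
       \<le> C * (indicator {0..} y *\<^sub>R exp (- 1 * y))"
    by (rule segint_dominated[OF R0]) blast
  obtain C' c' N' where D: "\<And>n u. n \<ge> N' \<Longrightarrow> 0 \<le> u \<Longrightarrow> u \<le> ssc \<Longrightarrow> of_real (t0 n) + of_real (real n * u) * (\<i> - 1) - of_nat n + 1 \<notin> \<real>\<^sub>\<le>\<^sub>0"
    by (rule Dn_segment_decay) blast
  let ?g = "\<lambda>n y. indicator {0..bsc n * real n * ssc} y *\<^sub>R (Dn n (of_real (t0 n) + of_real y * e / of_real (bsc n)) * exp (of_real (X n * y) * e))"
  let ?l = "\<lambda>y. indicator {0..} y *\<^sub>R exp ((of_real y * (- e)) ^ 3 / 3 - of_real \<xi> * (of_real y * (- e)))"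
  have "(\<lambda>n. LBINT y. ?g (n + N) y) \<longlonglongrightarrow> (LBINT y. ?l y)"
  proof (rule integral_dominated_convergence[where w = "\<lambda>y. C * (indicator {0..} y *\<^sub>R exp (- 1 * y))"])
    show "integrable lborel (\<lambda>y. C * (indicator {0..} y *\<^sub>R exp (- 1 * y)))"
      by (intro integrable_mult_right integrable_exp_neg_halfline) auto
    show "(\<lambda>y. ?g (n + N) y) \<in> borel_measurable lborel" for n
      using segint_measurable[OF _ e, of "n + N" "X (n + N)"] S(2) by simp
    have "?l \<in> borel_measurable borel"
      by (intro borel_measurable_continuous_on_indicator continuous_intros) auto
    then show "?l \<in> borel_measurable lborel" by simp
    show "AE y in lborel. norm (?g (n + N) y) \<le> C * (indicator {0..} y *\<^sub>R exp (- 1 * y))" for n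
      by (intro AE_I2 S(3) e XR) simp
    show "AE y in lborel. (\<lambda>n. ?g (n + N) y) \<longlonglongrightarrow> ?l y"
    proof (intro AE_I2 LIMSEQ_ignore_initial_segment)
      fix y
      show "(\<lambda>n. ?g n y) \<longlonglongrightarrow> ?l y"
      proof (cases "y \<ge> 0")
        case True
        have "filterlim (\<lambda>n. bsc n * real n * ssc) at_top sequentially"
          unfolding bsc_def using acb(1) ssc(1) by real_asymp
        then have "eventually (\<lambda>n. bsc n * real n * ssc \<ge> y) sequentially"
          unfolding filterlim_at_top by blast
        then have ev: "eventually (\<lambda>n. exp (LF n (of_real (t0 n) + (of_real y * e) / of_real (bsc n)) - LF n (of_real (t0 n))) * exp (of_real (X n * y) * e) = ?g n y) sequentially"
          using eventually_ge_at_top[of "max 1 N'"]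
        proof eventually_elim
          case (elim n)
          then have n1: "n \<ge> 1" "n \<ge> N'" by auto
          have b: "bsc n > 0" using bsc_pos[OF n1(1)] .
          define u where "u = y / bsc n / real n"
          have u: "0 \<le> u" "u \<le> ssc" using True elim(1) b n1 by (simp_all add: u_def field_simps)
          have "of_real (t0 n) + of_real (real n * u) * (\<i> - 1) - of_nat n + 1 \<notin> \<real>\<^sub>\<le>\<^sub>0" by (rule D[OF n1(2) u])
          moreover have "of_real (real n * u) * (\<i> - 1) = of_real y * (\<i> - 1) / of_real (bsc n)" using n1 by (simp add: u_def)
          ultimately have nn: "of_real (t0 n) + of_real y * (\<i> - 1) / of_real (bsc n) - of_nat n + 1 \<notin> \<real>\<^sub>\<le>\<^sub>0" by simp
          have "of_real (t0 n) + of_real y * e / of_real (bsc n) - of_nat n + 1 \<notin> \<real>\<^sub>\<le>\<^sub>0"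
          proof (cases "e = \<i> - 1")
            case False
            then have eq: "of_real (t0 n) + of_real y * e / of_real (bsc n) = cnj (of_real (t0 n) + of_real y * (\<i> - 1) / of_real (bsc n))"
              using e by simp
            show ?thesis unfolding eq using cnj_notin_nonpos_Reals[OF nn] .
          qed (use nn in simp)
          then show ?case using True elim(1) by (simp add: Dn_eq_exp)
        qed
        have "(\<lambda>n. exp (LF n (of_real (t0 n) + (of_real y * e) / of_real (bsc n)) - LF n (of_real (t0 n))) * exp (of_real (X n * y) * e))
           \<longlonglongrightarrow> exp (- ((of_real y * e) ^ 3 / 3)) * exp (of_real (\<xi> * y) * e)"
          by (intro tendsto_intros saddle_cubic_limit X)
        moreover have "exp (- ((of_real y * e) ^ 3 / 3)) * exp (of_real (\<xi> * y) * e) = ?l y"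
          using True by (simp add: mult_exp_exp mult.assoc power3_eq_cube)
        ultimately show ?thesis using ev by (auto intro: Lim_transform_eventually)
      qed simp
    qed
  qed
  then have "(\<lambda>n. segint (n + N) e (X (n + N))) \<longlonglongrightarrow> (LBINT y. ?l y)" by (simp add: segint_def)
  then show ?thesis by (rule LIMSEQ_offset)
qed

lemma Ps_tendsto:
  assumes X: "X \<longlonglongrightarrow> \<xi>"
  shows "(\<lambda>n. Ps n (X n)) \<longlonglongrightarrow> Airy_Ai (of_real \<xi>)"
proof -
  let ?f = "\<lambda>v. exp (v ^ 3 / 3 - of_real \<xi> * v)"
  let ?L = "\<lambda>e. LBINT y. indicator {0..} y *\<^sub>R exp ((of_real y * (- e)) ^ 3 / 3 - of_real \<xi> * (of_real y * (- e)))"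
  obtain R where R: "\<And>n. norm (X n) \<le> R" using X by (meson BseqE convergentI convergent_imp_Bseq)
  have R0: "R \<ge> 0" using R[of 0] norm_ge_zero order_trans by blast
  have XR: "X n \<ge> - R" for n using R[of n] by (simp add: abs_le_iff)
  obtain E N2 where E: "E \<longlonglongrightarrow> 0" "\<And>n \<xi>. n \<ge> N2 \<Longrightarrow> \<xi> \<ge> - R \<Longrightarrow> norm (of_real (bsc n) * polyrest n \<xi>) \<le> E n"
    by (rule polyrest_negligible[OF R0]) blast
  have rest: "(\<lambda>n. of_real (bsc n) * polyrest n (X n)) \<longlonglongrightarrow> 0"
    by (rule Lim_null_comparison[OF _ E(1)]) (use E(2) XR in \<open>auto simp: eventually_sequentially\<close>)
  \<comment> \<open>The reflection exchanges the directions, since - (\<i> - 1) = sqrt 2 cis (- pi /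
    4). The minus signs in \<open>r1\<close> and \<open>r2\<close> then restore the orientation of
    the Airy contour.\<close>
  have r1: "(\<i> - 1) * ?L (\<i> - 1) = - ray_integral (cis (- (pi / 4))) ?f"
  proof -
    have w: "of_real (sqrt 2) * cis (- (pi / 4)) = - (\<i> - 1)" by (simp add: complex_eq_iff cos_45 sin_45)
    show ?thesis unfolding ray_integral_scale[of "sqrt 2" "cis (- (pi / 4))", OF real_sqrt_gt_zero[OF zero_less_numeral]] w by (simp add: algebra_simps)
  qed
  have r2: "(- \<i> - 1) * ?L (- \<i> - 1) = - ray_integral (cis (pi / 4)) ?f"
  proof -
    have w: "of_real (sqrt 2) * cis (pi / 4) = - (- \<i> - 1)" by (simp add: complex_eq_iff cos_45 sin_45)
    show ?thesis unfolding ray_integral_scale[of "sqrt 2" "cis (pi / 4)", OF real_sqrt_gt_zero[OF zero_less_numeral]] w by (simp add: algebra_simps)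
  qed
  have "(\<lambda>n. 1 / (2 * of_real pi * \<i>) * ((\<i> - 1) * segint n (\<i> - 1) (X n) - (- \<i> - 1) * segint n (- \<i> - 1) (X n) + of_real (bsc n) * polyrest n (X n)))
     \<longlonglongrightarrow> 1 / (2 * of_real pi * \<i>) * ((\<i> - 1) * ?L (\<i> - 1) - (- \<i> - 1) * ?L (- \<i> - 1) + 0)"
    by (intro tendsto_mult tendsto_add tendsto_diff tendsto_const segint_tendsto[OF X] rest) auto
  also have "1 / (2 * of_real pi * \<i>) * ((\<i> - 1) * ?L (\<i> - 1) - (- \<i> - 1) * ?L (- \<i> - 1) + 0) = Airy_Ai (of_real \<xi>)"
    unfolding r1 r2 Airy_Ai_eq_moment by (subst airy_vertical_eq_rays[of "pi / 4"]) auto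
  finally show ?thesis
    by (rule Lim_transform_eventually) (use eventually_ge_at_top[of 2] in \<open>eventually_elim, simp only: Ps_eq_segints\<close>)
qed

end

section \<open>The Airy limit\<close>

text \<open>If uniform convergence fails, there are indices n N and points x N with error at least
  e. Compactness yields a convergent subsequence of the points, but the hypothesis speaks of one
  point for every index, so they must be placed at their indices within a full convergent
  sequence.\<close>

lemma uniform_limit_compact_sequentially:
  fixes f :: "nat \<Rightarrow> 'a::metric_space \<Rightarrow> 'b::metric_space"
  assumes K: "compact K" and l: "continuous_on K l"
    and cc: "\<And>X p. (\<And>n. X n \<in> K) \<Longrightarrow> p \<in> K \<Longrightarrow> X \<longlonglongrightarrow> p \<Longrightarrow> (\<lambda>n. f n (X n)) \<longlonglongrightarrow> l p"
  shows "uniform_limit K f l sequentially"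
proof (rule ccontr)
  assume "\<not> uniform_limit K f l sequentially"
  then obtain e where e: "e > 0" "\<And>N. \<exists>n\<ge>N. \<exists>x\<in>K. \<not> dist (f n x) (l x) < e"
    unfolding uniform_limit_iff eventually_sequentially by blast
  then obtain n x where nx: "\<And>N. n N \<ge> N \<and> x N \<in> K \<and> \<not> dist (f (n N) (x N)) (l (x N)) < e"
    by metis
  obtain p r where p: "p \<in> K" "strict_mono r" "(x \<circ> r) \<longlonglongrightarrow> p"
    using K nx unfolding compact_eq_seq_compact_metric seq_compact_def by metis
  \<comment> \<open>Indices that are never hit receive the limit p. Several j may have the same
    index m, hence the choice.\<close>
  define Y where "Y = (\<lambda>m. if \<exists>j. n (r j) = m then x (r (SOME j. n (r j) = m)) else p)"
  have YK: "Y m \<in> K" for m using nx p(1) by (auto simp: Y_def)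
  have Y: "Y \<longlonglongrightarrow> p"
  proof (rule metric_LIMSEQ_I)
    fix d :: real assume "d > 0"
    then obtain J where J: "\<And>j. j \<ge> J \<Longrightarrow> dist (x (r j)) p < d"
      using metric_LIMSEQ_D[OF p(3)] by auto
    \<comment> \<open>This exceeds n (r j) for every j < J, so an index m \<ge> m0 can only belong
      to some j \<ge> J.\<close>
    define m0 where "m0 = Suc (\<Sum>j<J. n (r j))"
    have "dist (Y m) p < d" if m: "m \<ge> m0" for m
    proof (cases "\<exists>j. n (r j) = m")
      case True
      define j where "j = (SOME j. n (r j) = m)"
      have j: "n (r j) = m" unfolding j_def using True by (rule someI_ex)
      have "j \<ge> J"
      proof (rule ccontr)
        assume "\<not> j \<ge> J"
        then have "n (r j) \<le> (\<Sum>j<J. n (r j))" by (intro member_le_sum) auto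
        then show False using j m by (simp add: m0_def)
      qed
      then show ?thesis using J True by (simp add: Y_def j_def)
    next
      case False
      then show ?thesis using \<open>d > 0\<close> by (simp add: Y_def)
    qed
    then show "\<exists>no. \<forall>m\<ge>no. dist (Y m) p < d" by blast
  qed
  have "(\<lambda>m. f m (Y m)) \<longlonglongrightarrow> l p" by (rule cc[OF YK p(1) Y])
  moreover have "(\<lambda>m. l (Y m)) \<longlonglongrightarrow> l p"
    by (rule continuous_on_tendsto_compose[OF l Y p(1)]) (simp add: YK)
  ultimately have "(\<lambda>m. dist (f m (Y m)) (l (Y m))) \<longlonglongrightarrow> dist (l p) (l p)" by (rule tendsto_dist)
  then have "eventually (\<lambda>m. dist (f m (Y m)) (l (Y m)) < e) sequentially"
    using e(1) by (intro order_tendstoD(2)) auto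
  then obtain m0 where m0: "\<And>m. m \<ge> m0 \<Longrightarrow> dist (f m (Y m)) (l (Y m)) < e"
    by (auto simp: eventually_sequentially)
  define m where "m = n (r m0)"
  have "m \<ge> m0" using nx[of "r m0"] strict_mono_imp_increasing[OF p(2), of m0] by (simp add: m_def)
  have ex: "\<exists>j. n (r j) = m" unfolding m_def by blast
  define j where "j = (SOME j. n (r j) = m)"
  have j: "n (r j) = m" unfolding j_def using ex by (rule someI_ex)
  have "Y m = x (r j)" using ex by (simp add: Y_def j_def)
  then show False using m0[OF \<open>m \<ge> m0\<close>] nx[of "r j"] j by simp
qed

section \<open>Convergence of the rescaled kernel\<close>

context truncated_product
begin

text \<open>Measurability of \<open>Qfun\<close> in r is read off from the integrability in
  \<open>qline_quotient_eq\<close> at k = 0, where the exponential weight is 1.\<close>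

lemma Ps_Qs_integrand_measurable:
  assumes n: "n \<ge> 1"
  shows "(\<lambda>r. indicator {0..} r *\<^sub>R (Ps n (\<xi> + r) * Qs n (\<eta> + r))) \<in> borel_measurable borel"
proof -
  have b: "bsc n > 0" using bsc_pos[OF n] .
  have s: "\<sigma>l n > real n - 1" using \<sigma>l_gt[OF n] by simp
  have y: "X0 n * exp (bsc n * \<eta>) > 0" using X0_pos[OF n] by simp
  have k: "0 < n" using n by simp
  have "integrable lborel (\<lambda>r. indicator {0..} r *\<^sub>R (exp (of_real (bsc n * r * real 0)) * Qfun n (\<sigma>l n) (X0 n * exp (bsc n * \<eta>) * exp (bsc n * r))))"
    by (rule qline_quotient_eq(1)[OF n k s y b])
  from borel_measurable_integrable[OF this]
  have q: "(\<lambda>r. indicator {0..} r *\<^sub>R Qfun n (\<sigma>l n) (X0 n * exp (bsc n * (\<eta> + r)))) \<in> borel_measurable borel"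
    by (simp add: exp_add distrib_left mult.assoc)
  have e: "(\<lambda>r. of_real (bsc n) * exp (LF n (of_real (t0 n))) * of_real (exp (bsc n * (\<eta> + r) * t0 n))) \<in> borel_measurable borel"
    by (intro borel_measurable_continuous_onI continuous_intros)
  have P: "(\<lambda>r. Ps n (\<xi> + r)) \<in> borel_measurable borel"
    unfolding Ps_def Ppoly_def by (intro borel_measurable_continuous_onI continuous_intros)
  have "(\<lambda>r. Ps n (\<xi> + r) * ((of_real (bsc n) * exp (LF n (of_real (t0 n))) * of_real (exp (bsc n * (\<eta> + r) * t0 n))) * (indicator {0..} r *\<^sub>R Qfun n (\<sigma>l n) (X0 n * exp (bsc n * (\<eta> + r)))))) \<in> borel_measurable borel"
    by (intro borel_measurable_times P e q)
  then show ?thesis by (simp add: Qs_def)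
qed

lemma Ps_Qs_integral_tendsto:
  assumes X: "X \<longlonglongrightarrow> \<xi>" and Y: "Y \<longlonglongrightarrow> \<eta>"
  shows "(\<lambda>n. LBINT r. indicator {0..} r *\<^sub>R (Ps n (X n + r) * Qs n (Y n + r))) \<longlonglongrightarrow> Airy_kernel \<xi> \<eta>"
proof -
  obtain R where R: "\<And>n. norm (X n) \<le> R" using X by (meson BseqE convergentI convergent_imp_Bseq)
  obtain S where S: "\<And>n. norm (Y n) \<le> S" using Y by (meson BseqE convergentI convergent_imp_Bseq)
  have R0: "R \<ge> 0" using R[of 0] norm_ge_zero order_trans by blast
  have XR: "X n \<ge> - R" for n using R[of n] by (simp add: abs_le_iff)
  have YS: "Y n \<ge> - S" for n using S[of n] by (simp add: abs_le_iff)
  obtain C N1 where C: "C \<ge> 0" "\<And>n \<xi>. n \<ge> N1 \<Longrightarrow> \<xi> \<ge> - R \<Longrightarrow> norm (Ps n \<xi>) \<le> C"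
    by (rule Ps_bound[OF R0]) blast
  obtain D N2 where D: "D \<ge> 0" "\<And>n \<eta>. n \<ge> N2 \<Longrightarrow> norm (Qs n \<eta>) \<le> D * exp (- \<eta>)"
    by (rule Qs_bound) blast
  define N where "N = max 1 (max N1 N2)"
  have "(\<lambda>n. LBINT r. indicator {0..} r *\<^sub>R (Ps (n + N) (X (n + N) + r) * Qs (n + N) (Y (n + N) + r))) \<longlonglongrightarrow> airy_overlap \<xi> \<eta>"
    unfolding airy_overlap_def
  proof (rule integral_dominated_convergence[where w = "\<lambda>r. C * D * exp S * (indicator {0..} r *\<^sub>R exp (- 1 * r))"])
    show "integrable lborel (\<lambda>r. C * D * exp S * (indicator {0..} r *\<^sub>R exp (- 1 * r)))"
      by (intro integrable_mult_right integrable_exp_neg_halfline) auto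
    show "(\<lambda>r. indicator {0..} r *\<^sub>R (Airy_Ai (of_real (\<xi> + r)) * Airy_Ai (of_real (\<eta> + r)))) \<in> borel_measurable lborel"
      using airy_overlap_integrable by (rule borel_measurable_integrable)
    show "AE r in lborel. (\<lambda>n. indicator {0..} r *\<^sub>R (Ps (n + N) (X (n + N) + r) * Qs (n + N) (Y (n + N) + r)))
        \<longlonglongrightarrow> indicator {0..} r *\<^sub>R (Airy_Ai (of_real (\<xi> + r)) * Airy_Ai (of_real (\<eta> + r)))"
    proof (intro AE_I2 LIMSEQ_ignore_initial_segment)
      fix r :: real
      have "(\<lambda>n. X n + r) \<longlonglongrightarrow> \<xi> + r" "(\<lambda>n. Y n + r) \<longlonglongrightarrow> \<eta> + r" by (intro tendsto_intros X Y)+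
      then show "(\<lambda>n. indicator {0..} r *\<^sub>R (Ps n (X n + r) * Qs n (Y n + r))) \<longlonglongrightarrow> indicator {0..} r *\<^sub>R (Airy_Ai (of_real (\<xi> + r)) * Airy_Ai (of_real (\<eta> + r)))"
        by (intro tendsto_scaleR tendsto_const tendsto_mult Ps_tendsto Qs_tendsto)
    qed
    fix n
    show "(\<lambda>r. indicator {0..} r *\<^sub>R (Ps (n + N) (X (n + N) + r) * Qs (n + N) (Y (n + N) + r))) \<in> borel_measurable lborel"
      using Ps_Qs_integrand_measurable[of "n + N"] by (simp add: N_def)
    show "AE r in lborel. norm (indicator {0..} r *\<^sub>R (Ps (n + N) (X (n + N) + r) * Qs (n + N) (Y (n + N) + r)))
       \<le> C * D * exp S * (indicator {0..} r *\<^sub>R exp (- 1 * r))"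
    proof (intro AE_I2)
      fix r :: real
      show "norm (indicator {0..} r *\<^sub>R (Ps (n + N) (X (n + N) + r) * Qs (n + N) (Y (n + N) + r))) \<le> C * D * exp S * (indicator {0..} r *\<^sub>R exp (- 1 * r))"
      proof (cases "r \<ge> 0")
        case True
        have 1: "norm (Ps (n + N) (X (n + N) + r)) \<le> C"
          using XR[of "n + N"] True by (intro C(2)) (auto simp: N_def)
        have "norm (Qs (n + N) (Y (n + N) + r)) \<le> D * exp (- (Y (n + N) + r))" by (intro D(2)) (simp add: N_def)
        also have "\<dots> \<le> D * exp (S + - 1 * r)" using D(1) YS[of "n + N"] by (intro mult_left_mono) auto
        finally have "norm (Ps (n + N) (X (n + N) + r)) * norm (Qs (n + N) (Y (n + N) + r)) \<le> C * (D * exp (S + - 1 * r))"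
          using 1 C(1) by (intro mult_mono) auto
        then show ?thesis using True by (simp only: exp_add) (simp add: norm_mult mult_ac)
      qed simp
    qed
  qed
  then show ?thesis unfolding Airy_kernel_eq_overlap[symmetric] by (rule LIMSEQ_offset)
qed

text \<open>\<open>Ps\<close> and \<open>Qs\<close> contain exp (- b r t0) and exp (b r t0), which
  cancel inside the integral. The same factors without r leave exp (b t0 (\<xi> - \<eta>)).\<close>

lemma corr_kernel_eq_Ps_Qs:
  assumes n: "n \<ge> 1" and g: "admissible_contour n g"
  shows "corr_kernel M \<nu> \<kappa> g n (X0 n * exp (bsc n * \<xi>)) (X0 n * exp (bsc n * \<eta>)) =
    of_real (exp (bsc n * t0 n * (\<xi> - \<eta>)) / (bsc n * (X0 n * exp (bsc n * \<eta>)))) *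
    (LBINT r. indicator {0..} r *\<^sub>R (Ps n (\<xi> + r) * Qs n (\<eta> + r)))"
proof -
  let ?b = "bsc n" and ?y = "X0 n * exp (bsc n * \<eta>)"
  have b: "?b > 0" using bsc_pos[OF n] .
  have X: "X0 n > 0" using X0_pos[OF n] .
  have y: "?y > 0" using X by simp
  have s: "\<sigma>l n > real n - 1" using \<sigma>l_gt[OF n] by simp
  have "corr_kernel M \<nu> \<kappa> g n (X0 n * exp (?b * \<xi>)) ?y =
    of_real (?b / ?y) * (LBINT r. indicator {0..} r *\<^sub>R (Ppoly n (X0 n * exp (?b * \<xi>) * exp (?b * r)) * Qfun n (\<sigma>l n) (?y * exp (?b * r))))"
    using X by (intro corr_kernel_eq_overlap[OF n s _ y g b]) simp
  also have "(\<lambda>r. indicator {0..} r *\<^sub>R (Ppoly n (X0 n * exp (?b * \<xi>) * exp (?b * r)) * Qfun n (\<sigma>l n) (?y * exp (?b * r)))) =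
    (\<lambda>r. of_real (exp (?b * t0 n * (\<xi> - \<eta>)) / ?b\<^sup>2) * (indicator {0..} r *\<^sub>R (Ps n (\<xi> + r) * Qs n (\<eta> + r))))"
  proof
    fix r :: real
    let ?P = "Ppoly n (X0 n * exp (?b * (\<xi> + r)))" and ?Q = "Qfun n (\<sigma>l n) (X0 n * exp (?b * (\<eta> + r)))"
    have "Ps n (\<xi> + r) * Qs n (\<eta> + r) = of_real (?b\<^sup>2) * (exp (- LF n (of_real (t0 n))) * exp (LF n (of_real (t0 n)))) *
        of_real (exp (- ?b * (\<xi> + r) * t0 n) * exp (?b * (\<eta> + r) * t0 n)) * (?P * ?Q)"
      by (simp add: Ps_def Qs_def power2_eq_square mult_ac)
    also have "exp (- LF n (of_real (t0 n))) * exp (LF n (of_real (t0 n))) = 1" by (simp add: mult_exp_exp)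
    also have "exp (- ?b * (\<xi> + r) * t0 n) * exp (?b * (\<eta> + r) * t0 n) = exp (- (?b * t0 n * (\<xi> - \<eta>)))"
      by (simp add: mult_exp_exp algebra_simps)
    finally have "Ps n (\<xi> + r) * Qs n (\<eta> + r) = of_real (?b\<^sup>2) * of_real (exp (- (?b * t0 n * (\<xi> - \<eta>)))) * (?P * ?Q)" by simp
    moreover have "exp (?b * t0 n * (\<xi> - \<eta>)) * exp (- (?b * t0 n * (\<xi> - \<eta>))) = 1" by (simp add: mult_exp_exp)
    then have "complex_of_real (exp (?b * t0 n * (\<xi> - \<eta>))) * of_real (exp (- (?b * t0 n * (\<xi> - \<eta>)))) = 1"
      by (simp flip: of_real_mult)
    ultimately have "of_real (exp (?b * t0 n * (\<xi> - \<eta>)) / ?b\<^sup>2) * (Ps n (\<xi> + r) * Qs n (\<eta> + r)) = ?P * ?Q"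
      using b by (simp add: field_simps)
    moreover have "X0 n * exp (?b * \<xi>) * exp (?b * r) = X0 n * exp (?b * (\<xi> + r))" "?y * exp (?b * r) = X0 n * exp (?b * (\<eta> + r))"
      by (simp_all add: exp_add distrib_left)
    ultimately show "indicator {0..} r *\<^sub>R (Ppoly n (X0 n * exp (?b * \<xi>) * exp (?b * r)) * Qfun n (\<sigma>l n) (?y * exp (?b * r))) =
      of_real (exp (?b * t0 n * (\<xi> - \<eta>)) / ?b\<^sup>2) * (indicator {0..} r *\<^sub>R (Ps n (\<xi> + r) * Qs n (\<eta> + r)))"
      by (simp only: mult_scaleR_right)
  qed
  finally have "corr_kernel M \<nu> \<kappa> g n (X0 n * exp (?b * \<xi>)) ?y = of_real (?b / ?y) * (of_real (exp (?b * t0 n * (\<xi> - \<eta>)) / ?b\<^sup>2) *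
     (LBINT r. indicator {0..} r *\<^sub>R (Ps n (\<xi> + r) * Qs n (\<eta> + r))))"
    by (simp only: integral_mult_right_zero)
  moreover have "?b / ?y * (exp (?b * t0 n * (\<xi> - \<eta>)) / ?b\<^sup>2) = exp (?b * t0 n * (\<xi> - \<eta>)) / (?b * ?y)"
    using b y by (simp add: power2_eq_square)
  ultimately show ?thesis by (simp only: mult.assoc[symmetric] of_real_mult[symmetric])
qed

section \<open>The constants of the theorem\<close>

lemma acb_eq: "acb = (real M - 1) powr (2 / 3) / 2 powr (1 / 3)"
proof -
  have p: "real M - 1 > 0" using M by auto
  then have "(real M - 1)\<^sup>2 = (real M - 1) powr 2" by (simp add: powr_numeral)
  then have "((real M - 1)\<^sup>2) powr (1 / 3) = (real M - 1) powr (2 / 3)" by (simp only: powr_powr) simp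
  then show ?thesis using p by (simp add: acb_def powr_divide)
qed

text \<open>Hence \<open>c\<^sub>2 M / n powr (2 / 3)\<close> is \<open>x_star M * bsc n\<close>,
  and the kernel arguments in the theorem are X0 (1 + b \<xi>) and X0 (1 + b \<eta>).\<close>

lemma c2_eq: "c\<^sub>2 M = x_star M * acb"
proof -
  have p: "real M - 1 > 0" "real M + 1 > 0" using M by auto
  have "(real M - 1) powr ((real M - 1) / 2) = (real M - 1) powr (real M / 2 - 7 / 6) * (real M - 1) powr (2 / 3)"
    by (subst powr_add[symmetric]) (rule arg_cong[where f = "\<lambda>u. _ powr u"], simp add: field_simps)
  moreover have "(2::real) powr (4 / 3) = 2 * 2 powr (1 / 3)"
    using powr_add[of "2::real" 1 "1 / 3"] by simp
  ultimately show ?thesis using p by (simp add: c\<^sub>2_def x_star_def acb_eq)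
qed

text \<open>The rate in the exponential prefactor is the change of t0 ln x per unit of
  \<xi>.\<close>

lemma gauge_eq:
  "(real n / 2) powr (1 / 3) * (real M + 1) powr (1 / 2) * (real M - 1) powr (1 / 6) = bsc n * t0 n"
proof (cases "n = 0")
  case False
  have p: "real M - 1 > 0" "real M + 1 > 0" using M by auto
  have z: "zs M = (real M + 1) powr (1 / 2) / (real M - 1) powr (1 / 2)"
    using p by (simp add: zs_def powr_half_sqrt real_sqrt_divide)
  have m: "(real M - 1) powr (2 / 3) = (real M - 1) powr (1 / 6) * (real M - 1) powr (1 / 2)"
    using p by (simp add: powr_add[symmetric])
  have nn: "real n = real n powr (1 / 3) * real n powr (2 / 3)"
    using False by (simp add: powr_add[symmetric])
  have nd: "(real n / 2) powr (1 / 3) = real n powr (1 / 3) / 2 powr (1 / 3)" by (simp add: powr_divide)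
  have "bsc n * t0 n = acb * zs M * (real n / real n powr (2 / 3))" by (simp add: bsc_def t0_def)
  also have "real n / real n powr (2 / 3) = real n powr (1 / 3)" using False by (subst nn) simp
  also have "acb * zs M * real n powr (1 / 3) = (real n / 2) powr (1 / 3) * (real M + 1) powr (1 / 2) * (real M - 1) powr (1 / 6)"
    unfolding acb_eq z m nd using p by simp
  finally show ?thesis by simp
qed (simp add: t0_def)

text \<open>The theorem perturbs X0 by the factor 1 + b \<xi>, whereas \<open>Ps\<close> and
  \<open>Qs\<close> are built for exp (b \<xi>). With L = ln (1 + b \<xi>) / b the discrepancy L -
  \<xi> is of order b. In the prefactor it is multiplied by b t0, which grows, but b * (b t0) is of
  order n^(-1/3) and still vanishes.\<close>

lemma scaled_kernel_tendsto:
  assumes g: "\<And>n. admissible_contour n (g n)" and X: "X \<longlonglongrightarrow> \<xi>" and Y: "Y \<longlonglongrightarrow> \<eta>"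
  shows "(\<lambda>n. of_real (exp ((real n / 2) powr (1 / 3) * (real M + 1) powr (1 / 2) * (real M - 1) powr (1 / 6) * (Y n - X n)) *
                real n powr (real M - 5 / 3) * c\<^sub>2 M) *
       corr_kernel M \<nu> \<kappa> (g n) n
         (real n ^ (M - 1) * (x_star M + c\<^sub>2 M * X n / real n powr (2 / 3)))
         (real n ^ (M - 1) * (x_star M + c\<^sub>2 M * Y n / real n powr (2 / 3)))) \<longlonglongrightarrow> Airy_kernel \<xi> \<eta>"
proof -
  have b0: "bsc \<longlonglongrightarrow> 0" unfolding bsc_def[abs_def] using acb(1) by real_asymp
  have bt: "(\<lambda>n. bsc n * (bsc n * t0 n)) \<longlonglongrightarrow> 0"
    unfolding bsc_def t0_def using acb(1) zs_gt_1[OF M] by real_asymp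
  define L where "L = (\<lambda>n x. ln (1 + bsc n * x) / bsc n)"
  have small: "eventually (\<lambda>n. \<bar>bsc n * Z n\<bar> \<le> 1 / 2) sequentially" if "Z \<longlonglongrightarrow> \<zeta>" for Z \<zeta>
  proof -
    have "(\<lambda>n. \<bar>bsc n * Z n\<bar>) \<longlonglongrightarrow> \<bar>0 * \<zeta>\<bar>" by (intro tendsto_intros b0 that)
    then have "eventually (\<lambda>n. \<bar>bsc n * Z n\<bar> < 1 / 2) sequentially" by (rule order_tendstoD) simp
    then show ?thesis by eventually_elim simp
  qed
  have Lb: "\<bar>L n x - x\<bar> \<le> 2 * bsc n * x\<^sup>2" if "n \<ge> 1" "\<bar>bsc n * x\<bar> \<le> 1 / 2" for n x
  proof -
    have b: "bsc n > 0" using bsc_pos[OF that(1)] .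
    have "\<bar>ln (1 + bsc n * x) - bsc n * x\<bar> \<le> 2 * (bsc n * x)\<^sup>2"
      by (rule abs_ln_one_plus_x_minus_x_bound[OF that(2)])
    moreover have "L n x - x = (ln (1 + bsc n * x) - bsc n * x) / bsc n" using b by (simp add: L_def field_simps)
    ultimately have "\<bar>L n x - x\<bar> \<le> 2 * (bsc n * x)\<^sup>2 / bsc n" using b by (simp add: abs_divide divide_right_mono)
    then show ?thesis using b by (simp add: power2_eq_square mult_ac)
  qed
  have Lgauge: "(\<lambda>n. bsc n * t0 n * (L n (Z n) - Z n)) \<longlonglongrightarrow> 0" if Z: "Z \<longlonglongrightarrow> \<zeta>" for Z \<zeta>
  proof (rule Lim_null_comparison)
    have "(\<lambda>n. 2 * (bsc n * (bsc n * t0 n)) * (Z n)\<^sup>2) \<longlonglongrightarrow> 2 * 0 * \<zeta>\<^sup>2" by (intro tendsto_intros bt Z)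
    then show "(\<lambda>n. 2 * (bsc n * (bsc n * t0 n)) * (Z n)\<^sup>2) \<longlonglongrightarrow> 0" by simp
    show "eventually (\<lambda>n. norm (bsc n * t0 n * (L n (Z n) - Z n)) \<le> 2 * (bsc n * (bsc n * t0 n)) * (Z n)\<^sup>2) sequentially"
      using small[OF Z] eventually_ge_at_top[of 1]
    proof eventually_elim
      case (elim n)
      have bt0: "bsc n * t0 n \<ge> 0" using bsc_pos[OF elim(2)] t0_gt[OF elim(2)] by simp
      have "bsc n * t0 n * \<bar>L n (Z n) - Z n\<bar> \<le> bsc n * t0 n * (2 * bsc n * (Z n)\<^sup>2)"
        using Lb[OF elim(2,1)] bt0 by (rule mult_left_mono)
      then have "norm (bsc n * t0 n * (L n (Z n) - Z n)) \<le> bsc n * t0 n * (2 * bsc n * (Z n)\<^sup>2)"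
        using bt0 by (simp only: real_norm_def abs_mult[of "bsc n * t0 n"] abs_of_nonneg)
      then show ?case by (simp only: mult_ac)
    qed
  qed
  have Lt: "(\<lambda>n. L n (Z n)) \<longlonglongrightarrow> \<zeta>" if Z: "Z \<longlonglongrightarrow> \<zeta>" for Z \<zeta>
  proof -
    have "(\<lambda>n. L n (Z n) - Z n) \<longlonglongrightarrow> 0"
    proof (rule Lim_null_comparison)
      have "(\<lambda>n. 2 * bsc n * (Z n)\<^sup>2) \<longlonglongrightarrow> 2 * 0 * \<zeta>\<^sup>2" by (intro tendsto_intros b0 Z)
      then show "(\<lambda>n. 2 * bsc n * (Z n)\<^sup>2) \<longlonglongrightarrow> 0" by simp
      show "eventually (\<lambda>n. norm (L n (Z n) - Z n) \<le> 2 * bsc n * (Z n)\<^sup>2) sequentially"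
        using small[OF Z] eventually_ge_at_top[of 1] by eventually_elim (use Lb in auto)
    qed
    from tendsto_add[OF this Z] show ?thesis by simp
  qed
  let ?I = "\<lambda>n. LBINT r. indicator {0..} r *\<^sub>R (Ps n (L n (X n) + r) * Qs n (L n (Y n) + r))"
  \<comment> \<open>What remains of the prefactors: the effect of replacing L by its argument, and
    the ratio of X0 to the second argument of the kernel.\<close>
  let ?F = "\<lambda>n. exp (bsc n * t0 n * (L n (X n) - X n) - bsc n * t0 n * (L n (Y n) - Y n)) / (1 + bsc n * Y n)"
  have "(\<lambda>n. of_real (?F n) * ?I n) \<longlonglongrightarrow> of_real (exp (0 - 0) / (1 + 0 * \<eta>)) * Airy_kernel \<xi> \<eta>"
    by (intro tendsto_intros Lgauge[OF X] Lgauge[OF Y] b0 Y Ps_Qs_integral_tendsto Lt[OF X] Lt[OF Y]) auto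
  then have lim: "(\<lambda>n. of_real (?F n) * ?I n) \<longlonglongrightarrow> Airy_kernel \<xi> \<eta>" by simp
  show ?thesis
  proof (rule Lim_transform_eventually[OF lim])
    show "eventually (\<lambda>n. of_real (?F n) * ?I n = of_real (exp ((real n / 2) powr (1 / 3) * (real M + 1) powr (1 / 2) * (real M - 1) powr (1 / 6) * (Y n - X n)) *
                real n powr (real M - 5 / 3) * c\<^sub>2 M) *
       corr_kernel M \<nu> \<kappa> (g n) n
         (real n ^ (M - 1) * (x_star M + c\<^sub>2 M * X n / real n powr (2 / 3)))
         (real n ^ (M - 1) * (x_star M + c\<^sub>2 M * Y n / real n powr (2 / 3)))) sequentially"
      using small[OF X] small[OF Y] eventually_ge_at_top[of 1]
    proof eventually_elim
      case (elim n)
      have b: "bsc n > 0" using bsc_pos[OF elim(3)] .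
      have X0: "X0 n > 0" using X0_pos[OF elim(3)] .
      have arg: "real n ^ (M - 1) * (x_star M + c\<^sub>2 M * z / real n powr (2 / 3)) = X0 n * exp (bsc n * L n z)" if "\<bar>bsc n * z\<bar> \<le> 1 / 2" for z
      proof -
        have "1 + bsc n * z > 0" using that by (simp add: abs_le_iff)
        then have "exp (bsc n * L n z) = 1 + bsc n * z" using b by (simp add: L_def)
        then show ?thesis by (simp add: X0_def c2_eq bsc_def algebra_simps)
      qed
      have p: "1 + bsc n * Y n > 0" using elim(2) by (simp add: abs_le_iff)
      have eY: "exp (bsc n * L n (Y n)) = 1 + bsc n * Y n" using b p by (simp add: L_def)
      have pre: "real n powr (real M - 5 / 3) * c\<^sub>2 M = bsc n * X0 n"
      proof -
        have "real n ^ (M - 1) = real n powr (real M - 1)"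
          using elim(3) M by (simp add: powr_realpow[symmetric] of_nat_diff)
        moreover have "real n powr (real M - 1) = real n powr (real M - 5 / 3) * real n powr (2 / 3)"
          using elim(3) by (simp add: powr_add[symmetric])
        ultimately show ?thesis using elim(3) by (simp add: X0_def bsc_def c2_eq)
      qed
      let ?G = "bsc n * t0 n"
      have ex: "exp (?G * (Y n - X n)) * exp (?G * (L n (X n) - L n (Y n))) = exp (?G * (L n (X n) - X n) - ?G * (L n (Y n) - Y n))"
        by (simp add: mult_exp_exp algebra_simps)
      have "exp (?G * (Y n - X n)) * (bsc n * X0 n) * (exp (?G * (L n (X n) - L n (Y n))) / (bsc n * (X0 n * (1 + bsc n * Y n)))) = ?F n"
        unfolding ex[symmetric] using b X0 p by simp
      then show ?case
        unfolding gauge_eq arg[OF elim(1)] arg[OF elim(2)] corr_kernel_eq_Ps_Qs[OF elim(3) g]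
        unfolding eY mult.assoc[of "exp _" "real n powr _"] pre
        by (simp only: mult.assoc[symmetric] of_real_mult[symmetric])
    qed
  qed
qed

end

theorem theorem4p3:
  fixes M \<kappa> :: nat and \<nu> :: "nat \<Rightarrow> nat" and \<gamma> :: "nat \<Rightarrow> real \<Rightarrow> complex" and S :: "real set"
  assumes "M \<ge> 2" and "\<nu> 0 = 0" and "\<kappa> > \<nu> 1"
    and "\<And>n. admissible_contour n (\<gamma> n)"
    and "compact S"
  shows "uniform_limit (S \<times> S)
    (\<lambda>n (\<xi>, \<eta>).
       of_real (exp ((real n / 2) powr (1 / 3) * (real M + 1) powr (1 / 2) *
                     (real M - 1) powr (1 / 6) * (\<eta> - \<xi>)) *
                real n powr (real M - 5 / 3) * c\<^sub>2 M) *
       corr_kernel M \<nu> \<kappa> (\<gamma> n) n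
         (real n ^ (M - 1) * (x_star M + c\<^sub>2 M * \<xi> / real n powr (2 / 3)))
         (real n ^ (M - 1) * (x_star M + c\<^sub>2 M * \<eta> / real n powr (2 / 3))))
    (\<lambda>(\<xi>, \<eta>). Airy_kernel \<xi> \<eta>) sequentially"
proof -
  interpret truncated_product M \<kappa> \<nu>
    by unfold_locales (use assms in auto)
  show ?thesis
  proof (rule uniform_limit_compact_sequentially)
    show "compact (S \<times> S)" using assms(5) by (intro compact_Times)
    show "continuous_on (S \<times> S) (\<lambda>(\<xi>, \<eta>). Airy_kernel \<xi> \<eta>)"
      unfolding Airy_kernel_eq_overlap using airy_overlap_isCont
      by (intro continuous_at_imp_continuous_on) auto
    fix X :: "nat \<Rightarrow> real \<times> real" and p
    assume "X \<longlonglongrightarrow> p"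
    from scaled_kernel_tendsto[OF assms(4) tendsto_fst[OF this] tendsto_snd[OF this]]
    show "(\<lambda>n. (case X n of (\<xi>, \<eta>) \<Rightarrow>
       of_real (exp ((real n / 2) powr (1 / 3) * (real M + 1) powr (1 / 2) *
                     (real M - 1) powr (1 / 6) * (\<eta> - \<xi>)) *
                real n powr (real M - 5 / 3) * c\<^sub>2 M) *
       corr_kernel M \<nu> \<kappa> (\<gamma> n) n
         (real n ^ (M - 1) * (x_star M + c\<^sub>2 M * \<xi> / real n powr (2 / 3)))
         (real n ^ (M - 1) * (x_star M + c\<^sub>2 M * \<eta> / real n powr (2 / 3)))))
       \<longlonglongrightarrow> (case p of (\<xi>, \<eta>) \<Rightarrow> Airy_kernel \<xi> \<eta>)"
      by (simp add: case_prod_beta)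
  qed
qed

end
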